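(* Let $F_{24}:=(6,\{02,03,04,12,15\})$. Then $\lambda_{F_{24}}=5/54$. Furthermore, the $F_{24}$-problem is perfectly $B$-stable with $B:=(6,\{01,12,23,34,45,50\})$, and the unique (up to automorphisms of $B$) maximiser of $p(F_{24},B(\boldsymbol x))$ over $\boldsymbol x\in\mathbb S_6$ is $\boldsymbol x=(1/6,1/6,1/6,1/6,1/6,1/6)$.
   Context: All graphs are finite and simple. $(m,E)$ denotes the graph or pattern with vertex set $\{0,\dots,m-1\}$ and edge set $E$; $ij$ abbreviates $\{i,j\}$ ($ii$ is a loop). For graphs $F,G$ with $\kappa\le n$ vertices, $p(F,G)$ is the number of $\kappa$-subsets of $V(G)$ inducing a subgraph isomorphic to $F$, divided by $\binom n\kappa$; $p(F,n)$ is the maximum of $p(F,G)$ over $n$-vertex graphs $G$; $\lambda_F=\lim_{n\to\infty}p(F,n)$ (the limit exists). A pattern is a graph in which loops are allowed; its automorphisms are the bijections of the vertex set preserving edges, non-edges, loops and non-loops. For a pattern $B$ on $\{0,\dots,m-1\}$ and disjoint (possibly empty) sets $V_0,\dots,V_{m-1}$, the blowup $B(V_0,\dots,V_{m-1})$ is the simple graph on $\bigcup V_i$ in which distinct $x\in V_i$, $y\in V_j$ are adjacent iff $\{i,j\}\in E(B)$ (so $V_i$ is a clique if $i$ has a loop and independent otherwise); $B()$ is the family of all blowups. $\mathbb S_m=\{\boldsymbol x\in\mathbb R^m:x_i\ge0,\sum x_i=1\}$, and $p(F,B(\boldsymbol x))$ is the limit as $n\to\infty$ of $p(F,B(V_0,\dots,V_{m-1}))$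 with $|V_i|=(x_i+o(1))n$. $\delta_{\mathrm{edit}}(G,B())$ is the minimum number of vertex pairs whose adjacency must be changed to turn $G$ into a graph isomorphic to a blowup of $B$ (of the same order). The $F$-problem is perfectly $B$-stable if there is $C>0$ such that every graph $G$ with $n\ge C$ vertices satisfies $\delta_{\mathrm{edit}}(G,B())\le C\,(p(F,n)-p(F,G))\,n^2$. *)

theory Defs
  imports Complex_Main "HOL-Library.Disjoint_Sets"
begin

text \<open>A graph or pattern is a pair of a vertex set and an edge set; the edge \<open>ij\<close> is the set
  \<open>{i, j}\<close>, so a loop at \<open>i\<close> is the singleton \<open>{i}\<close>.\<close>

type_synonym 'a graph = "'a set \<times> 'a set set"

abbreviation verts :: "'a graph \<Rightarrow> 'a set" where "verts G \<equiv> fst G"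
abbreviation edges :: "'a graph \<Rightarrow> 'a set set" where "edges G \<equiv> snd G"

definition simple_graph :: "'a graph \<Rightarrow> bool" where
  "simple_graph G \<longleftrightarrow> finite (verts G) \<and> (\<forall>e\<in>edges G. e \<subseteq> verts G \<and> card e = 2)"

definition isomorphism :: "('a \<Rightarrow> 'b) \<Rightarrow> 'a graph \<Rightarrow> 'b graph \<Rightarrow> bool" where
  "isomorphism f G H \<longleftrightarrow> bij_betw f (verts G) (verts H) \<and>
     (\<forall>x\<in>verts G. \<forall>y\<in>verts G. {x, y} \<in> edges G \<longleftrightarrow> {f x, f y} \<in> edges H)"

definition isomorphic :: "'a graph \<Rightarrow> 'b graph \<Rightarrow> bool" where
  "isomorphic G H \<longleftrightarrow> (\<exists>f. isomorphism f G H)"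

abbreviation automorphism :: "('a \<Rightarrow> 'a) \<Rightarrow> 'a graph \<Rightarrow> bool" where
  "automorphism f G \<equiv> isomorphism f G G"

definition induced :: "'a graph \<Rightarrow> 'a set \<Rightarrow> 'a graph" where
  "induced G S = (S, {e \<in> edges G. e \<subseteq> S})"

definition density :: "'b graph \<Rightarrow> 'a graph \<Rightarrow> real" where
  "density F G =
     real (card {S. S \<subseteq> verts G \<and> card S = card (verts F) \<and> isomorphic (induced G S) F})
     / real (card (verts G) choose card (verts F))"

text \<open>Every finite graph has an isomorphic copy with vertices in \<open>nat\<close>, so these suffice for
  the maximum, which is over a finite set of values.\<close>

definition max_density :: "'b graph \<Rightarrow> nat \<Rightarrow> real" where
  "max_density F n = Max {density F G | G :: nat graph. simple_graph G \<and> card (verts G) = n}"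

definition inducibility :: "'b graph \<Rightarrow> real" where
  "inducibility F = lim (max_density F)"

definition blowup :: "'b graph \<Rightarrow> ('b \<Rightarrow> 'a set) \<Rightarrow> 'a graph" where
  "blowup B V = (\<Union>i\<in>verts B. V i,
     {{x, y} | x y i j. i \<in> verts B \<and> j \<in> verts B \<and> x \<in> V i \<and> y \<in> V j \<and> x \<noteq> y \<and> {i, j} \<in> edges B})"

definition blowup_parts :: "'b graph \<Rightarrow> ('b \<Rightarrow> 'a set) \<Rightarrow> bool" where
  "blowup_parts B V \<longleftrightarrow> (\<forall>i\<in>verts B. finite (V i)) \<and> disjoint_family_on V (verts B)"

definition blowups :: "'b graph \<Rightarrow> 'a graph set" where
  "blowups B = {blowup B V | V. blowup_parts B V}"

definition edit_distance :: "'a graph \<Rightarrow> 'b graph \<Rightarrow> nat" where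
  "edit_distance G B = (LEAST k. \<exists>H H' :: 'a graph. simple_graph H \<and> verts H = verts G \<and>
     H' \<in> blowups B \<and> isomorphic H H' \<and>
     k = card (sym_diff (edges G) (edges H)))"

definition perfectly_stable :: "'c graph \<Rightarrow> 'b graph \<Rightarrow> bool" where
  "perfectly_stable F B \<longleftrightarrow> (\<exists>C::real. C > 0 \<and>
     (\<forall>(G :: nat graph) n. simple_graph G \<and> card (verts G) = n \<and> real n \<ge> C \<longrightarrow>
        real (edit_distance G B) \<le> C * (max_density F n - density F G) * (real n)\<^sup>2))"

text \<open>Points of \<open>\<real>\<^sup>m\<close> are the functions on \<open>nat\<close> that vanish from \<open>m\<close> on.\<close>

definition simplex :: "nat \<Rightarrow> (nat \<Rightarrow> real) set" where
  "simplex m = {x. (\<forall>i<m. 0 \<le> x i) \<and> (\<forall>i\<ge>m. x i = 0) \<and> (\<Sum>i<m. x i) = 1}"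

text \<open>The limit of the density of \<open>F\<close>, which for \<open>x\<close> in the simplex is the same for all sequences
  of blowups of \<open>B\<close> with part sizes \<open>(x i + o(1)) * n\<close>.\<close>

definition limit_density :: "'c graph \<Rightarrow> nat graph \<Rightarrow> (nat \<Rightarrow> real) \<Rightarrow> real" where
  "limit_density F B x = (THE L. \<forall>V :: nat \<Rightarrow> nat \<Rightarrow> nat set.
     (\<forall>n. blowup_parts B (V n)) \<and>
     (\<forall>i\<in>verts B. (\<lambda>n. real (card (V n i)) / real n) \<longlonglongrightarrow> x i) \<longrightarrow>
     (\<lambda>n. density F (blowup B (V n))) \<longlonglongrightarrow> L)"

definition is_maximiser :: "'c graph \<Rightarrow> nat \<Rightarrow> nat graph \<Rightarrow> (nat \<Rightarrow> real) \<Rightarrow> bool" where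
  "is_maximiser F m B x \<longleftrightarrow>
     x \<in> simplex m \<and> (\<forall>y\<in>simplex m. limit_density F B y \<le> limit_density F B x)"

definition unique_maximiser :: "'c graph \<Rightarrow> nat \<Rightarrow> nat graph \<Rightarrow> (nat \<Rightarrow> real) \<Rightarrow> bool" where
  "unique_maximiser F m B x \<longleftrightarrow> is_maximiser F m B x \<and>
     (\<forall>y. is_maximiser F m B y \<longrightarrow> (\<exists>f. automorphism f B \<and> (\<forall>i<m. y i = x (f i))))"

definition F24 :: "nat graph" where
  "F24 = ({..<6}, {{0, 2}, {0, 3}, {0, 4}, {1, 2}, {1, 5}})"

definition C6 :: "nat graph" where
  "C6 = ({..<6}, {{0, 1}, {1, 2}, {2, 3}, {3, 4}, {4, 5}, {5, 0}})"

end

theory Submission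
  imports Defs "HOL-Combinatorics.Multiset_Permutations"
begin

text \<open>
  An induced copy of the tree \<open>F24\<close> is an induced path on four vertices together with two
  further nonadjacent vertices whose only neighbour on the path is its first vertex. It is counted
  through ordered 6-tuples of vertices with repetitions allowed: \<open>copies E V\<close> is the number
  of tuples that list the path and then the two further vertices, which may coincide.
  Each induced copy of \<open>F24\<close> gives two such tuples, and the tuples with coinciding last
  vertices are induced paths on five vertices, so there are at most \<open>n ^ 5\<close> of them.

  \<^bold>\<open>Upper bound.\<close> A flag algebra certificate with integer data gives, for every graph on
  \<open>n\<close> vertices, the exact identity \<open>flag_identity\<close>: \<open>270000 * n ^ 6\<close> is
  \<open>1049760000 * copies\<close>, plus a nonnegative combination \<open>sos\<close> of squares, plus the sum
  of \<open>excess\<close> over all 6-tuples. The excess of a tuple depends only on the isomorphism type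
  of the pattern that it spans. By \<open>excess_bound\<close> it is at least 536, unless the six
  vertices can be coloured by the vertices of the hexagon such that adjacency is adjacency of the
  colours, and then it is 0. This is a finite check. To keep it small, every graph on six vertices
  is written as an extension of one of the 34 graphs on five vertices, and the excess of the
  extension is evaluated by rewriting. Since \<open>1049760000 = 3888 * 270000\<close>, there are at most
  \<open>n ^ 6 / 3888\<close> copies, and the inducibility is at most \<open>720 / 2 / 3888 = 5/54\<close>.
  Balanced blowups of the hexagon attain this.

  \<^bold>\<open>Stability.\<close> All induced paths on four vertices of the hexagon are
  equivalent under its symmetries, and a vertex of the hexagon is determined by its neighbours in such
  a path. So an induced path \<open>r\<close> in \<open>G\<close> suggests a colouring of all vertices. If a pair of vertices disagrees with this colouring, then \<open>r\<close> with this pair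
  has excess at least 536. So if every colouring has at least \<open>e\<close> disagreeing pairs, then the
  excess sums up to at least \<open>536 * e\<close> times the number of such paths
  (\<open>excess_ge_mismatches\<close>). This bounds \<open>e\<close> by the distance of the density of \<open>G\<close>
  from the limit \<open>5/54\<close>, but the maximum for a finite \<open>n\<close> differs from the limit. Therefore
  \<open>G\<close> is compared with the blowup \<open>H\<close> of the hexagon that has the best colouring of
  \<open>G\<close>. Both satisfy the identity, and the excess of \<open>H\<close> is 0. The parts of \<open>H\<close> have
  almost equal sizes by compactness, because \<open>H\<close> has almost as many copies as possible. Every sum
  that is squared in \<open>sos\<close> vanishes on a balanced blowup, hence it is small on \<open>H\<close>, and
  the squares of \<open>H\<close> exceed those of \<open>G\<close> by at most a small multiple of
  \<open>e * n ^ 4\<close> (\<open>sos_diff\<close>). Thus \<open>H\<close> has at least \<open>\<kappa> * e * n ^ 4\<close> more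
  copies than \<open>G\<close> (\<open>improvement\<close>), while the paths on five vertices change by at most
  \<open>25 * e * n ^ 3\<close>. Since \<open>H\<close> competes in the maximum, \<open>e\<close> is at most a
  constant times \<open>n ^ 2\<close> times the deficit of the density of \<open>G\<close>.

  \<^bold>\<open>Maximiser.\<close> The limit density of blowups is 360 times the polynomial \<open>hexpoly\<close> in
  the part sizes. It has two halves, and each of them is a quadratic form in the sizes of one class
  of the bipartite hexagon with coefficients from the other class. Bounding the halves for fixed total sizes
  \<open>A\<close> and \<open>B\<close> of the two classes leaves \<open>2 * A\<^sup>2 * B\<^sup>2 * (A\<^sup>2 + B\<^sup>2) / 243\<close> to maximise
  subject to \<open>A + B = 1\<close>.
\<close>

section \<open>The certificate\<close>

text \<open>The five lists \<open>cert_edge\<close>, \<open>cert_cherry\<close>, \<open>cert_claw\<close>, \<open>cert_matching\<close> and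
\<open>cert_nonedge\<close> encode positive semidefinite matrices, each as a sum of rank one matrices: an
entry \<open>(c, v)\<close> stands for \<open>c\<close> times the outer product of \<open>v\<close> with itself. The
first four are indexed by the neighbourhoods of a vertex in a fixed graph on four vertices, and the
last by the ways to attach a pair of vertices to a nonadjacent pair. They were found numerically by
semidefinite programming and rounded; the proof rests on the
positivity of the coefficients and on \<open>excess_bound\<close>.\<close>

definition cert_edge :: "(int \<times> int list) list" where
  "cert_edge =
    [(35146, [0, 0, 0, 0, 0, 1, -1, 0, 0, 1, -1, 0, 0, 0, 0, 0]), (3460, [0, 0, 0, 0, 0, 1, 0, 0,
    0, 0, -1, 0, 0, 0, 0, 0]), (1805, [0, 0, 0, 0, 2, 3, 3, -1, -2, -3, -3, 1, 0, 0, 0, 0]),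
    (782, [2, -4, -4, -2, 0, 0, 0, -1, 0, 0, 0, -1, 5, 5, 5, -6]), (611, [0, 1, -1, 0, 0, 6, -6,
    0, 0, 6, -6, 0, 0, 1, -1, 0]), (350, [1, -3, -3, -2, 1, 0, 0, 0, 1, 0, 0, 0, 4, 4, 4, -6]),
    (302, [2, -3, -3, -3, -1, 0, 0, -1, -1, 0, 0, -1, 4, 3, 3, 3]), (275, [1, -4, -4, -3, 1, 0,
    0, -1, 1, 0, 0, -1, 6, 5, 5, -3]), (245, [3, -4, -4, -4, -1, 0, 0, -1, -1, 0, 0, -1, 5, 4, 4,
    6]), (204, [0, 3, 3, 1, -1, 0, 0, 0, -1, 0, 0, 0, -5, -4, -4, 6]), (59, [2, -4, -4, -3, -1,
    0, 0, -1, -1, 0, 0, -1, 5, 5, 5, -2])]"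

definition cert_cherry :: "(int \<times> int list) list" where
  "cert_cherry =
    [(9646, [0, 0, 0, 0, 0, 0, 0, 0, 0, 0, 0, 1, 0, -1, 0, 0]), (5466, [1, -1, -1, -1, 0, 0, 0,
    0, 2, -2, 0, 0, 1, 0, -1, 0]), (4598, [0, 0, 1, 1, -1, -1, 0, 0, 0, 0, 1, 4, -1, -4, 0, 0]),
    (931, [2, -5, -5, -3, -3, -2, 2, 1, 10, -11, 2, 0, 4, 0, -4, -1]), (633, [1, 2, 4, 1, 3, 1,
    -2, 0, -6, 7, -1, 0, -2, 0, 3, 1]), (542, [2, -3, -3, -2, -2, -1, 1, -1, 7, -8, 1, 0, 2, 0,
    -4, -1]), (483, [4, 0, 3, 0, 2, -1, -3, -1, -1, 3, 0, 0, -1, 0, 0, -3]), (474, [5, -1, 0, 0,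
    0, -1, -2, -4, 4, -4, 0, 3, -1, 0, -5, -2]), (475, [0, 0, 1, 0, -1, 0, 0, 0, 0, 0, 1, 4, -1,
    -3, 0, 0]), (380, [5, 1, 2, 1, 1, 0, -4, -6, 0, 2, -1, 6, -2, 6, -3, -1]), (289, [8, 0, 5,
    -1, 4, -1, -6, -4, 0, 4, -1, 1, -1, 1, -2, -5]), (195, [2, 3, 6, 1, 5, 0, -4, -1, -8, 11, -2,
    -3, -2, -3, 4, 1]), (112, [0, 2, -2, 4, -3, 3, 0, -6, 1, -3, -1, 6, -3, 5, -5, 4]), (13, [1,
    -3, -3, -2, -2, -1, 1, 0, 7, -7, 2, 0, 2, 0, -3, -1]), (11, [8, 0, 6, -3, 5, -3, -6, -3, -2,
    6, -1, 1, -1, 1, 0, -5]), (7, [3, -3, -2, -2, -1, -1, 0, -1, 7, -7, 1, 0, 2, 1, -4, -2]), (3,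
    [3, -3, -2, -2, -1, -1, 0, -1, 7, -7, 1, 1, 2, 1, -4, -1])]"

definition cert_claw :: "(int \<times> int list) list" where
  "cert_claw =
    [(3565, [1, -1, 0, 0, 5, -1, 0, 0, 1, 0, -4, -1, 1, 1, 0, 0]), (1742, [0, 0, 6, -1, -6, 1, 0,
    0, 0, 0, 6, 3, -6, -3, 0, 0]), (975, [0, 0, 4, -1, 0, 0, 4, 2, -4, 1, 0, 0, -4, -2, 0, 0]),
    (760, [1, -2, 5, -2, 5, -2, -3, 0, 5, -2, -3, 0, -3, 0, 1, 1]), (287, [5, -1, 0, 1, 0, 1, 1,
    -3, 0, 1, 1, -3, 1, -3, -4, -6]), (255, [2, -1, 1, 0, 1, 0, 0, -1, 1, 0, 0, -1, 0, -1, -1,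
    -2]), (177, [0, 1, -5, 1, -1, 0, 0, 0, -1, 0, 0, 0, 4, 1, -1, -1]), (141, [2, -4, 10, -3, 10,
    -3, -6, 0, 10, -3, -6, 0, -6, 0, 2, 1]), (90, [0, 0, 6, -1, 0, 0, 6, 2, -6, 1, 0, 0, -6, -2,
    0, 0])]"

definition cert_matching :: "(int \<times> int list) list" where
  "cert_matching =
    [(30999, [0, 1, 0, -1, 0, -1, 0, 0, -1, 0, 1, 0, 1, 0, 0, 0]), (4900, [0, 2, 3, -5, -1, -1,
    -1, 0, 0, 0, -3, 1, 1, 0, 0, 1]), (3177, [0, 1, 2, -3, 0, -1, -1, 0, 1, 0, -3, 1, -1, 0, 0,
    3]), (1410, [0, 4, 3, -6, -2, -2, -1, 0, -1, 0, -2, 1, 2, 1, -1, 1]), (797, [0, 6, 0, -6, 0,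
    -6, 0, 1, -6, 0, 6, 0, 6, 0, 0, 0]), (614, [1, -2, -3, 5, 0, 2, 1, 0, -1, 1, 4, -1, 1, 0, 0,
    -4]), (169, [0, 3, -2, -1, -2, -1, -3, -6, 1, 3, 1, 6, 1, 6, -6, 0]), (90, [1, -3, -4, 7, 1,
    2, 1, 0, 0, 0, 4, -1, -1, 0, 0, -1])]"

definition cert_nonedge :: "(int \<times> int list) list" where
  "cert_nonedge =
    [(2272, [0, 0, 0, 0, 2, 0, 4, 0, -5, 0, 0, -1, 1, 0, -1, -2, 1, 0, 0, 0]), (833, [0, 1, -1,
    0, 0, 0, 1, 0, -1, 0, 0, -1, 1, 0, -2, 0, -4, 2, 4, 0]), (452, [0, 1, -1, 0, -2, -1, -7, 0,
    9, 0, 0, 4, -4, 0, 2, 3, 0, 0, -2, 2]), (380, [0, 1, -2, 0, 0, 0, -3, -2, 5, 0, 0, 6, -6, 0,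
    0, 3, 0, 1, -2, 0]), (345, [0, 1, -1, 0, 2, 0, 5, -2, -5, 0, 0, 1, -1, 0, -2, 0, 0, 2, 0,
    0]), (268, [2, 3, 1, 3, 8, -3, 2, 6, 2, 0, -4, -1, -7, -4, -1, -9, 2, 0, 2, 0]), (152, [0, 2,
    1, -3, -4, -1, -8, 0, 10, 2, 4, 4, -4, 0, 2, 2, -2, 0, -1, 3]), (148, [0, 3, 1, 3, 4, 0, 1,
    4, -3, -2, -4, -1, -3, 0, -2, -8, 1, -1, 1, 0]), (101, [0, 10, 5, -8, 4, -6, 1, 2, 0, 6, 2,
    2, -10, 4, 0, -7, 1, 2, 2, 1]), (78, [0, 9, 5, -7, 2, -3, 0, 2, 1, 2, 4, 0, -8, 4, -2, -7,
    -1, 0, 0, -1]), (67, [0, 7, 4, -1, 6, -5, 0, 4, 5, 2, 0, 0, -8, 0, 0, -8, -1, 1, 0, 1]), (57,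
    [0, 1, -1, 0, 0, 0, 0, 0, 0, 0, 0, -1, 1, 0, -2, 0, -6, 2, 6, 0]), (51, [0, 2, -2, 1, 0, 0,
    -6, 0, 5, 0, -2, 5, -5, 0, -1, 0, -3, 1, 2, -1]), (33, [6, 4, 0, 2, 12, -6, 2, 10, 7, 2, -8,
    0, -16, -8, 0, -10, 1, 1, 1, -6]), (30, [4, -1, -2, 2, 6, -4, 2, 4, 10, 4, -4, 1, -9, -8, 3,
    1, 1, 2, 1, -6]), (29, [0, 0, 0, 0, 2, 0, 7, -2, -7, 0, 0, -2, 2, 0, -1, 0, -2, 1, 2, 2]),
    (24, [2, 1, -1, 0, 0, -2, -4, 2, 11, 2, 0, 2, -6, -4, 2, 2, 0, 1, -2, 4]), (13, [2, -2, 2, 0,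
    0, -3, 1, 4, 6, 2, 0, -6, 2, -4, 3, 1, 0, 0, -2, 2]), (12, [2, 10, 3, -4, 6, -6, 0, 6, 5, 2,
    0, 0, -12, 0, 0, -9, -1, 1, 0, 0]), (8, [2, 1, -1, 0, 0, -3, -5, 2, 13, 2, 0, 3, -7, -4, 3,
    3, 0, 2, -3, 6]), (2, [4, 7, 2, -4, 6, -6, 0, 4, 7, 6, -2, 3, -15, -4, 0, -5, 1, 2, 0, 0])]"

text \<open>A pair of vertices attached to a nonadjacent pair of roots is coded by five bits. The two vertices
of the pair are not ordered, so the 32 codes fall into 20 classes, which index the vectors of
\<open>cert_nonedge\<close>.\<close>

definition flag_index :: "nat list" where
  "flag_index =
    [0, 1, 2, 3, 1, 4, 5, 6, 2, 5, 7, 8, 3, 6, 8, 9, 10, 11, 12, 13, 11, 14, 15, 16, 12, 15, 17,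
    18, 13, 16, 18, 19]"

text \<open>In \<open>classes_2\<close>, \<open>classes_3\<close> and \<open>classes_4\<close> an entry consists of the edges of a
representative of an isomorphism class and of witnesses: for each set of neighbours of a new vertex,
a permutation that takes the extension to a representative of the next list.\<close>

definition classes_2 :: "((nat \<times> nat) list \<times> nat list list) list" where
  "classes_2 =
    [([], [[0, 1, 2], [0, 2, 1], [1, 2, 0], [2, 0, 1]]), ([(0, 1)], [[0, 1, 2], [0, 1, 2], [1, 0,
    2], [0, 1, 2]])]"

definition classes_3 :: "((nat \<times> nat) list \<times> nat list list) list" where
  "classes_3 =
    [([], [[0, 1, 2, 3], [0, 3, 1, 2], [1, 3, 0, 2], [3, 0, 1, 2], [2, 3, 0, 1], [3, 0, 2, 1],
    [3, 1, 2, 0], [3, 0, 1, 2]]), ([(0, 1)], [[0, 1, 2, 3], [0, 1, 3, 2], [1, 0, 3, 2], [0, 1, 3,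
    2], [0, 2, 3, 1], [0, 3, 2, 1], [1, 3, 2, 0], [3, 0, 1, 2]]), ([(0, 1), (0, 2)], [[0, 1, 2,
    3], [0, 1, 2, 3], [0, 1, 3, 2], [0, 1, 3, 2], [0, 2, 3, 1], [0, 2, 3, 1], [0, 3, 1, 2], [0,
    3, 1, 2]]), ([(0, 1), (0, 2), (1, 2)], [[0, 1, 2, 3], [0, 1, 2, 3], [1, 0, 2, 3], [0, 1, 2,
    3], [2, 0, 1, 3], [0, 2, 1, 3], [1, 2, 0, 3], [0, 1, 2, 3]])]"

definition classes_4 :: "((nat \<times> nat) list \<times> nat list list) list" where
  "classes_4 =
    [([], [[0, 1, 2, 3, 4], [0, 4, 1, 2, 3], [1, 4, 0, 2, 3], [4, 0, 1, 2, 3], [2, 4, 0, 1, 3],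
    [4, 0, 2, 1, 3], [4, 1, 2, 0, 3], [4, 0, 1, 2, 3], [3, 4, 0, 1, 2], [4, 0, 3, 1, 2], [4, 1,
    3, 0, 2], [4, 0, 1, 3, 2], [4, 2, 3, 0, 1], [4, 0, 2, 3, 1], [4, 1, 2, 3, 0], [4, 0, 1, 2,
    3]]), ([(0, 1)], [[0, 1, 2, 3, 4], [0, 1, 4, 2, 3], [1, 0, 4, 2, 3], [0, 1, 4, 2, 3], [0, 2,
    4, 1, 3], [0, 4, 2, 1, 3], [1, 4, 2, 0, 3], [4, 0, 1, 2, 3], [0, 3, 4, 1, 2], [0, 4, 3, 1,
    2], [1, 4, 3, 0, 2], [4, 0, 1, 3, 2], [4, 0, 1, 2, 3], [4, 0, 1, 2, 3], [4, 1, 0, 2, 3], [4,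
    0, 1, 2, 3]]), ([(0, 1), (0, 2)], [[0, 1, 2, 3, 4], [0, 1, 2, 4, 3], [0, 1, 4, 2, 3], [0, 1,
    4, 2, 3], [0, 2, 4, 1, 3], [0, 2, 4, 1, 3], [0, 4, 1, 2, 3], [0, 4, 1, 2, 3], [0, 3, 4, 1,
    2], [0, 4, 3, 1, 2], [0, 4, 1, 3, 2], [0, 4, 1, 3, 2], [0, 4, 2, 3, 1], [0, 4, 2, 3, 1], [4,
    0, 1, 2, 3], [4, 0, 1, 2, 3]]), ([(0, 1), (0, 2), (0, 3)], [[0, 1, 2, 3, 4], [0, 1, 2, 3, 4],
    [0, 1, 4, 2, 3], [0, 1, 4, 2, 3], [0, 2, 4, 1, 3], [0, 2, 4, 1, 3], [0, 4, 1, 2, 3], [0, 4,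
    1, 2, 3], [0, 3, 4, 1, 2], [0, 3, 4, 1, 2], [0, 4, 1, 3, 2], [0, 4, 1, 3, 2], [0, 4, 2, 3,
    1], [0, 4, 2, 3, 1], [0, 4, 1, 2, 3], [0, 4, 1, 2, 3]]), ([(0, 1), (0, 2), (1, 2)], [[0, 1,
    2, 3, 4], [0, 1, 2, 4, 3], [1, 0, 2, 4, 3], [0, 1, 2, 4, 3], [2, 0, 1, 4, 3], [0, 2, 1, 4,
    3], [1, 2, 0, 4, 3], [0, 1, 2, 4, 3], [3, 0, 1, 2, 4], [4, 0, 1, 2, 3], [4, 1, 0, 2, 3], [4,
    0, 1, 2, 3], [4, 2, 0, 1, 3], [4, 0, 2, 1, 3], [4, 1, 2, 0, 3], [4, 0, 1, 2, 3]]), ([(1, 2),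
    (0, 3)], [[0, 1, 2, 3, 4], [0, 1, 2, 3, 4], [1, 0, 3, 2, 4], [0, 1, 4, 2, 3], [2, 0, 3, 1,
    4], [0, 2, 4, 1, 3], [0, 1, 2, 4, 3], [0, 4, 1, 2, 3], [3, 1, 2, 0, 4], [1, 0, 3, 4, 2], [1,
    3, 4, 0, 2], [1, 4, 0, 3, 2], [2, 3, 4, 0, 1], [2, 4, 0, 3, 1], [3, 4, 1, 2, 0], [4, 0, 1, 2,
    3]]), ([(0, 1), (1, 2), (0, 3)], [[0, 1, 2, 3, 4], [0, 1, 2, 3, 4], [1, 0, 3, 2, 4], [0, 1,
    4, 2, 3], [0, 2, 1, 4, 3], [0, 2, 1, 4, 3], [0, 1, 2, 4, 3], [0, 1, 4, 2, 3], [1, 3, 0, 4,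
    2], [1, 0, 3, 4, 2], [1, 3, 0, 4, 2], [1, 0, 4, 3, 2], [0, 2, 4, 3, 1], [0, 4, 2, 1, 3], [1,
    4, 3, 0, 2], [4, 0, 1, 2, 3]]), ([(0, 1), (0, 2), (1, 2), (0, 3)], [[0, 1, 2, 3, 4], [0, 1,
    2, 3, 4], [0, 1, 2, 4, 3], [0, 1, 2, 4, 3], [0, 2, 1, 4, 3], [0, 2, 1, 4, 3], [0, 1, 2, 4,
    3], [0, 1, 2, 4, 3], [3, 0, 1, 2, 4], [0, 1, 3, 4, 2], [0, 1, 4, 3, 2], [0, 1, 4, 3, 2], [0,
    2, 4, 3, 1], [0, 2, 4, 3, 1], [0, 4, 1, 2, 3], [0, 4, 1, 2, 3]]), ([(0, 2), (1, 2), (0, 3),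
    (1, 3)], [[0, 1, 2, 3, 4], [0, 1, 2, 3, 4], [1, 0, 2, 3, 4], [0, 1, 2, 3, 4], [2, 3, 0, 1,
    4], [0, 2, 1, 3, 4], [1, 2, 0, 3, 4], [0, 1, 2, 4, 3], [3, 2, 0, 1, 4], [0, 3, 1, 2, 4], [1,
    3, 0, 2, 4], [0, 1, 3, 4, 2], [2, 3, 0, 1, 4], [2, 3, 0, 4, 1], [2, 3, 1, 4, 0], [4, 0, 1, 2,
    3]]), ([(0, 1), (0, 2), (1, 2), (0, 3), (1, 3)], [[0, 1, 2, 3, 4], [0, 1, 2, 3, 4], [1, 0, 2,
    3, 4], [0, 1, 2, 3, 4], [2, 0, 1, 3, 4], [0, 1, 2, 4, 3], [1, 0, 2, 4, 3], [0, 1, 2, 4, 3],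
    [3, 0, 1, 2, 4], [0, 1, 3, 4, 2], [1, 0, 3, 4, 2], [0, 1, 3, 4, 2], [2, 3, 0, 1, 4], [0, 1,
    4, 2, 3], [1, 0, 4, 2, 3], [0, 1, 4, 2, 3]]), ([(0, 1), (0, 2), (1, 2), (0, 3), (1, 3), (2,
    3)], [[0, 1, 2, 3, 4], [0, 1, 2, 3, 4], [1, 0, 2, 3, 4], [0, 1, 2, 3, 4], [2, 0, 1, 3, 4],
    [0, 2, 1, 3, 4], [1, 2, 0, 3, 4], [0, 1, 2, 3, 4], [3, 0, 1, 2, 4], [0, 3, 1, 2, 4], [1, 3,
    0, 2, 4], [0, 1, 3, 2, 4], [2, 3, 0, 1, 4], [0, 2, 3, 1, 4], [1, 2, 3, 0, 4], [0, 1, 2, 3,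
    4]])]"

text \<open>Here the second component contains the colourings of the representative by the vertices of the
hexagon for which adjacency is adjacency of the colours. Enough of them are listed to cover all extensions
by a sixth vertex that can be coloured.\<close>

definition classes_5 :: "((nat \<times> nat) list \<times> nat list list) list" where
  "classes_5 =
    [([], [[0, 0, 0, 0, 2], [0, 0, 2, 4, 0], [0, 2, 0, 4, 4], [0, 2, 4, 2, 4], [0, 0, 2, 2, 2],
    [0, 2, 0, 0, 2], [0, 2, 2, 0, 0], [0, 2, 2, 0, 2], [0, 2, 2, 2, 0], [0, 0, 0, 2, 0], [0, 0,
    0, 2, 2], [0, 0, 2, 0, 0], [0, 0, 2, 0, 2], [0, 0, 2, 2, 0], [0, 2, 0, 0, 0], [0, 2, 0, 2,
    0], [0, 2, 0, 2, 2], [0, 2, 2, 2, 2]]), ([(0, 1)], [[0, 1, 3, 3, 3], [0, 1, 4, 4, 4]]), ([(0,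
    1), (0, 2)], [[0, 1, 1, 3, 3], [0, 1, 5, 3, 3], [0, 1, 1, 4, 4]]), ([(0, 1), (0, 2), (0, 3)],
    [[0, 1, 1, 1, 3], [0, 1, 1, 5, 3], [0, 1, 5, 1, 3], [0, 1, 5, 5, 3], [0, 1, 1, 1, 4]]), ([(0,
    1), (0, 2), (0, 3), (0, 4)], [[0, 1, 1, 1, 5], [0, 1, 1, 5, 1], [0, 1, 1, 5, 5], [0, 1, 5, 1,
    1], [0, 1, 5, 1, 5], [0, 1, 5, 5, 1], [0, 1, 5, 5, 5]]), ([(0, 1), (0, 2), (1, 2)], []),
    ([(1, 2), (0, 3)], []), ([(0, 1), (1, 2), (0, 3)], []), ([(0, 1), (0, 2), (1, 2), (0, 3)],
    []), ([(1, 2), (0, 3), (0, 4)], [[0, 2, 3, 5, 5], [0, 3, 2, 5, 5]]), ([(0, 1), (1, 2), (0,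
    3), (0, 4)], [[0, 1, 2, 5, 5]]), ([(0, 1), (0, 2), (1, 2), (0, 3), (0, 4)], []), ([(0, 2),
    (1, 2), (0, 3), (1, 3)], [[0, 0, 1, 1, 3], [0, 0, 1, 5, 3], [0, 2, 1, 1, 4], [0, 0, 1, 1,
    4]]), ([(0, 1), (0, 2), (1, 2), (0, 3), (1, 3)], []), ([(0, 2), (1, 2), (1, 3), (0, 4)], [[0,
    2, 1, 3, 5]]), ([(0, 1), (0, 2), (1, 2), (1, 3), (0, 4)], []), ([(0, 2), (1, 2), (0, 3), (1,
    3), (0, 4)], [[0, 2, 1, 1, 5]]), ([(0, 1), (0, 2), (1, 2), (0, 3), (1, 3), (0, 4)], []),
    ([(0, 2), (1, 2), (0, 3), (1, 3), (0, 4), (1, 4)], [[0, 0, 1, 1, 5], [0, 0, 1, 5, 1], [0, 0,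
    1, 5, 5], [0, 2, 1, 1, 1]]), ([(0, 1), (0, 2), (1, 2), (0, 3), (1, 3), (0, 4), (1, 4)], []),
    ([(0, 1), (0, 2), (1, 2), (0, 3), (1, 3), (2, 3)], []), ([(1, 2), (1, 3), (2, 3), (0, 4)],
    []), ([(0, 1), (1, 2), (1, 3), (2, 3), (0, 4)], []), ([(0, 1), (0, 2), (1, 2), (1, 3), (2,
    3), (0, 4)], []), ([(0, 1), (0, 2), (1, 2), (0, 3), (1, 3), (2, 3), (0, 4)], []), ([(0, 1),
    (0, 2), (0, 3), (2, 3), (0, 4), (1, 4)], []), ([(1, 2), (0, 3), (2, 3), (0, 4), (1, 4)], []),
    ([(0, 1), (1, 2), (0, 3), (2, 3), (0, 4), (1, 4)], []), ([(0, 1), (0, 2), (1, 2), (0, 3), (2,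
    3), (0, 4), (1, 4)], []), ([(0, 2), (1, 2), (0, 3), (1, 3), (2, 3), (0, 4), (1, 4)], []),
    ([(0, 1), (0, 2), (1, 2), (0, 3), (1, 3), (2, 3), (0, 4), (1, 4)], []), ([(0, 1), (0, 2), (0,
    3), (1, 3), (2, 3), (0, 4), (1, 4), (2, 4)], []), ([(0, 1), (0, 2), (1, 2), (0, 3), (1, 3),
    (2, 3), (0, 4), (1, 4), (2, 4)], []), ([(0, 1), (0, 2), (1, 2), (0, 3), (1, 3), (2, 3), (0,
    4), (1, 4), (2, 4), (3, 4)], [])]"

text \<open>Lists of bits are read as binary numbers with the least significant bit first.\<close>

definition bidx :: "bool list \<Rightarrow> nat" where
  "bidx bs = foldr (\<lambda>b n. of_bool b + 2 * n) bs 0"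

definition form :: "(int \<times> int list) list \<Rightarrow> nat \<Rightarrow> nat \<Rightarrow> int" where
  "form cs i j = (\<Sum>(c, v)\<leftarrow>cs. c * (v ! i) * (v ! j))"

definition root_edge :: "bool list" where "root_edge = [True, False, False, False, False, False]"

definition root_cherry :: "bool list" where "root_cherry = [True, True, False, False, False, False]"

definition root_claw :: "bool list" where "root_claw = [True, True, False, True, False, False]"

definition root_matching :: "bool list" where "root_matching = [False, False, True, True, False, False]"

definition root_path :: "bool list" where "root_path = [True, False, True, False, False, True]"

definition cert_roots :: "(bool list \<times> (int \<times> int list) list) list" where
  "cert_roots = [(root_edge, cert_edge), (root_cherry, cert_cherry), (root_claw, cert_claw),
     (root_matching, cert_matching)]"

definition kernel4 :: "bool list \<Rightarrow> bool list \<Rightarrow> bool list \<Rightarrow> int" where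
  "kernel4 r Y Z = (\<Sum>(r', cs)\<leftarrow>cert_roots. if r = r' then form cs (bidx Y) (bidx Z) else 0)"

text \<open>This is \<open>F24\<close>, drawn as a path with two pendant vertices at its first vertex, except that the two
pendant vertices may coincide.\<close>

definition copy4 :: "bool list \<Rightarrow> bool list \<Rightarrow> bool list \<Rightarrow> bool \<Rightarrow> bool" where
  "copy4 r Y Z e \<longleftrightarrow> r = root_path \<and> Y = [True, False, False, False] \<and> Z = [True, False, False, False] \<and> \<not> e"

definition kernel2 :: "bool \<Rightarrow> bool list \<Rightarrow> bool list \<Rightarrow> int" where
  "kernel2 e Y Z = (if e then 0 else form cert_nonedge (flag_index ! bidx Y) (flag_index ! bidx Z))"

definition pattern :: "('a \<Rightarrow> 'a \<Rightarrow> bool) \<Rightarrow> 'a list \<Rightarrow> nat \<Rightarrow> nat \<Rightarrow> bool" where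
  "pattern E xs i j = E (xs ! i) (xs ! j)"

text \<open>The pattern with a given code: in \<open>bits n p\<close> the pairs \<open>i < j\<close> are sorted by \<open>j\<close> and
then by \<open>i\<close>, so that a new vertex appends bits.\<close>

definition entry :: "bool list \<Rightarrow> nat \<Rightarrow> nat \<Rightarrow> bool" where
  "entry l i j = (if i = j then False else l ! (if i < j then j * (j - 1) div 2 + i else i * (i - 1) div 2 + j))"

definition bits :: "nat \<Rightarrow> (nat \<Rightarrow> nat \<Rightarrow> bool) \<Rightarrow> bool list" where
  "bits n p = concat (map (\<lambda>j. map (\<lambda>i. p i j) [0..<j]) [0..<n])"

definition orders4 :: "nat list list" where
  "orders4 = [[0, 1, 2, 3], [0, 1, 3, 2], [0, 2, 1, 3], [0, 2, 3, 1], [0, 3, 1, 2], [0, 3, 2, 1], [1, 0, 2, 3], [1, 0, 3, 2], [1, 2, 0, 3], [1, 2, 3, 0], [1, 3, 0, 2], [1, 3, 2, 0], [2, 0, 1, 3], [2, 0, 3, 1], [2, 1, 0, 3], [2, 1, 3, 0], [2, 3, 0, 1], [2, 3, 1, 0], [3, 0, 1, 2], [3, 0, 2, 1], [3, 1, 0, 2], [3, 1, 2, 0], [3, 2, 0, 1], [3, 2, 1, 0]]"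

definition term4 :: "bool list \<Rightarrow> bool list \<Rightarrow> bool list \<Rightarrow> bool \<Rightarrow> int" where
  "term4 r Y Z e = kernel4 r Y Z + (if copy4 r Y Z e then 2916000 else 0)"

definition sum4 :: "bool list \<Rightarrow> bool list \<Rightarrow> bool list \<Rightarrow> bool \<Rightarrow> int" where
  "sum4 r Y Z e = (\<Sum>s\<leftarrow>orders4. term4 (bits 4 (pattern (entry r) s)) (map ((!) Y) s) (map ((!) Z) s) e)"

definition sum2 :: "bool \<Rightarrow> bool list \<Rightarrow> bool list \<Rightarrow> int" where
  "sum2 e Y Z = kernel2 e Y Z + kernel2 e (map ((!) Y) [1, 0, 3, 2, 4]) (map ((!) Z) [1, 0, 3, 2, 4])"

definition splits4 :: "(nat list \<times> nat list) list" where
  "splits4 =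
    [([0, 1, 2, 3], [4, 5]), ([0, 1, 2, 4], [3, 5]), ([0, 1, 2, 5], [3, 4]), ([0, 1, 3, 4], [2,
    5]), ([0, 1, 3, 5], [2, 4]), ([0, 1, 4, 5], [2, 3]), ([0, 2, 3, 4], [1, 5]), ([0, 2, 3, 5],
    [1, 4]), ([0, 2, 4, 5], [1, 3]), ([0, 3, 4, 5], [1, 2]), ([1, 2, 3, 4], [0, 5]), ([1, 2, 3,
    5], [0, 4]), ([1, 2, 4, 5], [0, 3]), ([1, 3, 4, 5], [0, 2]), ([2, 3, 4, 5], [0, 1])]"

text \<open>Each choice of a root pair leaves four vertices, which split into two pairs in three ways.\<close>

definition splits2 :: "(nat list \<times> nat list \<times> nat list) list" where
  "splits2 = concat (map (\<lambda>(R, S).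
    [(S, [R ! 0, R ! 1], [R ! 2, R ! 3]), (S, [R ! 0, R ! 2], [R ! 1, R ! 3]), (S, [R ! 0, R ! 3], [R ! 1, R ! 2])]) splits4)"

text \<open>The functions \<open>quad_part\<close> and \<open>pair_part\<close> are the contributions of the root sets to the
certificate on six vertices. All ways to choose an ordered root and
then the rest are grouped by the underlying sets: \<open>splits4\<close> lists the choices of four roots,
and \<open>splits2\<close> those of two roots and two unordered pairs. The functions \<open>sum4\<close> and
\<open>sum2\<close> sum over the orders of the root.\<close>

definition quad_part :: "(nat \<Rightarrow> nat \<Rightarrow> bool) \<Rightarrow> nat list \<times> nat list \<Rightarrow> int" where
  "quad_part p = (\<lambda>(R, S). sum4 (bits 4 (pattern p R)) (map (\<lambda>x. p x (S ! 0)) R) (map (\<lambda>x. p x (S ! 1)) R) (p (S ! 0) (S ! 1)))"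

definition pair_part :: "(nat \<Rightarrow> nat \<Rightarrow> bool) \<Rightarrow> nat list \<times> nat list \<times> nat list \<Rightarrow> int" where
  "pair_part p = (\<lambda>(R, S, T). sum2 (p (R ! 0) (R ! 1))
          [p (R ! 0) (S ! 0), p (R ! 1) (S ! 0), p (R ! 0) (S ! 1), p (R ! 1) (S ! 1), p (S ! 0) (S ! 1)]
          [p (R ! 0) (T ! 0), p (R ! 1) (T ! 0), p (R ! 0) (T ! 1), p (R ! 1) (T ! 1), p (T ! 0) (T ! 1)])"

text \<open>The slack of the certificate on a pattern with six vertices.\<close>

definition excess :: "(nat \<Rightarrow> nat \<Rightarrow> bool) \<Rightarrow> int" where
  "excess p = 270000 - (\<Sum>x\<leftarrow>splits4. quad_part p x) - (\<Sum>x\<leftarrow>splits2. pair_part p x)"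

text \<open>The following tables are computed once by the simplifier and then used as rewrite rules, so that the
evaluation of \<open>excess\<close> on more than a thousand patterns amounts to table lookups and additions.\<close>

schematic_goal gram_edge: "map (\<lambda>i. map (form cert_edge i) [0..<16]) [0..<16] = ?M"
  by (simp add: form_def cert_edge_def upt_rec_numeral upt_rec)

schematic_goal gram_cherry: "map (\<lambda>i. map (form cert_cherry i) [0..<16]) [0..<16] = ?M"
  by (simp add: form_def cert_cherry_def upt_rec_numeral upt_rec)

schematic_goal gram_claw: "map (\<lambda>i. map (form cert_claw i) [0..<16]) [0..<16] = ?M"
  by (simp add: form_def cert_claw_def upt_rec_numeral upt_rec)

schematic_goal gram_matching: "map (\<lambda>i. map (form cert_matching i) [0..<16]) [0..<16] = ?M"
  by (simp add: form_def cert_matching_def upt_rec_numeral upt_rec)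

schematic_goal gram_nonedge: "map (\<lambda>i. map (form cert_nonedge i) [0..<20]) [0..<20] = ?M"
  by (simp add: form_def cert_nonedge_def upt_rec_numeral upt_rec)

lemma map_upt16: "map f [0..<16] = [f 0, f (Suc 0), f 2, f 3, f 4, f 5, f 6, f 7, f 8, f 9, f 10, f 11, f 12, f 13, f 14, f 15]"
  by (simp add: eval_nat_numeral)

lemma map_upt20: "map f [0..<20] = [f 0, f (Suc 0), f 2, f 3, f 4, f 5, f 6, f 7, f 8, f 9, f 10, f 11, f 12, f 13, f 14, f 15, f 16, f 17, f 18, f 19]"
  by (simp add: eval_nat_numeral)

lemmas gram_rules = gram_edge[unfolded map_upt16, simplified] gram_cherry[unfolded map_upt16, simplified]
  gram_claw[unfolded map_upt16, simplified] gram_matching[unfolded map_upt16, simplified] gram_nonedge[unfolded map_upt20, simplified]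

text \<open>Universal quantifiers over bits are expanded such that a check can run through all codes.\<close>

lemma all_bool: "(\<forall>b. P b) \<longleftrightarrow> P False \<and> P True" by (metis (full_types))

schematic_goal bidx_table: "map bidx [[a,b,c,d]. d \<leftarrow> [False, True], c \<leftarrow> [False, True], b \<leftarrow> [False, True], a \<leftarrow> [False, True]] = ?M"
  by (simp add: bidx_def)

lemmas bidx_rules = bidx_table[simplified]

schematic_goal flag_table: "map (\<lambda>bs. flag_index ! bidx bs) [[a,b,c,d,e]. e \<leftarrow> [False, True], d \<leftarrow> [False, True], c \<leftarrow> [False, True], b \<leftarrow> [False, True], a \<leftarrow> [False, True]] = ?M"
  by (simp add: bidx_def flag_index_def)

lemmas flag_rules = flag_table[simplified list.map concat.simps append_Cons append_Nil, simplified list.inject simp_thms]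

lemma bits4: "bits 4 p = [p 0 1, p 0 2, p 1 2, p 0 3, p 1 3, p 2 3]"
  by (simp add: bits_def eval_nat_numeral)

lemma copy4_eq: "copy4 r [y0,y1,y2,y3] [z0,z1,z2,z3] e \<longleftrightarrow> r = root_path \<and> (y0 \<and> z0 \<and> \<not> y1 \<and> \<not> z1 \<and> \<not> y2 \<and> \<not> z2 \<and> \<not> y3 \<and> \<not> z3 \<and> \<not> e)"
  by (auto simp: copy4_def)

schematic_goal sum4_table: "map (\<lambda>r. sum4 r [y0,y1,y2,y3] [z0,z1,z2,z3] e) [[a,b,c,d,f,g]. g \<leftarrow> [False, True], f \<leftarrow> [False, True], d \<leftarrow> [False, True], c \<leftarrow> [False, True], b \<leftarrow> [False, True], a \<leftarrow> [False, True]] = ?M"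
  by (simp add: sum4_def term4_def orders4_def bits4 pattern_def entry_def kernel4_def cert_roots_def copy4_eq root_edge_def root_cherry_def root_claw_def root_matching_def root_path_def)

lemmas sum4_rules = sum4_table[simplified list.map concat.simps append_Cons append_Nil, simplified list.inject simp_thms]

text \<open>The adjacency of \<open>C6\<close>, as a relation that can be evaluated in finite checks.\<close>

definition hex :: "nat \<Rightarrow> nat \<Rightarrow> bool" where
  "hex i j \<longleftrightarrow> (i, j) \<in> {(0, 1), (1, 0), (1, 2), (2, 1), (2, 3), (3, 2), (3, 4), (4, 3), (4, 5), (5, 4), (5, 0), (0, 5)}"

definition hex_trace :: "nat list \<Rightarrow> nat \<Rightarrow> bool list" where
  "hex_trace c v = map (\<lambda>x. hex x v) c"

definition edge_bits :: "nat \<Rightarrow> (nat \<times> nat) list \<Rightarrow> bool list" where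
  "edge_bits n es = bits n (\<lambda>i j. (i, j) \<in> set es)"

text \<open>The right-hand side is the excess as a sum of table entries for symbolic bits. Instances of this rule
avoid the expansion of the definition for each pattern.\<close>

schematic_goal excess_rule: "excess (entry [a,b,c,d,e,f,g,h,i,j,k,l,m,n,p]) = ?X"
  by (simp add: excess_def quad_part_def pair_part_def splits4_def splits2_def bits4 pattern_def entry_def del: sum4_rules)

lemma sum2_eq: "sum2 e [y0,y1,y2,y3,y4] [z0,z1,z2,z3,z4] = (if e then 0 else
   form cert_nonedge (flag_index ! bidx [y0,y1,y2,y3,y4]) (flag_index ! bidx [z0,z1,z2,z3,z4]) +
   form cert_nonedge (flag_index ! bidx [y1,y0,y3,y2,y4]) (flag_index ! bidx [z1,z0,z3,z2,z4]))"
  by (simp add: sum2_def kernel2_def)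

lemma bits5: "bits 5 p = [p 0 1, p 0 2, p 1 2, p 0 3, p 1 3, p 2 3, p 0 4, p 1 4, p 2 4, p 3 4]"
  by (simp add: bits_def eval_nat_numeral)

text \<open>The list \<open>cs\<close> provides the colours of the first five vertices, so only the colour of the sixth
is searched for.\<close>

definition colourable_by :: "nat list list \<Rightarrow> bool list \<Rightarrow> bool" where
  "colourable_by cs t = list_ex (\<lambda>c. list_ex (\<lambda>v. t = hex_trace c v) [0,Suc 0,2,3,4,5]) cs"

definition settled :: "int \<Rightarrow> nat list list \<Rightarrow> bool list \<Rightarrow> bool" where
  "settled x cs t = (if 536 \<le> x then True else x = 0 \<and> colourable_by cs t)"

definition class_ok :: "bool list \<Rightarrow> nat list list \<Rightarrow> bool" where
  "class_ok r cs \<longleftrightarrow> (\<forall>a b c d e. settled (excess (entry (r @ [a,b,c,d,e]))) cs [a,b,c,d,e])"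

lemma class_ok_expand: "class_ok [a,b,c,d,e,f,g,h,i,j] cs =
  list_all (\<lambda>t. settled (excess (entry ([a,b,c,d,e,f,g,h,i,j] @ t))) cs t)
    [[a,b,c,d,e]. a \<leftarrow> [False, True], b \<leftarrow> [False, True], c \<leftarrow> [False, True], d \<leftarrow> [False, True], e \<leftarrow> [False, True]]"
  by (simp add: class_ok_def all_bool conj_assoc)

lemmas class_ok_rule = class_ok_expand[simplified list.map concat.simps append_Cons append_Nil list.pred_inject]

schematic_goal hex_table: "map (\<lambda>i. map (hex i) [0,1,2,3,4,5]) [0,1,2,3,4,5] = ?M"
  by (simp add: hex_def)

lemmas hex_rules = hex_table[simplified]

schematic_goal classes_bits: "map (\<lambda>(es, cs). (edge_bits 5 es, cs)) classes_5 = ?M"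
  by (simp add: classes_5_def edge_bits_def bits5)

text \<open>This is the verification of the certificate. By the symmetry of the excess it suffices to treat one
representative of each graph on five vertices and all 32 neighbourhoods of a sixth vertex.\<close>

lemma classes_ok: "list_all (\<lambda>(r, cs). class_ok r cs) (map (\<lambda>(es, cs). (edge_bits 5 es, cs)) classes_5)"
  unfolding classes_bits
  by (simp only: list.pred_inject prod.case class_ok_rule excess_rule sum2_eq sum4_rules bidx_rules flag_rules gram_rules if_True if_False
    add_0_left add_0_right arith_simps rel_simps diff_numeral_simps HOL.simp_thms settled_def colourable_by_def list_ex_Nil_iff list_ex_Cons_iff hex_trace_def
    list.map hex_rules list.inject)

section \<open>The excess as an average over all orders\<close>

definition graphlike :: "('a \<Rightarrow> 'a \<Rightarrow> bool) \<Rightarrow> bool" where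
  "graphlike E \<longleftrightarrow> (\<forall>x y. E x y = E y x) \<and> (\<forall>x. \<not> E x x)"

lemma graphlike_pattern: "graphlike E \<Longrightarrow> graphlike (pattern E xs)"
  by (simp add: graphlike_def pattern_def)

lemma sum_permutations_split:
  assumes "finite A" "k \<le> card A"
  shows "(\<Sum>zs\<in>permutations_of_set A. f zs) =
    (\<Sum>R | R \<subseteq> A \<and> card R = k. \<Sum>xs\<in>permutations_of_set R. \<Sum>ys\<in>permutations_of_set (A - R). f (xs @ ys))"
proof -
  have fin: "finite {R. R \<subseteq> A \<and> card R = k}" using assms(1) by simp
  have "(\<Sum>R | R \<subseteq> A \<and> card R = k. \<Sum>xs\<in>permutations_of_set R. \<Sum>ys\<in>permutations_of_set (A - R). f (xs @ ys)) =
    (\<Sum>(R, xs, ys)\<in>Sigma {R. R \<subseteq> A \<and> card R = k} (\<lambda>R. permutations_of_set R \<times> permutations_of_set (A - R)). f (xs @ ys))"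
    using fin by (simp add: sum.Sigma sum.cartesian_product)
  also have "\<dots> = (\<Sum>zs\<in>permutations_of_set A. f zs)"
  proof (rule sum.reindex_bij_witness[where j = "\<lambda>(R, xs, ys). xs @ ys" and i = "\<lambda>zs. (set (take k zs), take k zs, drop k zs)"])
    fix a assume "a \<in> Sigma {R. R \<subseteq> A \<and> card R = k} (\<lambda>R. permutations_of_set R \<times> permutations_of_set (A - R))"
    then obtain R xs ys where a: "a = (R, xs, ys)" "R \<subseteq> A" "card R = k" "xs \<in> permutations_of_set R" "ys \<in> permutations_of_set (A - R)"
      by auto
    have l: "length xs = k" using a by (simp add: permutations_of_set_def distinct_card[symmetric])
    show "(set (take k (case a of (R, xs, ys) \<Rightarrow> xs @ ys)), take k (case a of (R, xs, ys) \<Rightarrow> xs @ ys),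
         drop k (case a of (R, xs, ys) \<Rightarrow> xs @ ys)) = a"
      using a l by (auto simp: permutations_of_set_def)
    show "(case a of (R, xs, ys) \<Rightarrow> xs @ ys) \<in> permutations_of_set A"
      using a by (auto simp: permutations_of_set_def)
    show "f (case a of (R, xs, ys) \<Rightarrow> xs @ ys) = (case a of (R, xs, ys) \<Rightarrow> f (xs @ ys))"
      by (simp add: a)
  next
    fix zs assume z: "zs \<in> permutations_of_set A"
    then have zs: "set zs = A" "distinct zs" by (auto simp: permutations_of_set_def)
    then have l: "length zs = card A" by (metis distinct_card)
    have "set (take k zs) \<union> set (drop k zs) = A" using zs by (metis append_take_drop_id set_append)
    moreover have "set (take k zs) \<inter> set (drop k zs) = {}" using zs(2) set_take_disj_set_drop_if_distinct by blast
    ultimately have d: "set (drop k zs) = A - set (take k zs)" by blast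
    show "(case (set (take k zs), take k zs, drop k zs) of (R, xs, ys) \<Rightarrow> xs @ ys) = zs" by simp
    show "(set (take k zs), take k zs, drop k zs)
         \<in> Sigma {R. R \<subseteq> A \<and> card R = k} (\<lambda>R. permutations_of_set R \<times> permutations_of_set (A - R))"
      using zs l assms(2) d set_take_subset[of k zs] by (auto simp: permutations_of_set_def distinct_card)
  qed
  finally show ?thesis by simp
qed

lemma permutations_nth:
  assumes "distinct xs"
  shows "permutations_of_set (set xs) = (\<lambda>s. map ((!) xs) s) ` permutations_of_set {..<length xs}"
proof -
  have "set xs = (!) xs ` {..<length xs}" by (auto simp: in_set_conv_nth)
  moreover have "inj_on ((!) xs) {..<length xs}" using assms by (auto simp: inj_on_def nth_eq_iff_index_eq)
  ultimately show ?thesis by (metis permutations_of_set_image_inj)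
qed

lemma sum_permutations_nth:
  assumes "distinct xs"
  shows "(\<Sum>zs\<in>permutations_of_set (set xs). f zs) = (\<Sum>s\<in>permutations_of_set {..<length xs}. f (map ((!) xs) s))"
proof -
  have "inj_on (\<lambda>s. map ((!) xs) s) (permutations_of_set {..<length xs})"
  proof (rule inj_onI)
    fix s t assume "s \<in> permutations_of_set {..<length xs}" "t \<in> permutations_of_set {..<length xs}" "map ((!) xs) s = map ((!) xs) t"
    then show "s = t" using assms
      by (intro map_inj_on[of "(!) xs"]) (auto simp: permutations_of_set_def nth_eq_iff_index_eq inj_on_def)
  qed
  then show ?thesis by (simp add: permutations_nth[OF assms] sum.reindex)
qed

lemma orders4: "permutations_of_set {..<4} = set orders4" "distinct orders4"
proof -
  have "permutations_of_set (set [0,1,2,3::nat]) = set orders4" by code_simp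
  moreover have "{..<4} = set [0,1,2,3::nat]" by (auto simp: eval_nat_numeral less_Suc_eq)
  ultimately show "permutations_of_set {..<4} = set orders4" by simp
  show "distinct orders4" by code_simp
qed

lemma sum_orders4:
  assumes "distinct xs" "length xs = 4"
  shows "(\<Sum>zs\<in>permutations_of_set (set xs). f zs) = (\<Sum>s\<leftarrow>orders4. f (map ((!) xs) s))"
  using assms by (simp add: sum_permutations_nth orders4 sum.distinct_set_conv_list)

lemma sum_orders2:
  assumes "distinct [a, b]"
  shows "(\<Sum>zs\<in>permutations_of_set {a, b}. f zs) = f [a, b] + f [b, a]"
proof -
  have "permutations_of_set {a, b} = {[a, b], [b, a]}"
    using assms by (auto simp: permutations_of_set_nonempty insert_Diff_if)
  then show ?thesis using assms by simp
qed

lemma splits4_sets: "{R. R \<subseteq> {..<6} \<and> card R = 4} = set (map (set \<circ> fst) splits4)" "distinct (map (set \<circ> fst) splits4)"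
proof -
  have "{R \<in> Pow (set [0,1,2,3,4,5::nat]). card R = 4} = set (map (set \<circ> fst) splits4)" by code_simp
  moreover have "{..<6} = set [0,1,2,3,4,5::nat]" by (auto simp: eval_nat_numeral less_Suc_eq)
  ultimately show "{R. R \<subseteq> {..<6} \<and> card R = 4} = set (map (set \<circ> fst) splits4)" by (simp add: Pow_def)
  show "distinct (map (set \<circ> fst) splits4)" by code_simp
qed

text \<open>The two flags can be exchanged, so that it suffices to enumerate unordered pairs of flags.\<close>

lemma form_sym: "form cs j i = form cs i j"
  unfolding form_def by (intro arg_cong[where f = sum_list] map_cong refl) auto

lemma kernel4_sym: "kernel4 r Z Y = kernel4 r Y Z"
  unfolding kernel4_def by (intro arg_cong[where f = sum_list] map_cong refl) (auto simp: form_sym)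

lemma term4_sym: "term4 r Z Y e = term4 r Y Z e"
  by (auto simp: term4_def kernel4_sym copy4_def)

lemma bits_Suc: "bits (Suc n) p = bits n p @ map (\<lambda>i. p i n) [0..<n]"
  by (simp add: bits_def)

lemma bits_cong:
  assumes "\<And>i j. i < j \<Longrightarrow> j < n \<Longrightarrow> p i j = q i j"
  shows "bits n p = bits n q"
  unfolding bits_def by (intro arg_cong[where f = concat] map_cong refl) (auto simp: assms)

lemma length_bits: "length (bits n p) = n * (n - 1) div 2"
proof (induction n)
  case (Suc n)
  have "Suc n * n = n * (n - 1) + 2 * n" by (cases n) auto
  then show ?case using Suc by (simp add: bits_Suc)
qed (simp add: bits_def)

lemma bits_nth: "i < j \<Longrightarrow> j < n \<Longrightarrow> bits n p ! (j * (j - 1) div 2 + i) = p i j"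
proof (induction n)
  case (Suc n)
  show ?case
  proof (cases "j = n")
    case True
    then show ?thesis using Suc.prems by (simp add: bits_Suc nth_append length_bits)
  next
    case False
    then have "j < n" using Suc.prems by simp
    moreover have "j * (j - 1) div 2 + i < n * (n - 1) div 2"
    proof -
      have "j * (j - 1) div 2 + j = Suc j * j div 2"
      proof -
        have "Suc j * j = j * (j - 1) + 2 * j" by (cases j) auto
        then show ?thesis by simp
      qed
      also have "\<dots> \<le> n * (n - 1) div 2" using \<open>j < n\<close>
        by (intro div_le_mono mult_le_mono) auto
      finally show ?thesis using \<open>i < j\<close> by simp
    qed
    ultimately show ?thesis using Suc by (simp add: bits_Suc nth_append length_bits)
  qed
qed simp

lemma entry_bits:
  assumes "graphlike q" "i < n" "j < n"
  shows "entry (bits n q) i j = q i j"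
  using assms bits_nth[of i j n q] bits_nth[of j i n q] by (auto simp: entry_def graphlike_def)

text \<open>The functions \<open>kern4\<close>, \<open>copy\<close> and \<open>kern2\<close> fix the roles of the six vertices: the
first four (or two) are roots, and the others form two flags on this root. The factor 4
compensates for the multiplicities 2 and 8 in \<open>sum_kern4\<close> and \<open>sum_kern2\<close>, and 2916000 is the
weight of a copy for which the certificate is tight.\<close>

definition kern4 :: "(nat \<Rightarrow> nat \<Rightarrow> bool) \<Rightarrow> int" where
  "kern4 p = kernel4 (bits 4 p) (map (\<lambda>i. p i 4) [0,1,2,3]) (map (\<lambda>i. p i 5) [0,1,2,3])"

definition copy :: "(nat \<Rightarrow> nat \<Rightarrow> bool) \<Rightarrow> bool" where
  "copy p = copy4 (bits 4 p) (map (\<lambda>i. p i 4) [0,1,2,3]) (map (\<lambda>i. p i 5) [0,1,2,3]) (p 4 5)"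

definition kern2 :: "(nat \<Rightarrow> nat \<Rightarrow> bool) \<Rightarrow> int" where
  "kern2 p = kernel2 (p 0 1) [p 0 2, p 1 2, p 0 3, p 1 3, p 2 3] [p 0 4, p 1 4, p 0 5, p 1 5, p 4 5]"

definition kern :: "(nat \<Rightarrow> nat \<Rightarrow> bool) \<Rightarrow> int" where
  "kern p = 4 * (kern4 p + (if copy p then 2916000 else 0)) + kern2 p"

lemma Diff_splits4: "list_all (\<lambda>(R, S). distinct (R @ S) \<and> set (R @ S) = {0,1,2,3,4,5} \<and> length R = 4 \<and> length S = 2) splits4"
  by code_simp

text \<open>An order of the six vertices amounts to a set of four roots, an order of the roots and an order of
the other two vertices. Exchanging the latter does not change the summand, which gives the factor 2.\<close>

lemma sum_kern4:
  assumes "graphlike p"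
  shows "(\<Sum>zs\<in>permutations_of_set {..<6}. kern4 (pattern p zs) + (if copy (pattern p zs) then 2916000 else 0)) =
    2 * (\<Sum>x\<leftarrow>splits4. quad_part p x)"
proof -
  define f where "f zs = kern4 (pattern p zs) + (if copy (pattern p zs) then 2916000 else 0)" for zs
  have "(\<Sum>zs\<in>permutations_of_set {..<6}. f zs) =
    (\<Sum>R\<in>set (map (set \<circ> fst) splits4). \<Sum>xs\<in>permutations_of_set R. \<Sum>ys\<in>permutations_of_set ({..<6} - R). f (xs @ ys))"
    using sum_permutations_split[of "{..<6::nat}" 4 f] by (simp only: splits4_sets) simp
  also have "\<dots> = (\<Sum>RS\<leftarrow>splits4. \<Sum>xs\<in>permutations_of_set (set (fst RS)). \<Sum>ys\<in>permutations_of_set ({..<6} - set (fst RS)). f (xs @ ys))"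
    by (subst sum.distinct_set_conv_list[OF splits4_sets(2)]) (simp add: o_def)
  also have "\<dots> = (\<Sum>x\<leftarrow>splits4. 2 * quad_part p x)"
  proof (intro arg_cong[where f = sum_list] map_cong refl)
    fix RS assume RS: "RS \<in> set splits4"
    obtain R S where RS_eq [simp]: "RS = (R, S)" by force
    have *: "distinct (R @ S)" "set (R @ S) = {0,1,2,3,4,5}" "length R = 4" "length S = 2"
      using bspec[OF Diff_splits4[unfolded list_all_iff] RS] by (simp_all only: RS_eq prod.case)
    obtain a b c d where R: "R = [a,b,c,d]" using *(3) by (auto simp: length_Suc_conv eval_nat_numeral)
    obtain y z where S: "S = [y,z]" using *(4) by (auto simp: length_Suc_conv eval_nat_numeral)
    have "{..<6} - set R = {y, z}"
    proof -
      have "{..<6} = set (R @ S)" unfolding *(2) by (auto simp: eval_nat_numeral less_Suc_eq)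
      then show ?thesis using *(1) by (auto simp: S)
    qed
    moreover have "distinct [y, z]" using *(1) by (auto simp: S)
    ultimately have "(\<Sum>xs\<in>permutations_of_set (set R). \<Sum>ys\<in>permutations_of_set ({..<6} - set R). f (xs @ ys)) =
       (\<Sum>s\<leftarrow>orders4. f (map ((!) R) s @ [y, z]) + f (map ((!) R) s @ [z, y]))"
      using * by (simp add: sum_orders2 sum_orders4)
    also have "\<dots> = (\<Sum>s\<leftarrow>orders4. 2 * term4 (bits 4 (pattern (entry (bits 4 (pattern p R))) s)) (map ((!) (map (\<lambda>x. p x y) R)) s) (map ((!) (map (\<lambda>x. p x z) R)) s) (p y z))"
    proof (intro arg_cong[where f = sum_list] map_cong refl)
      fix s assume "s \<in> set orders4"
      then have s: "s \<in> permutations_of_set {..<4}" by (simp add: orders4)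
      then have "length s = 4" using length_finite_permutations_of_set by fastforce
      then obtain s0 s1 s2 s3 where ss: "s = [s0,s1,s2,s3]" by (auto simp: length_Suc_conv eval_nat_numeral)
      have lt: "s0 < 4" "s1 < 4" "s2 < 4" "s3 < 4" using s by (auto simp: ss permutations_of_set_def)
      have sym: "p u v = p v u" "\<not> p u u" for u v using assms by (auto simp: graphlike_def)
      have e: "entry (bits 4 (pattern p R)) i j = pattern p R i j" if "i < 4" "j < 4" for i j
        using that by (intro entry_bits graphlike_pattern[OF assms])
      define r' where "r' = bits 4 (pattern (entry (bits 4 (pattern p R))) s)"
      have r: "bits 4 (pattern p (map ((!) R) s @ [u, v])) = r'" for u v
        using lt e by (simp add: r'_def bits4[of "pattern p _"] bits4[of "pattern (entry _) _"] ss pattern_def)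
      have t: "map (\<lambda>i. pattern p (map ((!) R) s @ [u, v]) i 4) [0,1,2,3] = map ((!) (map (\<lambda>x. p x u) R)) s"
        "map (\<lambda>i. pattern p (map ((!) R) s @ [u, v]) i 5) [0,1,2,3] = map ((!) (map (\<lambda>x. p x v) R)) s"
        "pattern p (map ((!) R) s @ [u, v]) 4 5 = p u v" for u v
        using lt *(3) by (simp_all add: pattern_def ss)
      have *: "f (map ((!) R) s @ [u, v]) = term4 r' (map ((!) (map (\<lambda>x. p x u) R)) s) (map ((!) (map (\<lambda>x. p x v) R)) s) (p u v)" for u v
        unfolding f_def kern4_def copy_def r t term4_def ..
      have "f (map ((!) R) s @ [z, y]) = f (map ((!) R) s @ [y, z])"
        unfolding * sym(1)[of z y] by (rule term4_sym)
      then show "f (map ((!) R) s @ [y, z]) + f (map ((!) R) s @ [z, y]) = 2 * term4 (bits 4 (pattern (entry (bits 4 (pattern p R))) s))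
          (map ((!) (map (\<lambda>x. p x y) R)) s) (map ((!) (map (\<lambda>x. p x z) R)) s) (p y z)"
        unfolding * r'_def by simp
    qed
    also have "\<dots> = 2 * quad_part p (R, S)"
      by (simp add: quad_part_def sum4_def S sum_list_const_mult)
    finally show "(\<Sum>xs\<in>permutations_of_set (set (fst RS)). \<Sum>ys\<in>permutations_of_set ({..<6} - set (fst RS)). f (xs @ ys)) =
      2 * quad_part p RS"
      by simp
  qed
  also have "\<dots> = 2 * (\<Sum>x\<leftarrow>splits4. quad_part p x)"
    by (simp add: sum_list_const_mult)
  finally show ?thesis by (simp add: f_def)
qed

lemma flag_swap: "flag_index ! bidx [c, d, a, b, e] = flag_index ! bidx [a, b, c, d, e]"
  by (cases a; cases b; cases c; cases d; cases e; simp add: flag_rules)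

lemma kernel2_swap_left: "kernel2 e [c, d, a, b, f] Z = kernel2 e [a, b, c, d, f] Z"
  and kernel2_swap_right: "kernel2 e Y [c, d, a, b, f] = kernel2 e Y [a, b, c, d, f]"
  and kernel2_sym: "kernel2 e Z Y = kernel2 e Y Z"
  by (simp_all add: kernel2_def flag_swap form_sym)

lemma splits2_sets: "{R. R \<subseteq> {..<6} \<and> card R = 2} = set (map (set \<circ> snd) splits4)" "distinct (map (set \<circ> snd) splits4)"
proof -
  have "{R \<in> Pow (set [0,1,2,3,4,5::nat]). card R = 2} = set (map (set \<circ> snd) splits4)" by code_simp
  moreover have "{..<6} = set [0,1,2,3,4,5::nat]" by (auto simp: eval_nat_numeral less_Suc_eq)
  ultimately show "{R. R \<subseteq> {..<6} \<and> card R = 2} = set (map (set \<circ> snd) splits4)" by (simp add: Pow_def)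
  show "distinct (map (set \<circ> snd) splits4)" by code_simp
qed

text \<open>Eight orders of the four remaining vertices give the same two flags: each of the flags can be
reversed, and the two can be exchanged.\<close>

lemma sum_kern2:
  assumes "graphlike p"
  shows "(\<Sum>zs\<in>permutations_of_set {..<6}. kern2 (pattern p zs)) = 8 * (\<Sum>x\<leftarrow>splits2. pair_part p x)"
proof -
  define f where "f zs = kern2 (pattern p zs)" for zs
  have "(\<Sum>zs\<in>permutations_of_set {..<6}. f zs) =
    (\<Sum>R\<in>set (map (set \<circ> snd) splits4). \<Sum>xs\<in>permutations_of_set R. \<Sum>ys\<in>permutations_of_set ({..<6} - R). f (xs @ ys))"
    using sum_permutations_split[of "{..<6::nat}" 2 f] by (simp only: splits2_sets) simp
  also have "\<dots> = (\<Sum>RS\<leftarrow>splits4. \<Sum>xs\<in>permutations_of_set (set (snd RS)). \<Sum>ys\<in>permutations_of_set ({..<6} - set (snd RS)). f (xs @ ys))"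
    by (subst sum.distinct_set_conv_list[OF splits2_sets(2)]) (simp add: o_def)
  also have "\<dots> = (\<Sum>(R, S)\<leftarrow>splits4. 8 * (pair_part p (S, [R ! 0, R ! 1], [R ! 2, R ! 3]) +
      pair_part p (S, [R ! 0, R ! 2], [R ! 1, R ! 3]) + pair_part p (S, [R ! 0, R ! 3], [R ! 1, R ! 2])))"
  proof (intro arg_cong[where f = sum_list] map_cong refl)
    fix RS assume RS: "RS \<in> set splits4"
    obtain R S where RS_eq [simp]: "RS = (R, S)" by force
    have *: "distinct (R @ S)" "set (R @ S) = {0,1,2,3,4,5}" "length R = 4" "length S = 2"
      using bspec[OF Diff_splits4[unfolded list_all_iff] RS] by (simp_all only: RS_eq prod.case)
    obtain a b c d where R: "R = [a,b,c,d]" using *(3) by (auto simp: length_Suc_conv eval_nat_numeral)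
    obtain y z where S: "S = [y,z]" using *(4) by (auto simp: length_Suc_conv eval_nat_numeral)
    have "{..<6} - {y, z} = set R"
    proof -
      have "{..<6} = set (R @ S)" unfolding *(2) by (auto simp: eval_nat_numeral less_Suc_eq)
      then show ?thesis using *(1) by (auto simp: S)
    qed
    moreover have "distinct [y, z]" using *(1) by (auto simp: S)
    ultimately have "(\<Sum>xs\<in>permutations_of_set (set S). \<Sum>ys\<in>permutations_of_set ({..<6} - set S). f (xs @ ys)) =
       (\<Sum>s\<leftarrow>orders4. f ([y, z] @ map ((!) R) s) + f ([z, y] @ map ((!) R) s))"
      using * by (simp add: S sum_orders2 sum_orders4 sum_list_addf)
    also have "\<dots> = 8 * (pair_part p (S, [R ! 0, R ! 1], [R ! 2, R ! 3]) +
      pair_part p (S, [R ! 0, R ! 2], [R ! 1, R ! 3]) + pair_part p (S, [R ! 0, R ! 3], [R ! 1, R ! 2]))"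
    proof -
      have sym: "p u v = p v u" for u v using assms by (auto simp: graphlike_def)
      have s: "p z y = p y z" "p b a = p a b" "p c a = p a c" "p d a = p a d" "p c b = p b c" "p d b = p b d" "p d c = p c d"
        by (simp_all add: sym)
      define k where "k e u v y z = kernel2 e [p y u, p z u, p y v, p z v, p u v]" for e u v y z
      have k: "k e v u y z Z = k e u v y z Z" for e u v y z Z
        unfolding k_def by (subst kernel2_swap_left) (simp add: sym[of v u])
      define l where "l e u v w x y z = k e u v y z [p y w, p z w, p y x, p z x, p w x]" for e u v w x y z
      have l1: "l e v u w x y z = l e u v w x y z" for e u v w x y z
        unfolding l_def by (rule k)
      have l2: "l e u v x w y z = l e u v w x y z" for e u v w x y z
        unfolding l_def k_def by (subst kernel2_swap_right) (simp add: sym[of x w])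
      have l3: "l e w x u v y z = l e u v w x y z" for e u v w x y z
        unfolding l_def k_def by (rule kernel2_sym)
      have fl: "f [y', z', u, v, w, x] = l (p y' z') u v w x y' z'" for y' z' u v w x
        by (simp add: f_def kern2_def pattern_def l_def k_def)
      have pp: "pair_part p ([y, z], [u, v], [w, x]) = l (p y z) u v w x y z + l (p y z) u v w x z y" for u v w x
        by (simp add: pair_part_def sum2_def l_def k_def)
      show ?thesis unfolding S R
        by (simp add: orders4_def fl pp s(1) l1[of _ b a] l1[of _ c a] l1[of _ d a] l1[of _ c b] l1[of _ d b] l1[of _ d c]
          l2[of _ _ _ b a] l2[of _ _ _ c a] l2[of _ _ _ d a] l2[of _ _ _ c b] l2[of _ _ _ d b] l2[of _ _ _ d c]
          l3[of _ b c a d] l3[of _ b d a c] l3[of _ c d a b])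
    qed
    finally show "(\<Sum>xs\<in>permutations_of_set (set (snd RS)). \<Sum>ys\<in>permutations_of_set ({..<6} - set (snd RS)). f (xs @ ys)) =
      (case RS of (R, S) \<Rightarrow> 8 * (pair_part p (S, [R ! 0, R ! 1], [R ! 2, R ! 3]) +
      pair_part p (S, [R ! 0, R ! 2], [R ! 1, R ! 3]) + pair_part p (S, [R ! 0, R ! 3], [R ! 1, R ! 2])))"
      by simp
  qed
  also have "\<dots> = 8 * (\<Sum>x\<leftarrow>splits2. pair_part p x)" by (simp add: splits2_def splits4_def)
  finally show ?thesis by (simp add: f_def)
qed

text \<open>Both \<open>excess\<close> and \<open>total\<close> describe the slack of the certificate. The first is a short sum
that can be evaluated, the second is evidently invariant under permutations of the vertices.\<close>

definition total :: "(nat \<Rightarrow> nat \<Rightarrow> bool) \<Rightarrow> int" where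
  "total p = (\<Sum>zs\<in>permutations_of_set {..<6}. kern (pattern p zs))"

lemma total_excess:
  assumes "graphlike p"
  shows "total p = 8 * (270000 - excess p)"
proof -
  have "total p = 4 * (\<Sum>zs\<in>permutations_of_set {..<6}. kern4 (pattern p zs) + (if copy (pattern p zs) then 2916000 else 0))
     + (\<Sum>zs\<in>permutations_of_set {..<6}. kern2 (pattern p zs))"
    unfolding total_def kern_def by (simp only: sum.distrib sum_distrib_left distrib_left)
  then show ?thesis unfolding sum_kern4[OF assms] sum_kern2[OF assms] excess_def by simp
qed

section \<open>All graphs on six vertices\<close>

lemma kern_cong:
  assumes "\<And>i j. i < 6 \<Longrightarrow> j < 6 \<Longrightarrow> p i j = q i j"
  shows "kern p = kern q"
  unfolding kern_def kern4_def copy_def kern2_def bits4 by (simp add: assms)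

text \<open>Renaming the vertices permutes the orders over which \<open>total\<close> sums.\<close>

lemma total_permute:
  fixes p :: "nat \<Rightarrow> nat \<Rightarrow> bool"
  assumes "\<pi> \<in> permutations_of_set {..<6}"
  shows "total (pattern p \<pi>) = total p"
proof -
  have \<pi>: "distinct \<pi>" "set \<pi> = {..<6}" using assms by (auto simp: permutations_of_set_def)
  then have l: "length \<pi> = 6" by (metis card_lessThan distinct_card)
  have "total p = (\<Sum>zs\<in>permutations_of_set {..<6}. kern (pattern p (map ((!) \<pi>) zs)))"
    unfolding total_def using sum_permutations_nth[OF \<pi>(1), of "\<lambda>zs. kern (pattern p zs)"] \<pi>(2) l by simp
  also have "\<dots> = total (pattern p \<pi>)"
    unfolding total_def
  proof (intro sum.cong refl kern_cong)
    fix zs i j assume "zs \<in> permutations_of_set {..<6::nat}" "i < (6::nat)" "j < (6::nat)"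
    moreover from this(1) have "length zs = 6" using length_finite_permutations_of_set by fastforce
    ultimately show "pattern p (map ((!) \<pi>) zs) i j = pattern (pattern p \<pi>) zs i j" by (simp add: pattern_def)
  qed
  finally show ?thesis by simp
qed

lemma excess_permute:
  fixes p :: "nat \<Rightarrow> nat \<Rightarrow> bool"
  assumes "graphlike p" "\<pi> \<in> permutations_of_set {..<6}"
  shows "excess (pattern p \<pi>) = excess p"
  using total_permute[OF assms(2), of p] total_excess[OF assms(1)] total_excess[OF graphlike_pattern[OF assms(1)], of \<pi>] by simp

definition colourable :: "(nat \<Rightarrow> nat \<Rightarrow> bool) \<Rightarrow> bool" where
  "colourable p \<longleftrightarrow> (\<exists>c. (\<forall>i<6. c i < 6) \<and> (\<forall>i<6. \<forall>j<6. p i j = hex (c i) (c j)))"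

text \<open>The witnesses stored with the representatives on \<open>n\<close> vertices show that each extension by one
vertex is isomorphic to a representative on \<open>n + 1\<close> vertices.\<close>

definition step_ok :: "nat \<Rightarrow> ((nat \<times> nat) list \<times> nat list list) list \<Rightarrow> ((nat \<times> nat) list \<times> nat list list) list \<Rightarrow> bool" where
  "step_ok n cur nxt \<longleftrightarrow> list_all (\<lambda>(es, ps). list_all (\<lambda>t. let \<tau> = ps ! bidx t in
     distinct \<tau> \<and> set \<tau> = set [0..<Suc n] \<and>
     bits (Suc n) (pattern (entry (edge_bits n es @ t)) \<tau>) \<in> set (map (edge_bits (Suc n) \<circ> fst) nxt)) (List.n_lists n [False, True])) cur"

text \<open>Computing these codes first keeps them from being evaluated again for each extension in the last
step.\<close>

schematic_goal classes_5_codes: "map (edge_bits (Suc 4) \<circ> fst) classes_5 = ?M" by code_simp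

lemma steps_ok: "step_ok 2 classes_2 classes_3" "step_ok 3 classes_3 classes_4" "step_ok 4 classes_4 classes_5"
proof -
  show "step_ok 2 classes_2 classes_3" "step_ok 3 classes_3 classes_4" by code_simp+
  show "step_ok 4 classes_4 classes_5" unfolding step_ok_def classes_5_codes by code_simp
qed

text \<open>The vertices are listed in an order in which the first \<open>n\<close> of them span a representative. The
witness for the extension by the next vertex reorders the first \<open>n + 1\<close> of them.\<close>

lemma class_step:
  fixes p :: "nat \<Rightarrow> nat \<Rightarrow> bool"
  assumes "step_ok n cur nxt" "graphlike p" "\<pi> \<in> permutations_of_set {..<6}" "n < 6"
    and "bits n (pattern p \<pi>) \<in> set (map (edge_bits n \<circ> fst) cur)"
  shows "\<exists>\<pi>\<in>permutations_of_set {..<6}. bits (Suc n) (pattern p \<pi>) \<in> set (map (edge_bits (Suc n) \<circ> fst) nxt)"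
proof -
  define q where "q = pattern p \<pi>"
  have q: "graphlike q" using assms(2) by (simp add: q_def graphlike_pattern)
  define t where "t = map (\<lambda>i. q i n) [0..<n]"
  obtain es ps where es: "(es, ps) \<in> set cur" "bits n q = edge_bits n es" using assms(5) by (auto simp: q_def)
  have t: "t \<in> set (List.n_lists n [False, True])" by (auto simp: t_def set_n_lists)
  define \<tau> where "\<tau> = ps ! bidx t"
  have bq: "edge_bits n es @ t = bits (Suc n) q" by (simp only: bits_Suc es(2) t_def)
  have "distinct \<tau> \<and> set \<tau> = set [0..<Suc n] \<and>
    bits (Suc n) (pattern (entry (edge_bits n es @ t)) \<tau>) \<in> set (map (edge_bits (Suc n) \<circ> fst) nxt)"
    using bspec[OF bspec[OF assms(1)[unfolded step_ok_def list_all_iff] es(1), unfolded prod.case list_all_iff] t]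
    unfolding Let_def \<tau>_def .
  note * = this[unfolded bq set_upt]
  note \<tau> = conjunct1[OF *] conjunct1[OF conjunct2[OF *]] conjunct2[OF conjunct2[OF *]]
  have l: "length \<tau> = Suc n" using \<tau>(1,2) distinct_card by fastforce
  define \<tau>' where "\<tau>' = \<tau> @ [Suc n..<6]"
  have \<tau>': "\<tau>' \<in> permutations_of_set {..<6}"
  proof -
    have "set \<tau>' = {0..<Suc n} \<union> {Suc n..<6}" unfolding \<tau>'_def set_append set_upt \<tau>(2) ..
    also have "\<dots> = {..<6}" using assms(4) by force
    finally have "set \<tau>' = {..<6}" .
    moreover have "distinct \<tau>'" unfolding \<tau>'_def distinct_append set_upt \<tau>(2) using \<tau>(1) by (auto simp del: upt_Suc)
    ultimately show ?thesis by (intro permutations_of_setI)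
  qed
  have \<pi>: "distinct \<pi>" "set \<pi> = {..<6}" "length \<pi> = 6"
    using assms(3) length_finite_permutations_of_set[of \<pi> "{..<6}"] by (auto simp: permutations_of_set_def)
  have "map ((!) \<pi>) \<tau>' \<in> permutations_of_set {..<6}"
    using permutations_nth[OF \<pi>(1)] \<pi> \<tau>' by auto
  moreover have "bits (Suc n) (pattern p (map ((!) \<pi>) \<tau>')) = bits (Suc n) (pattern (entry (bits (Suc n) q)) \<tau>)"
  proof (rule bits_cong)
    fix i j assume ij: "i < j" "j < Suc n"
    have "\<tau> ! i < Suc n" "\<tau> ! j < Suc n" using \<tau>(2) l ij nth_mem[of i \<tau>] nth_mem[of j \<tau>] by auto
    then show "pattern p (map ((!) \<pi>) \<tau>') i j = pattern (entry (bits (Suc n) q)) \<tau> i j"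
      using ij l by (simp add: pattern_def entry_bits[OF q] \<tau>'_def nth_append) (simp add: q_def pattern_def)
  qed
  ultimately show ?thesis using \<tau>(3) by (intro bexI[of _ "map ((!) \<pi>) \<tau>'"]) simp_all
qed

lemma class_exists:
  fixes p :: "nat \<Rightarrow> nat \<Rightarrow> bool"
  assumes "graphlike p"
  shows "\<exists>\<pi>\<in>permutations_of_set {..<6}. bits 5 (pattern p \<pi>) \<in> set (map (edge_bits 5 \<circ> fst) classes_5)"
proof -
  have s: "Suc 2 = 3" "Suc 3 = 4" "Suc 4 = 5" "(2::nat) < 6" "(3::nat) < 6" "(4::nat) < 6" by simp_all
  have 0: "[0..<6] \<in> permutations_of_set {..<6}" by (intro permutations_of_setI) (auto simp del: upt_Suc)
  have 2: "bits 2 (pattern p [0..<6]) \<in> set (map (edge_bits 2 \<circ> fst) classes_2)"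
    by (auto simp: bits_def edge_bits_def classes_2_def numeral_2_eq_2)
  obtain \<pi>3 where 3: "\<pi>3 \<in> permutations_of_set {..<6}" "bits 3 (pattern p \<pi>3) \<in> set (map (edge_bits 3 \<circ> fst) classes_3)"
    using class_step[OF steps_ok(1) assms 0 s(4) 2, unfolded s(1)] by (elim bexE)
  obtain \<pi>4 where 4: "\<pi>4 \<in> permutations_of_set {..<6}" "bits 4 (pattern p \<pi>4) \<in> set (map (edge_bits 4 \<circ> fst) classes_4)"
    using class_step[OF steps_ok(2) assms 3(1) s(5) 3(2), unfolded s(2)] by (elim bexE)
  show ?thesis
    using class_step[OF steps_ok(3) assms 4(1) s(6) 4(2), unfolded s(3)] .
qed

lemma excess_cong:
  assumes "\<And>i j. i < 6 \<Longrightarrow> j < 6 \<Longrightarrow> p i j = q i j"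
  shows "excess p = excess q"
  unfolding excess_def quad_part_def pair_part_def splits4_def splits2_def bits4 by (simp add: assms pattern_def)

lemma colourings_ok: "list_all (\<lambda>(es, cs). list_all (\<lambda>c. length c = 5 \<and> list_all (\<lambda>x. x < 6) c \<and>
    bits 5 (\<lambda>i j. hex (c ! i) (c ! j)) = edge_bits 5 es) cs) classes_5"
  by code_simp

lemma graphlike_hex: "graphlike hex" by (auto simp: graphlike_def hex_def)

text \<open>The vertices are permuted such that the first five span a representative; then \<open>classes_ok\<close>
applies to the neighbourhood of the sixth. A colouring is transported back along the permutation.\<close>

theorem excess_bound:
  fixes p :: "nat \<Rightarrow> nat \<Rightarrow> bool"
  assumes "graphlike p"
  shows "536 \<le> excess p \<or> (excess p = 0 \<and> colourable p)"
proof -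
  obtain \<pi> where \<pi>: "\<pi> \<in> permutations_of_set {..<6}" "bits 5 (pattern p \<pi>) \<in> set (map (edge_bits 5 \<circ> fst) classes_5)"
    using class_exists[OF assms] by blast
  define q where "q = pattern p \<pi>"
  have q: "graphlike q" using assms by (simp add: q_def graphlike_pattern)
  obtain es cs where es: "(es, cs) \<in> set classes_5" "bits 5 q = edge_bits 5 es" using \<pi>(2) by (auto simp: q_def)
  define t where "t = map (\<lambda>i. q i 5) [0..<5]"
  have b6: "bits 6 q = edge_bits 5 es @ t" using bits_Suc[of 5 q] by (simp add: es(2) t_def)
  have "class_ok (edge_bits 5 es) cs" using classes_ok es(1) by (auto simp: list_all_iff)
  moreover have "t = [q 0 5, q 1 5, q 2 5, q 3 5, q 4 5]" by (simp add: t_def eval_nat_numeral)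
  ultimately have "settled (excess (entry (bits 6 q))) cs t" by (auto simp: class_ok_def b6)
  moreover have "excess (entry (bits 6 q)) = excess q" by (rule excess_cong) (simp add: entry_bits[OF q])
  moreover have "excess q = excess p" unfolding q_def by (rule excess_permute[OF assms \<pi>(1)])
  ultimately consider "536 \<le> excess p" | "excess p = 0" "colourable_by cs t"
    by (auto simp: settled_def split: if_splits)
  then show ?thesis
  proof cases
    case 2
    then obtain c v where c: "c \<in> set cs" "v \<in> set [0,1,2,3,4,5]" "t = hex_trace c v"
      by (auto simp: colourable_by_def list_ex_iff)
    have c': "length c = 5" "\<forall>x\<in>set c. x < 6" "bits 5 (\<lambda>i j. hex (c ! i) (c ! j)) = edge_bits 5 es"
      using colourings_ok es(1) c(1) by (fastforce simp: list_all_iff)+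
    define d where "d = c @ [v]"
    have "bits 6 (\<lambda>i j. hex (d ! i) (d ! j)) = bits 6 q"
    proof -
      have "bits 5 (\<lambda>i j. hex (d ! i) (d ! j)) = bits 5 (\<lambda>i j. hex (c ! i) (c ! j))"
        by (rule bits_cong) (simp add: d_def nth_append c'(1))
      moreover have "map (\<lambda>i. hex (d ! i) (d ! 5)) [0..<5] = t"
        by (rule nth_equalityI) (simp_all add: c(3) hex_trace_def d_def nth_append c'(1))
      ultimately show ?thesis using bits_Suc[of 5 "\<lambda>i j. hex (d ! i) (d ! j)"] by (simp add: b6 c'(3))
    qed
    then have eq: "q i j = hex (d ! i) (d ! j)" if "i < 6" "j < 6" for i j
      using that q graphlike_hex entry_bits[OF q, of i 6 j] entry_bits[of "\<lambda>i j. hex (d ! i) (d ! j)" i 6 j]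
      by (simp add: graphlike_def)
    have d6: "d ! i < 6" if "i < 6" for i
    proof -
      have "d ! i \<in> set d" using that c'(1) by (intro nth_mem) (simp add: d_def)
      then show ?thesis using c'(2) c(2) by (auto simp: d_def)
    qed
    have "length \<pi> = 6" "set \<pi> = {..<6}" using \<pi>(1) length_finite_permutations_of_set[of \<pi> "{..<6}"] by (auto simp: permutations_of_set_def)
    then have "\<forall>x<6. \<exists>i<6. \<pi> ! i = x" by (metis in_set_conv_nth lessThan_iff)
    then obtain g where g: "\<And>x. x < 6 \<Longrightarrow> g x < 6 \<and> \<pi> ! g x = x" by metis
    have "p x y = hex (d ! g x) (d ! g y)" if "x < 6" "y < 6" for x y
      using eq[of "g x" "g y"] g[OF that(1)] g[OF that(2)] by (simp add: q_def pattern_def)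
    then have "colourable p" unfolding colourable_def using g d6 by (intro exI[of _ "\<lambda>x. d ! g x"]) auto
    then show ?thesis using 2 by simp
  qed simp
qed

section \<open>The flag identity\<close>

definition tuples :: "'a set \<Rightarrow> nat \<Rightarrow> 'a list set" where
  "tuples V k = {xs. set xs \<subseteq> V \<and> length xs = k}"

lemma finite_tuples: "finite V \<Longrightarrow> finite (tuples V k)"
  unfolding tuples_def by (rule finite_lists_length_eq)

lemma card_tuples: "finite V \<Longrightarrow> card (tuples V k) = card V ^ k"
  unfolding tuples_def by (rule card_lists_length_eq)

lemma tuples_1: "tuples V (Suc 0) = (\<lambda>v. [v]) ` V"
  by (auto simp: tuples_def length_Suc_conv)

lemma sum_tuples_1: "(\<Sum>ys\<in>tuples V (Suc 0). f ys) = (\<Sum>v\<in>V. f [v])"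
  unfolding tuples_1 by (subst sum.reindex) (auto simp: inj_on_def)

lemma sum_tuples_append:
  assumes "finite V"
  shows "(\<Sum>zs\<in>tuples V (k + m). f zs) = (\<Sum>xs\<in>tuples V k. \<Sum>ys\<in>tuples V m. f (xs @ ys))"
proof -
  have "(\<Sum>xs\<in>tuples V k. \<Sum>ys\<in>tuples V m. f (xs @ ys)) = (\<Sum>(xs, ys)\<in>tuples V k \<times> tuples V m. f (xs @ ys))"
    by (simp add: sum.cartesian_product)
  also have "\<dots> = (\<Sum>zs\<in>tuples V (k + m). f zs)"
    by (rule sum.reindex_bij_witness[where j = "\<lambda>(xs, ys). xs @ ys" and i = "\<lambda>zs. (take k zs, drop k zs)"])
      (auto simp: tuples_def dest: in_set_takeD in_set_dropD)
  finally show ?thesis ..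
qed

lemma sum_tuples_2: "finite V \<Longrightarrow> (\<Sum>ys\<in>tuples V 2. f ys) = (\<Sum>y\<in>V. \<Sum>z\<in>V. f [y, z])"
  using sum_tuples_append[of V f "Suc 0" "Suc 0"] by (simp add: sum_tuples_1 numeral_2_eq_2)

lemma sum_tuples_4: "finite V \<Longrightarrow> (\<Sum>zs\<in>tuples V 4. f zs) = (\<Sum>xs\<in>tuples V 2. \<Sum>ys\<in>tuples V 2. f (xs @ ys))"
  using sum_tuples_append[of V f 2 2] by simp

lemma sum_tuples_permute:
  assumes "finite V" "zs \<in> permutations_of_set {..<k}"
  shows "(\<Sum>xs\<in>tuples V k. f (map ((!) xs) zs)) = (\<Sum>xs\<in>tuples V k. f xs)"
proof -
  have zs: "set zs = {..<k}" "distinct zs" using assms(2) by (auto simp: permutations_of_set_def)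
  then have l: "length zs = k" by (metis card_lessThan distinct_card)
  have inj: "inj_on (\<lambda>xs. map ((!) xs) zs) (tuples V k)"
  proof (rule inj_onI)
    fix xs ys assume *: "xs \<in> tuples V k" "ys \<in> tuples V k" "map ((!) xs) zs = map ((!) ys) zs"
    then have "\<forall>i\<in>{..<k}. xs ! i = ys ! i" by (simp add: zs(1)[symmetric])
    then show "xs = ys" using * by (intro nth_equalityI) (auto simp: tuples_def)
  qed
  have "(\<lambda>xs. map ((!) xs) zs) ` tuples V k \<subseteq> tuples V k"
    using zs l by (fastforce simp: tuples_def)
  then have "(\<lambda>xs. map ((!) xs) zs) ` tuples V k = tuples V k"
    using endo_inj_surj[OF finite_tuples[OF assms(1)] _ inj] by blast
  then show ?thesis using sum.reindex[OF inj, of f] by (simp add: o_def)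
qed

text \<open>Here \<open>v\<close> is a vector of the certificate, regarded as a function of a root with one further
vertex; \<open>flag2\<close> is the analogue for two roots with two further vertices.\<close>

definition flag4 :: "bool list \<Rightarrow> int list \<Rightarrow> (nat \<Rightarrow> nat \<Rightarrow> bool) \<Rightarrow> int" where
  "flag4 r v p = (if bits 4 p = r then v ! bidx (map (\<lambda>i. p i 4) [0,1,2,3]) else 0)"

definition flag2 :: "int list \<Rightarrow> (nat \<Rightarrow> nat \<Rightarrow> bool) \<Rightarrow> int" where
  "flag2 v p = (if p 0 1 then 0 else v ! (flag_index ! bidx [p 0 2, p 1 2, p 0 3, p 1 3, p 2 3]))"

text \<open>A square is given by its coefficient, the number of roots, the number of further vertices and the
function that is summed over the further vertices. The factors 360 and 90 come from averaging
\<open>kern\<close> over the 720 orders, with the common factor 8 of \<open>total_excess\<close> cancelled.\<close>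

definition squares :: "(int \<times> nat \<times> nat \<times> ((nat \<Rightarrow> nat \<Rightarrow> bool) \<Rightarrow> int)) list" where
  "squares = concat (map (\<lambda>(r, cs). map (\<lambda>(c, v). (360 * c, 4, 1, flag4 r v)) cs) cert_roots)
     @ map (\<lambda>(c, v). (90 * c, 2, 2, flag2 v)) cert_nonedge"

definition sos :: "('a \<Rightarrow> 'a \<Rightarrow> bool) \<Rightarrow> 'a set \<Rightarrow> int" where
  "sos E V = (\<Sum>(c, k, m, g)\<leftarrow>squares. c * (\<Sum>xs\<in>tuples V k. (\<Sum>ys\<in>tuples V m. g (pattern E (xs @ ys)))\<^sup>2))"

definition copies :: "('a \<Rightarrow> 'a \<Rightarrow> bool) \<Rightarrow> 'a set \<Rightarrow> nat" where
  "copies E V = card {xs \<in> tuples V 6. copy (pattern E xs)}"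

lemma sum_list_swap: "(\<Sum>x\<in>A. \<Sum>y\<leftarrow>ys. f x y) = (\<Sum>y\<leftarrow>ys. \<Sum>x\<in>A. f x y)" for f :: "_ \<Rightarrow> _ \<Rightarrow> int"
  by (induction ys) (simp_all add: sum.distrib)

lemma sum_square: "(\<Sum>x\<in>A. \<Sum>y\<in>A. c * (f x * f y)) = c * (\<Sum>x\<in>A. f x)\<^sup>2" for f :: "_ \<Rightarrow> int"
  by (simp only: power2_eq_square sum_product) (simp only: sum_distrib_left)

text \<open>A positive semidefinite form in two flags with the same root is a combination of products of a
function of the first flag and the same function of the second. Summation over the two flags turns the
products into squares.\<close>

lemma kern4_append:
  assumes "length xs = 4"
  shows "kern4 (pattern E (xs @ [y] @ [z])) = (\<Sum>(r, cs)\<leftarrow>cert_roots. \<Sum>(c, v)\<leftarrow>cs.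
    c * (flag4 r v (pattern E (xs @ [y])) * flag4 r v (pattern E (xs @ [z]))))"
proof -
  have b: "bits 4 (pattern E (xs @ ys)) = bits 4 (pattern E xs)" for ys
    using assms by (intro bits_cong) (simp add: pattern_def nth_append)
  obtain a b c d where xs: "xs = [a,b,c,d]" using assms by (auto simp: length_Suc_conv eval_nat_numeral)
  show ?thesis
    unfolding kern4_def kernel4_def b flag4_def
    by (intro arg_cong[where f = sum_list] map_cong refl)
      (auto simp: form_def xs pattern_def case_prod_unfold mult.assoc)
qed

lemma sum_kern4_tuples:
  assumes "finite V"
  shows "(\<Sum>xs\<in>tuples V 6. kern4 (pattern E xs)) = (\<Sum>(r, cs)\<leftarrow>cert_roots. \<Sum>(c, v)\<leftarrow>cs.
     c * (\<Sum>xs\<in>tuples V 4. (\<Sum>ys\<in>tuples V 1. flag4 r v (pattern E (xs @ ys)))\<^sup>2))"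
proof -
  have "(\<Sum>xs\<in>tuples V 6. kern4 (pattern E xs)) = (\<Sum>xs\<in>tuples V 4. \<Sum>y\<in>V. \<Sum>z\<in>V. kern4 (pattern E (xs @ [y] @ [z])))"
    using sum_tuples_append[OF assms, of "\<lambda>xs. kern4 (pattern E xs)" 4 2] by (simp add: sum_tuples_2[OF assms])
  also have "\<dots> = (\<Sum>xs\<in>tuples V 4. \<Sum>y\<in>V. \<Sum>z\<in>V. \<Sum>(r, cs)\<leftarrow>cert_roots. \<Sum>(c, v)\<leftarrow>cs.
    c * (flag4 r v (pattern E (xs @ [y])) * flag4 r v (pattern E (xs @ [z]))))"
    by (intro sum.cong refl kern4_append) (simp add: tuples_def)
  also have "\<dots> = (\<Sum>(r, cs)\<leftarrow>cert_roots. \<Sum>(c, v)\<leftarrow>cs. \<Sum>xs\<in>tuples V 4. \<Sum>y\<in>V. \<Sum>z\<in>V.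
    c * (flag4 r v (pattern E (xs @ [y])) * flag4 r v (pattern E (xs @ [z]))))"
    by (simp add: case_prod_unfold sum_list_swap)
  finally show ?thesis by (simp add: sum_square sum_tuples_1 sum_distrib_left)
qed

lemma kern2_append:
  assumes "length xs = 2" "length ys = 2" "length zs = 2"
  shows "kern2 (pattern E (xs @ ys @ zs)) = (\<Sum>(c, v)\<leftarrow>cert_nonedge. c * (flag2 v (pattern E (xs @ ys)) * flag2 v (pattern E (xs @ zs))))"
proof -
  obtain a b where xs: "xs = [a,b]" using assms by (auto simp: length_Suc_conv eval_nat_numeral)
  obtain c d where ys: "ys = [c,d]" using assms by (auto simp: length_Suc_conv eval_nat_numeral)
  obtain e f where zs: "zs = [e,f]" using assms by (auto simp: length_Suc_conv eval_nat_numeral)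
  show ?thesis
    by (auto simp: xs ys zs kern2_def kernel2_def flag2_def pattern_def form_def mult.assoc case_prod_unfold)
qed

lemma sum_kern2_tuples:
  assumes "finite V"
  shows "(\<Sum>xs\<in>tuples V 6. kern2 (pattern E xs)) = (\<Sum>(c, v)\<leftarrow>cert_nonedge.
     c * (\<Sum>xs\<in>tuples V 2. (\<Sum>ys\<in>tuples V 2. flag2 v (pattern E (xs @ ys)))\<^sup>2))"
proof -
  have "(\<Sum>xs\<in>tuples V 6. kern2 (pattern E xs)) = (\<Sum>xs\<in>tuples V 2. \<Sum>ys\<in>tuples V 2. \<Sum>zs\<in>tuples V 2. kern2 (pattern E (xs @ ys @ zs)))"
    using sum_tuples_append[OF assms, of "\<lambda>xs. kern2 (pattern E xs)" 2 4]
    by (simp add: sum_tuples_4[OF assms])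
  also have "\<dots> = (\<Sum>xs\<in>tuples V 2. \<Sum>ys\<in>tuples V 2. \<Sum>zs\<in>tuples V 2. \<Sum>(c, v)\<leftarrow>cert_nonedge.
     c * (flag2 v (pattern E (xs @ ys)) * flag2 v (pattern E (xs @ zs))))"
    by (intro sum.cong refl kern2_append) (simp_all add: tuples_def)
  also have "\<dots> = (\<Sum>(c, v)\<leftarrow>cert_nonedge. \<Sum>xs\<in>tuples V 2. \<Sum>ys\<in>tuples V 2. \<Sum>zs\<in>tuples V 2.
     c * (flag2 v (pattern E (xs @ ys)) * flag2 v (pattern E (xs @ zs))))"
    by (simp add: case_prod_unfold sum_list_swap)
  finally show ?thesis by (simp add: sum_square sum_distrib_left)
qed

text \<open>Summing \<open>total\<close> over all 6-tuples and exchanging the sums replaces each of the 720 orders by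
the identity, since permuting the entries of tuples permutes the tuples. What remains is the sum of
\<open>kern\<close>, whose parts are squares and the number of copies.\<close>

theorem flag_identity:
  assumes "finite V" "graphlike E"
  shows "270000 * int (card V) ^ 6 = (\<Sum>xs\<in>tuples V 6. excess (pattern E xs)) + 1049760000 * int (copies E V) + sos E V"
proof -
  have 1: "(\<Sum>xs\<in>tuples V 6. total (pattern E xs)) = 8 * (270000 * int (card V) ^ 6 - (\<Sum>xs\<in>tuples V 6. excess (pattern E xs)))"
    by (simp add: total_excess[OF graphlike_pattern[OF assms(2)]] card_tuples[OF assms(1)] sum_subtractf sum_distrib_left[symmetric])
  have "(\<Sum>xs\<in>tuples V 6. total (pattern E xs)) = (\<Sum>zs\<in>permutations_of_set {..<6}. \<Sum>xs\<in>tuples V 6. kern (pattern (pattern E xs) zs))"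
    unfolding total_def by (rule sum.swap)
  also have "\<dots> = (\<Sum>zs\<in>permutations_of_set {..<6::nat}. \<Sum>xs\<in>tuples V 6. kern (pattern E (map ((!) xs) zs)))"
  proof (intro sum.cong refl kern_cong)
    fix zs :: "nat list" and xs :: "'a list" and i j
    assume "zs \<in> permutations_of_set {..<6}" "i < (6::nat)" "j < (6::nat)"
    moreover from this(1) have "length zs = 6" using length_finite_permutations_of_set by fastforce
    ultimately show "pattern (pattern E xs) zs i j = pattern E (map ((!) xs) zs) i j" by (simp add: pattern_def)
  qed
  also have "\<dots> = (\<Sum>zs\<in>permutations_of_set {..<6::nat}. \<Sum>xs\<in>tuples V 6. kern (pattern E xs))"
    by (intro sum.cong refl sum_tuples_permute assms) auto
  also have "\<dots> = 720 * (\<Sum>xs\<in>tuples V 6. kern (pattern E xs))"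
    by (simp add: fact_numeral)
  also have "(\<Sum>xs\<in>tuples V 6. kern (pattern E xs)) = 4 * ((\<Sum>xs\<in>tuples V 6. kern4 (pattern E xs)) +
      2916000 * int (copies E V)) + (\<Sum>xs\<in>tuples V 6. kern2 (pattern E xs))"
    unfolding kern_def copies_def
    by (simp add: sum.distrib sum_distrib_left[symmetric] sum.If_cases finite_tuples[OF assms(1)] Int_def)
  also have "720 * \<dots> = 8 * (1049760000 * int (copies E V) + (360 * (\<Sum>xs\<in>tuples V 6. kern4 (pattern E xs)) + 90 * (\<Sum>xs\<in>tuples V 6. kern2 (pattern E xs))))"
    by (simp add: algebra_simps)
  also have "360 * (\<Sum>xs\<in>tuples V 6. kern4 (pattern E xs)) + 90 * (\<Sum>xs\<in>tuples V 6. kern2 (pattern E xs)) = sos E V"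
    unfolding sum_kern4_tuples[OF assms(1)] sum_kern2_tuples[OF assms(1)] sos_def squares_def
    by (simp add: sum_list_const_mult[symmetric] case_prod_unfold o_def cert_roots_def mult.assoc)
  finally show ?thesis using 1 by simp
qed

section \<open>Tightness at the hexagon\<close>

lemma squares_coeff_pos: "(c, k, m, g) \<in> set squares \<Longrightarrow> 0 < c"
proof -
  assume "(c, k, m, g) \<in> set squares"
  moreover have "list_all (\<lambda>(r, cs). list_all (\<lambda>(c, v). 0 < c) cs) cert_roots" "list_all (\<lambda>(c, v). 0 < c) cert_nonedge"
    by code_simp+
  ultimately show "0 < c" unfolding squares_def by (fastforce simp: list_all_iff)
qed

lemma squares_dims: "(c, k, m, g) \<in> set squares \<Longrightarrow> (k, m) = (4, 1) \<or> (k, m) = (2, 2)"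
  unfolding squares_def by auto

lemma sos_nonneg: "0 \<le> sos E V"
  unfolding sos_def using squares_coeff_pos
  by (intro sum_list_nonneg) (fastforce intro!: mult_nonneg_nonneg sum_nonneg simp: less_imp_le)

lemma excess_nonneg: "graphlike p \<Longrightarrow> 0 \<le> excess p"
  using excess_bound[of p] by auto

text \<open>Both the excess and the squares are nonnegative in the flag identity.\<close>

theorem copies_bound:
  assumes "finite V" "graphlike E"
  shows "3888 * int (copies E V) \<le> int (card V) ^ 6"
proof -
  have "0 \<le> (\<Sum>xs\<in>tuples V 6. excess (pattern E xs))"
    by (intro sum_nonneg excess_nonneg graphlike_pattern assms)
  then show ?thesis using flag_identity[OF assms] sos_nonneg[of E V] by simp
qed

lemma tuples_map: "xs \<in> tuples V k \<Longrightarrow> (\<And>x. x \<in> V \<Longrightarrow> c x \<in> W) \<Longrightarrow> map c xs \<in> tuples W k"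
  by (auto simp: tuples_def)

text \<open>In the hexagon the two pendant vertices must coincide: a copy consists of five consecutive vertices,
and the one before the root path is listed twice.\<close>

definition hex_copies :: "nat list list" where
  "hex_copies = map (\<lambda>i. map (\<lambda>j. (i + j) mod 6) [1,2,3,4,0,0]) [0..<6] @ map (\<lambda>i. map (\<lambda>j. (i + j) mod 6) [5,4,3,2,0,0]) [0..<6]"

lemma hex_copies:
  "set hex_copies \<subseteq> {xs \<in> tuples {..<6} 6. copy (pattern hex xs)}" "distinct hex_copies" "card (set hex_copies) = 12"
proof -
  have "list_all (\<lambda>xs. list_all (\<lambda>x. x < 6) xs \<and> length xs = 6 \<and> copy (pattern hex xs)) hex_copies"
    "distinct hex_copies" "length hex_copies = 12"
    unfolding hex_copies_def by code_simp+
  then show "set hex_copies \<subseteq> {xs \<in> tuples {..<6} 6. copy (pattern hex xs)}" "distinct hex_copies" "card (set hex_copies) = 12"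
    by (auto simp: list_all_iff tuples_def distinct_card)
qed

lemma copies_hex: "12 \<le> copies hex {..<6}"
  unfolding copies_def hex_copies(3)[symmetric] by (intro card_mono hex_copies(1)) (simp add: finite_tuples)

text \<open>The hexagon itself attains the bound with equality, as \<open>12 * 3888 = 6 ^ 6\<close>. Complementary
slackness in the flag identity then yields that all its nonnegative terms vanish, without any
inspection of the certificate.\<close>

lemma hex_tight: "(\<Sum>xs\<in>tuples {..<6} 6. excess (pattern hex xs)) = 0" "sos hex {..<6} = 0"
proof -
  have "0 \<le> (\<Sum>xs\<in>tuples {..<6::nat} 6. excess (pattern hex xs))"
    by (intro sum_nonneg excess_nonneg graphlike_pattern graphlike_hex)
  then show "(\<Sum>xs\<in>tuples {..<6} 6. excess (pattern hex xs)) = 0" "sos hex {..<6} = 0"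
    using flag_identity[of "{..<6}" hex] graphlike_hex sos_nonneg[of hex "{..<6}"] copies_hex by simp_all
qed

lemma hex_excess:
  assumes "xs \<in> tuples {..<6} 6"
  shows "excess (pattern hex xs) = 0"
  using hex_tight(1) assms
  by (subst (asm) sum_nonneg_eq_0_iff) (auto simp: finite_tuples intro!: excess_nonneg graphlike_pattern graphlike_hex)

lemma hex_squares:
  assumes "(c, k, m, g) \<in> set squares" "xs \<in> tuples {..<6} k"
  shows "(\<Sum>ys\<in>tuples {..<6} m. g (pattern hex (xs @ ys))) = 0"
proof -
  have "\<forall>x\<in>set (map (\<lambda>(c, k, m, g). c * (\<Sum>xs\<in>tuples {..<6} k. (\<Sum>ys\<in>tuples {..<6} m. g (pattern hex (xs @ ys)))\<^sup>2)) squares). x = 0"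
    using hex_tight(2) unfolding sos_def
    by (subst (asm) sum_list_nonneg_eq_0_iff) (fastforce intro!: mult_nonneg_nonneg sum_nonneg dest: squares_coeff_pos simp: less_imp_le)+
  then have "c * (\<Sum>xs\<in>tuples {..<6} k. (\<Sum>ys\<in>tuples {..<6} m. g (pattern hex (xs @ ys)))\<^sup>2) = 0"
    using assms(1) by fastforce
  then have "(\<Sum>xs\<in>tuples {..<6} k. (\<Sum>ys\<in>tuples {..<6} m. g (pattern hex (xs @ ys)))\<^sup>2) = 0"
    using squares_coeff_pos[OF assms(1)] by simp
  then show ?thesis using assms(2) by (subst (asm) sum_nonneg_eq_0_iff) (auto simp: finite_tuples)
qed

lemma finite_range_flag: "(c, k, m, g) \<in> set squares \<Longrightarrow> finite (range g)"
proof -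
  assume "(c, k, m, g) \<in> set squares"
  then consider r v where "g = flag4 r v" | v where "g = flag2 v" unfolding squares_def by auto
  then show ?thesis
  proof cases
    case 1
    have "range g \<subseteq> insert 0 ((\<lambda>t. v ! bidx t) ` {t. set t \<subseteq> UNIV \<and> length t = 4})"
      by (auto simp: 1 flag4_def)
    then show ?thesis by (rule finite_subset) (intro finite.insertI finite_imageI finite_lists_length_eq, simp)
  next
    case 2
    have "range g \<subseteq> insert 0 ((\<lambda>t. v ! (flag_index ! bidx t)) ` {t. set t \<subseteq> UNIV \<and> length t = 5})"
      by (auto simp: 2 flag2_def)
    then show ?thesis by (rule finite_subset) (intro finite.insertI finite_imageI finite_lists_length_eq, simp)
  qed
qed

text \<open>The functions in \<open>squares\<close> depend on finitely many bits. The value of the bound does not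
matter, because it only enters the choice of the constants in the stability argument.\<close>

lemma flags_bounded: "\<exists>B\<ge>0. \<forall>(c, k, m, g)\<in>set squares. c \<le> B \<and> (\<forall>p. \<bar>g p\<bar> \<le> (B::int))"
proof -
  define S where "S = (\<Union>(c, k, m, g)\<in>set squares. insert c (range (\<lambda>p. \<bar>g p\<bar>)))"
  have "finite (range (\<lambda>p. \<bar>g p\<bar>))" if "(c, k, m, g) \<in> set squares" for c k m g
    using finite_imageI[OF finite_range_flag[OF that], of abs] by (simp add: image_image)
  then have "finite S" unfolding S_def by auto
  then have "finite (insert 0 S)" by simp
  then have "\<forall>x\<in>insert 0 S. x \<le> Max (insert 0 S)" by simp
  then show ?thesis unfolding S_def by (intro exI[of _ "Max (insert 0 S)"]) (fastforce simp: S_def)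
qed

lemma flag_cong:
  assumes "(c, k, m, g) \<in> set squares" "\<And>i j. i < j \<Longrightarrow> j < k + m \<Longrightarrow> p i j = q i j"
  shows "g p = g q"
proof -
  consider r v where "g = flag4 r v" "k = 4" "m = 1" | v where "g = flag2 v" "k = 2" "m = 2" using assms(1) unfolding squares_def by auto
  then show ?thesis
  proof cases
    case 1
    have "bits 4 p = bits 4 q" by (intro bits_cong assms(2)) (simp_all add: 1)
    then show ?thesis using assms(2) by (simp add: 1 flag4_def)
  next
    case 2
    then show ?thesis using assms(2) by (simp add: flag2_def)
  qed
qed

section \<open>Colourings from rooted paths\<close>

text \<open>If the path \<open>1, 2, 3, 4\<close> is the root in the hexagon, then a vertex is determined by its
neighbours in the root. The vertex 0 has the neighbour 1 only, and its colour serves as the default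
for neighbourhoods that do not occur in the hexagon.\<close>

definition colour_of :: "bool list \<Rightarrow> nat" where
  "colour_of t = (if t = [False, True, False, False] then 1 else if t = [True, False, True, False] then 2 else
     if t = [False, True, False, True] then 3 else if t = [False, False, True, False] then 4 else
     if t = [False, False, False, True] then 5 else 0)"

definition roots :: "('a \<Rightarrow> 'a \<Rightarrow> bool) \<Rightarrow> 'a set \<Rightarrow> 'a list set" where
  "roots E V = {r \<in> tuples V 4. bits 4 (pattern E r) = root_path}"

definition root_colour :: "('a \<Rightarrow> 'a \<Rightarrow> bool) \<Rightarrow> 'a list \<Rightarrow> 'a \<Rightarrow> nat" where
  "root_colour E r y = colour_of (map (\<lambda>x. E x y) r)"

text \<open>Ordered pairs are counted, so this is twice the number of edges and nonedges that have to be changed.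
A pair \<open>(x, x)\<close> never contributes for a loopless \<open>E\<close>.\<close>

definition mismatches :: "('a \<Rightarrow> 'a \<Rightarrow> bool) \<Rightarrow> 'a set \<Rightarrow> ('a \<Rightarrow> nat) \<Rightarrow> nat" where
  "mismatches E V c = card {(x, y) \<in> V \<times> V. E x y \<noteq> hex (c x) (c y)}"

lemma colour_of_less: "colour_of t < 6" by (simp add: colour_of_def)

text \<open>All induced paths on four vertices of the hexagon are equivalent under its symmetries, so colours
relative to any such path describe adjacency. The nested conditions prune the search.\<close>

lemma hex_roots: "list_all (\<lambda>a. list_all (\<lambda>b. if hex a b then list_all (\<lambda>c. if hex b c \<and> \<not> hex a c then
    list_all (\<lambda>d. if hex c d \<and> \<not> hex a d \<and> \<not> hex b d then
      list_all (\<lambda>y. list_all (\<lambda>z. hex y z = hex (colour_of [hex a y, hex b y, hex c y, hex d y])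
        (colour_of [hex a z, hex b z, hex c z, hex d z])) [0..<6]) [0..<6]
      else True) [0..<6] else True) [0..<6] else True) [0..<6]) [0..<6]"
  by code_simp

lemma hex_root_colour:
  assumes "a < 6" "b < 6" "c < 6" "d < 6" "y < 6" "z < 6"
    "hex a b" "hex b c" "hex c d" "\<not> hex a c" "\<not> hex a d" "\<not> hex b d"
  shows "hex y z = hex (colour_of [hex a y, hex b y, hex c y, hex d y]) (colour_of [hex a z, hex b z, hex c z, hex d z])"
proof -
  have mem: "x \<in> {0..<6}" if "x < 6" for x :: nat using that by simp
  note 1 = bspec[OF bspec[OF hex_roots[unfolded list_all_iff set_upt] mem[OF assms(1)]] mem[OF assms(2)], unfolded if_P[OF assms(7)]]
  note 2 = bspec[OF 1 mem[OF assms(3)], unfolded if_P[OF conjI[OF assms(8,10)]]]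
  note 3 = bspec[OF 2 mem[OF assms(4)], unfolded if_P[OF conjI[OF assms(9) conjI[OF assms(11,12)]]]]
  show ?thesis by (rule bspec[OF bspec[OF 3 mem[OF assms(5)]] mem[OF assms(6)]])
qed

lemma colourable_root:
  assumes "r \<in> roots E V" "colourable (pattern E (r @ [y, z]))"
  shows "E y z = hex (root_colour E r y) (root_colour E r z)"
proof -
  obtain r0 r1 r2 r3 where r: "r = [r0, r1, r2, r3]"
    using assms(1) by (auto simp: roots_def tuples_def length_Suc_conv eval_nat_numeral)
  have path: "E r0 r1" "E r1 r2" "E r2 r3" "\<not> E r0 r2" "\<not> E r0 r3" "\<not> E r1 r3"
    using assms(1) by (auto simp: roots_def bits4 root_path_def pattern_def r)
  obtain d where d: "\<And>i. i < 6 \<Longrightarrow> d i < 6" "\<And>i j. i < 6 \<Longrightarrow> j < 6 \<Longrightarrow> pattern E (r @ [y, z]) i j = hex (d i) (d j)"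
    using assms(2) by (auto simp: colourable_def)
  have "hex (d 4) (d 5) = hex (colour_of [hex (d 0) (d 4), hex (d 1) (d 4), hex (d 2) (d 4), hex (d 3) (d 4)])
     (colour_of [hex (d 0) (d 5), hex (d 1) (d 5), hex (d 2) (d 5), hex (d 3) (d 5)])"
    by (rule hex_root_colour) (use d(1) path in \<open>auto simp: d(2)[symmetric] pattern_def r\<close>)
  then show ?thesis by (simp add: d(2)[symmetric] pattern_def r root_colour_def)
qed

lemma card_tuples_filter: "finite V \<Longrightarrow> int (card {xs \<in> tuples V k. P xs}) = (\<Sum>xs\<in>tuples V k. of_bool (P xs))"
  by (simp add: finite_tuples Int_def)

lemma card_pairs:
  assumes "finite V"
  shows "int (card {(x, y) \<in> V \<times> V. W x y}) = (\<Sum>x\<in>V. \<Sum>y\<in>V. of_bool (W x y))"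
proof -
  have "{(x, y) \<in> V \<times> V. W x y} = {p \<in> V \<times> V. W (fst p) (snd p)}" by auto
  then show ?thesis unfolding sum.cartesian_product using assms by (simp add: case_prod_unfold Int_def)
qed

text \<open>A copy is an induced path on four vertices with two further vertices.\<close>

lemma copies_le_roots:
  assumes "finite V"
  shows "copies E V \<le> card (roots E V) * card V ^ 2"
proof -
  have "int (copies E V) = (\<Sum>r\<in>tuples V 4. \<Sum>ys\<in>tuples V 2. of_bool (copy (pattern E (r @ ys))))"
    unfolding copies_def card_tuples_filter[OF assms]
    using sum_tuples_append[OF assms, of "\<lambda>xs. of_bool (copy (pattern E xs)) :: int" 4 2] by simp
  also have "\<dots> \<le> (\<Sum>r\<in>tuples V 4. of_bool (r \<in> roots E V) * int (card V ^ 2))"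
  proof (rule sum_mono)
    fix r assume r: "r \<in> tuples V 4"
    have "(\<Sum>ys\<in>tuples V 2. of_bool (copy (pattern E (r @ ys))) :: int) \<le> (\<Sum>ys\<in>tuples V 2. of_bool (r \<in> roots E V))"
    proof (rule sum_mono)
      fix ys
      have "bits 4 (pattern E (r @ ys)) = bits 4 (pattern E r)"
        using r by (intro bits_cong) (auto simp: pattern_def nth_append tuples_def)
      then show "of_bool (copy (pattern E (r @ ys))) \<le> (of_bool (r \<in> roots E V) :: int)"
        using r by (auto simp: copy_def copy4_def roots_def)
    qed
    then show "(\<Sum>ys\<in>tuples V 2. of_bool (copy (pattern E (r @ ys))) :: int) \<le> of_bool (r \<in> roots E V) * int (card V ^ 2)"
      by (cases "r \<in> roots E V") (simp_all add: card_tuples[OF assms])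
  qed
  also have "\<dots> = int (card (roots E V) * card V ^ 2)"
    unfolding sum_distrib_right[symmetric] roots_def
    by (subst card_tuples_filter[OF assms, symmetric]) (auto simp: card_tuples_filter[OF assms] intro!: sum.cong arg_cong2[of _ _ _ _ "(*)"])
  finally show ?thesis by linarith
qed

text \<open>For a fixed root path, each pair of vertices that disagrees with the colouring by neighbourhoods in
the path completes the path to a tuple that is not colourable, and this has excess at least 536.\<close>

lemma excess_ge_mismatches:
  assumes "finite V" "graphlike E" "\<And>c. (\<forall>x. c x < 6) \<Longrightarrow> e \<le> mismatches E V c"
  shows "536 * int (card (roots E V)) * int e \<le> (\<Sum>xs\<in>tuples V 6. excess (pattern E xs))"
proof -
  have "536 * int (card (roots E V)) * int e = (\<Sum>r\<in>roots E V. 536 * int e)" by simp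
  also have "\<dots> \<le> (\<Sum>r\<in>roots E V. \<Sum>ys\<in>tuples V 2. excess (pattern E (r @ ys)))"
  proof (rule sum_mono)
    fix r assume r: "r \<in> roots E V"
    have "536 * int e \<le> 536 * int (mismatches E V (root_colour E r))"
      using assms(3)[of "root_colour E r"] by (simp add: root_colour_def colour_of_less)
    also have "int (mismatches E V (root_colour E r)) = (\<Sum>y\<in>V. \<Sum>z\<in>V. of_bool (E y z \<noteq> hex (root_colour E r y) (root_colour E r z)))"
      unfolding mismatches_def by (rule card_pairs[OF assms(1)])
    also have "536 * \<dots> \<le> (\<Sum>y\<in>V. \<Sum>z\<in>V. excess (pattern E (r @ [y, z])))"
      unfolding sum_distrib_left
    proof (intro sum_mono)
      fix y z
      show "536 * of_bool (E y z \<noteq> hex (root_colour E r y) (root_colour E r z)) \<le> excess (pattern E (r @ [y, z]))"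
        using colourable_root[OF r, of y z] excess_bound[OF graphlike_pattern[OF assms(2)], of "r @ [y, z]"] by auto
    qed
    also have "\<dots> = (\<Sum>ys\<in>tuples V 2. excess (pattern E (r @ ys)))" by (simp add: sum_tuples_2[OF assms(1)])
    finally show "536 * int e \<le> (\<Sum>ys\<in>tuples V 2. excess (pattern E (r @ ys)))" by simp
  qed
  also have "\<dots> \<le> (\<Sum>r\<in>tuples V 4. \<Sum>ys\<in>tuples V 2. excess (pattern E (r @ ys)))"
    by (intro sum_mono2 finite_tuples assms(1) sum_nonneg excess_nonneg graphlike_pattern assms(2)) (auto simp: roots_def)
  also have "\<dots> = (\<Sum>xs\<in>tuples V 6. excess (pattern E xs))"
    using sum_tuples_append[OF assms(1), of "\<lambda>xs. excess (pattern E xs)" 4 2] by simp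
  finally show ?thesis .
qed

lemma card_tuples_pair:
  assumes "finite V" "i < q" "j < q" "i \<noteq> j"
  shows "card {zs \<in> tuples V q. W (zs ! i) (zs ! j)} = card {(x, y) \<in> V \<times> V. W x y} * card V ^ (q - 2)"
proof -
  define rest where "rest = filter (\<lambda>l. l \<noteq> i \<and> l \<noteq> j) [0..<q]"
  have \<pi>: "i # j # rest \<in> permutations_of_set {..<q}"
    using assms by (intro permutations_of_setI) (auto simp: rest_def)
  then have l: "length rest = q - 2" using length_finite_permutations_of_set[OF \<pi>] by simp
  have q: "q = 2 + (q - 2)" using assms by simp
  have "int (card {zs \<in> tuples V q. W (zs ! i) (zs ! j)}) = (\<Sum>zs\<in>tuples V q. of_bool (W (map ((!) zs) (i # j # rest) ! 0) (map ((!) zs) (i # j # rest) ! 1)))"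
    by (simp add: card_tuples_filter[OF assms(1)])
  also have "\<dots> = (\<Sum>zs\<in>tuples V q. of_bool (W (zs ! 0) (zs ! 1)))"
    by (rule sum_tuples_permute[OF assms(1) \<pi>, of "\<lambda>zs. of_bool (W (zs ! 0) (zs ! 1))"])
  also have "\<dots> = (\<Sum>xs\<in>tuples V 2. \<Sum>ys\<in>tuples V (q - 2). of_bool (W ((xs @ ys) ! 0) ((xs @ ys) ! 1)))"
    by (subst q, subst sum_tuples_append[OF assms(1)]) simp
  also have "\<dots> = (\<Sum>x\<in>V. \<Sum>y\<in>V. of_bool (W x y) * int (card V ^ (q - 2)))"
    by (simp add: sum_tuples_2[OF assms(1)] card_tuples[OF assms(1)] mult.commute)
  also have "\<dots> = (\<Sum>x\<in>V. \<Sum>y\<in>V. of_bool (W x y)) * int (card V ^ (q - 2))"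
    by (simp only: sum_distrib_right)
  also have "(\<Sum>x\<in>V. \<Sum>y\<in>V. of_bool (W x y)) = int (card {(x, y) \<in> V \<times> V. W x y})"
    by (simp only: card_pairs[OF assms(1)])
  finally show ?thesis by (simp only: of_nat_mult[symmetric] of_nat_eq_iff)
qed

text \<open>A union bound over the pairs of positions, each of which contributes the same number of tuples.\<close>

lemma card_tuples_altered:
  assumes "finite V"
  shows "card {zs \<in> tuples V q. \<exists>i j. i < j \<and> j < q \<and> W (zs ! i) (zs ! j)} \<le> q\<^sup>2 * card {(x, y) \<in> V \<times> V. W x y} * card V ^ (q - 2)"
proof -
  have "{zs \<in> tuples V q. \<exists>i j. i < j \<and> j < q \<and> W (zs ! i) (zs ! j)} \<subseteq>
     (\<Union>(i, j)\<in>{(i, j). i < j \<and> j < q}. {zs \<in> tuples V q. W (zs ! i) (zs ! j)})" by auto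
  moreover have fin: "finite {(i, j). i < j \<and> j < q}"
    by (rule finite_subset[of _ "{..<q} \<times> {..<q}"]) auto
  ultimately have "card {zs \<in> tuples V q. \<exists>i j. i < j \<and> j < q \<and> W (zs ! i) (zs ! j)} \<le>
     card (\<Union>(i, j)\<in>{(i, j). i < j \<and> j < q}. {zs \<in> tuples V q. W (zs ! i) (zs ! j)})"
    by (intro card_mono) (auto intro: finite_subset[OF _ finite_tuples[OF assms]])
  also have "\<dots> \<le> (\<Sum>(i, j)\<in>{(i, j). i < j \<and> j < q}. card {zs \<in> tuples V q. W (zs ! i) (zs ! j)})"
    using card_UN_le[OF fin] by (simp add: case_prod_unfold)
  also have "\<dots> = (\<Sum>(i, j)\<in>{(i, j). i < j \<and> j < q}. card {(x, y) \<in> V \<times> V. W x y} * card V ^ (q - 2))"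
    by (intro sum.cong refl, clarify, rule card_tuples_pair[OF assms]) simp_all
  also have "\<dots> = card {(i, j). i < j \<and> j < q} * (card {(x, y) \<in> V \<times> V. W x y} * card V ^ (q - 2))" by simp
  also have "card {(i, j). i < j \<and> j < q} \<le> card ({..<q} \<times> {..<q})" by (intro card_mono) auto
  finally show ?thesis by (simp add: power2_eq_square mult.assoc)
qed

section \<open>Blowups of the hexagon\<close>

definition part_size :: "'a set \<Rightarrow> ('a \<Rightarrow> nat) \<Rightarrow> nat \<Rightarrow> nat" where
  "part_size V c i = card {x \<in> V. c x = i}"

lemma sum_by_colour:
  assumes "finite V" "\<And>x. x \<in> V \<Longrightarrow> c x < 6"
  shows "(\<Sum>x\<in>V. f (c x)) = (\<Sum>i<6. int (part_size V c i) * f i)"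
proof -
  have "(\<Sum>x\<in>V. f (c x)) = (\<Sum>i<6. \<Sum>x\<in>{x \<in> V. c x = i}. f (c x))"
    using assms by (intro sum.group[symmetric]) auto
  also have "\<dots> = (\<Sum>i<6. int (part_size V c i) * f i)" by (intro sum.cong) (auto simp: part_size_def)
  finally show ?thesis .
qed

lemma tuples_0: "tuples V 0 = {[]}" by (auto simp: tuples_def)

lemma sum_tuples_Suc: "finite V \<Longrightarrow> (\<Sum>xs\<in>tuples V (Suc m). f xs) = (\<Sum>x\<in>V. \<Sum>xs\<in>tuples V m. f (x # xs))"
  using sum_tuples_append[of V f "Suc 0" m] by (simp add: sum_tuples_1)

lemma sum_tuples_by_colour:
  assumes "finite V" "\<And>x. x \<in> V \<Longrightarrow> c x < 6"
  shows "(\<Sum>ys\<in>tuples V m. f (map c ys)) = (\<Sum>zs\<in>tuples {..<6} m. int (prod_list (map (part_size V c) zs)) * f zs)"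
proof (induction m arbitrary: f)
  case 0
  then show ?case by (simp add: tuples_0)
next
  case (Suc m)
  have "(\<Sum>ys\<in>tuples V (Suc m). f (map c ys)) = (\<Sum>x\<in>V. \<Sum>zs\<in>tuples {..<6} m. int (prod_list (map (part_size V c) zs)) * f (c x # zs))"
    using Suc[of "\<lambda>zs. f (c _ # zs)"] by (simp add: sum_tuples_Suc assms(1))
  also have "\<dots> = (\<Sum>i<6. int (part_size V c i) * (\<Sum>zs\<in>tuples {..<6} m. int (prod_list (map (part_size V c) zs)) * f (i # zs)))"
    by (rule sum_by_colour[OF assms])
  finally show ?case by (simp add: sum_tuples_Suc sum_distrib_left mult.assoc)
qed

text \<open>If all factors are close to \<open>\<mu>\<close>, then a product of \<open>k\<close> factors is close to \<open>\<mu> ^ k\<close>;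
the bounds \<open>0\<close> and \<open>n ^ k\<close> on the product are carried along for the induction.\<close>

lemma prod_list_bound:
  fixes N :: "'a \<Rightarrow> real" and n \<mu> \<eta> :: real
  assumes "\<And>z. z \<in> set zs \<Longrightarrow> 0 \<le> N z \<and> N z \<le> n \<and> \<bar>N z - \<mu>\<bar> \<le> \<eta> * n" "0 \<le> \<mu>" "\<mu> \<le> n"
  shows "\<bar>prod_list (map N zs) - \<mu> ^ length zs\<bar> \<le> real (length zs) * \<eta> * n ^ length zs \<and> 0 \<le> prod_list (map N zs) \<and> prod_list (map N zs) \<le> n ^ length zs"
  using assms(1)
proof (induction zs)
  case (Cons z zs)
  define P where "P = prod_list (map N zs)"
  define m where "m = length zs"
  have IH: "\<bar>P - \<mu> ^ m\<bar> \<le> real m * \<eta> * n ^ m" "0 \<le> P" "P \<le> n ^ m" using Cons by (auto simp: P_def m_def)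
  have z: "0 \<le> N z" "N z \<le> n" "\<bar>N z - \<mu>\<bar> \<le> \<eta> * n" using Cons.prems[of z] by auto
  have n: "0 \<le> n" using assms(2,3) by simp
  have "N z * P - \<mu> * \<mu> ^ m = (N z - \<mu>) * P + \<mu> * (P - \<mu> ^ m)" by (simp add: algebra_simps)
  then have "\<bar>N z * P - \<mu> * \<mu> ^ m\<bar> \<le> \<bar>N z - \<mu>\<bar> * P + \<mu> * \<bar>P - \<mu> ^ m\<bar>"
    using abs_triangle_ineq[of "(N z - \<mu>) * P" "\<mu> * (P - \<mu> ^ m)"] IH(2) assms(2) by (simp add: abs_mult)
  also have "\<dots> \<le> (\<eta> * n) * n ^ m + n * (real m * \<eta> * n ^ m)"
    using z IH n assms by (intro add_mono mult_mono) (auto intro: order_trans[OF abs_ge_zero])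
  also have "\<dots> = real (Suc m) * \<eta> * n ^ Suc m" by (simp add: algebra_simps)
  finally have "\<bar>N z * P - \<mu> * \<mu> ^ m\<bar> \<le> real (Suc m) * \<eta> * n ^ Suc m" .
  moreover have "N z * P \<le> n * n ^ m" using z IH n by (intro mult_mono) auto
  ultimately show ?case using z IH by (simp add: P_def m_def)
qed simp

lemma real_prod_list: "real (prod_list (map N zs)) = prod_list (map (\<lambda>z. real (N z)) zs)"
  by (induction zs) simp_all

text \<open>The relation is defined on all of the type and only restricted to \<open>V\<close> by counting tuples in
\<open>V\<close>; this relates tuples in the blowup directly to tuples of colours in the hexagon.\<close>

definition blow :: "('a \<Rightarrow> nat) \<Rightarrow> 'a \<Rightarrow> 'a \<Rightarrow> bool" where
  "blow c x y = hex (c x) (c y)"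

lemma graphlike_blow: "graphlike (blow c)"
  using graphlike_hex by (auto simp: graphlike_def blow_def)

lemma pattern_blow: "i < length xs \<Longrightarrow> j < length xs \<Longrightarrow> pattern (blow c) xs i j = pattern hex (map c xs) i j"
  by (simp add: pattern_def blow_def)

lemma excess_blow:
  assumes "xs \<in> tuples V 6" "\<And>x. x \<in> V \<Longrightarrow> c x < 6"
  shows "excess (pattern (blow c) xs) = 0"
proof -
  have "excess (pattern (blow c) xs) = excess (pattern hex (map c xs))"
    using assms(1) by (intro excess_cong pattern_blow) (auto simp: tuples_def)
  also have "\<dots> = 0" using assms by (intro hex_excess tuples_map) auto
  finally show ?thesis .
qed

text \<open>The inner sums of the squares vanish on the hexagon by \<open>hex_squares\<close>, hence on blowups with
parts of size exactly \<open>n / 6\<close>. With parts within \<open>\<eta> * n\<close> of this size, each of the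
\<open>6 ^ m\<close> products of part sizes changes by at most \<open>m * \<eta> * n ^ m\<close>, where \<open>m \<le> 2\<close>.\<close>

lemma flag_sum_blow:
  fixes B \<eta> :: real
  assumes g: "(w, k, m, g) \<in> set squares" and V: "finite V" and c: "\<And>x. x \<in> V \<Longrightarrow> c x < 6" and xs: "xs \<in> tuples V k"
    and B: "0 \<le> (B::real)" "\<And>p. real_of_int \<bar>g p\<bar> \<le> B"
    and \<eta>: "\<And>i. i < 6 \<Longrightarrow> \<bar>real (part_size V c i) - card V / 6\<bar> \<le> \<eta> * card V"
  shows "real_of_int \<bar>\<Sum>ys\<in>tuples V m. g (pattern (blow c) (xs @ ys))\<bar> \<le> 72 * \<eta> * B * card V ^ m"
proof -
  define n where "n = real (card V)"
  define h where "h zs = g (pattern hex (map c xs @ zs))" for zs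
  have m: "m = 1 \<or> m = 2" using squares_dims[OF g] by auto
  have \<eta>0: "0 \<le> \<eta> * n" using \<eta>[of 0] by (auto simp: n_def intro: order_trans[OF abs_ge_zero])
  have "(\<Sum>ys\<in>tuples V m. g (pattern (blow c) (xs @ ys))) = (\<Sum>ys\<in>tuples V m. h (map c ys))"
  proof (intro sum.cong refl)
    fix ys assume "ys \<in> tuples V m"
    then have "length (xs @ ys) = k + m" using xs by (simp add: tuples_def)
    then show "g (pattern (blow c) (xs @ ys)) = h (map c ys)"
      unfolding h_def map_append[symmetric] by (intro flag_cong[OF g] pattern_blow) auto
  qed
  also have "\<dots> = (\<Sum>zs\<in>tuples {..<6} m. int (prod_list (map (part_size V c) zs)) * h zs)"
    by (rule sum_tuples_by_colour[OF V c])
  finally have "real_of_int (\<Sum>ys\<in>tuples V m. g (pattern (blow c) (xs @ ys))) =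
      (\<Sum>zs\<in>tuples {..<6} m. prod_list (map (\<lambda>z. real (part_size V c z)) zs) * h zs)"
    by (simp add: real_prod_list)
  also have "\<dots> = (\<Sum>zs\<in>tuples {..<6} m. (prod_list (map (\<lambda>z. real (part_size V c z)) zs) - (n / 6) ^ m) * h zs) +
       (n / 6) ^ m * real_of_int (\<Sum>zs\<in>tuples {..<6} m. h zs)"
    by (simp add: left_diff_distrib sum_subtractf sum_distrib_left)
  also have "(\<Sum>zs\<in>tuples {..<6} m. h zs) = 0"
    unfolding h_def using c by (intro hex_squares[OF g] tuples_map[OF xs]) auto
  finally have "real_of_int \<bar>\<Sum>ys\<in>tuples V m. g (pattern (blow c) (xs @ ys))\<bar> \<le>
      (\<Sum>zs\<in>tuples {..<6} m. \<bar>(prod_list (map (\<lambda>z. real (part_size V c z)) zs) - (n / 6) ^ m) * h zs\<bar>)"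
    using sum_abs by simp
  also have "\<dots> \<le> (\<Sum>zs\<in>tuples {..<6::nat} m. (real m * \<eta> * n ^ m) * B)"
  proof (rule sum_mono)
    fix zs :: "nat list" assume zs: "zs \<in> tuples {..<6} m"
    have "\<bar>prod_list (map (\<lambda>z. real (part_size V c z)) zs) - (n / 6) ^ length zs\<bar> \<le> real (length zs) * \<eta> * n ^ length zs"
    proof (rule conjunct1[OF prod_list_bound])
      fix z assume "z \<in> set zs"
      then have "z < 6" using zs by (auto simp: tuples_def)
      moreover have "part_size V c z \<le> card V" unfolding part_size_def using V by (intro card_mono) auto
      ultimately show "0 \<le> real (part_size V c z) \<and> real (part_size V c z) \<le> n \<and> \<bar>real (part_size V c z) - n / 6\<bar> \<le> \<eta> * n"
        using \<eta>[of z] by (simp add: n_def)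
    qed (simp_all add: n_def)
    then have "\<bar>prod_list (map (\<lambda>z. real (part_size V c z)) zs) - (n / 6) ^ m\<bar> \<le> real m * \<eta> * n ^ m"
      using zs by (simp add: tuples_def)
    moreover have "real_of_int \<bar>h zs\<bar> \<le> B" unfolding h_def using B(2) by simp
    ultimately show "\<bar>(prod_list (map (\<lambda>z. real (part_size V c z)) zs) - (n / 6) ^ m) * h zs\<bar> \<le> (real m * \<eta> * n ^ m) * B"
      unfolding abs_mult by (intro mult_mono) auto
  qed
  also have "\<dots> = 6 ^ m * real m * (\<eta> * n ^ m * B)" by (simp add: card_tuples)
  also have "\<dots> \<le> 72 * (\<eta> * n ^ m * B)"
  proof -
    have "0 \<le> \<eta> * n ^ m" using m \<eta>0 mult_nonneg_nonneg[OF \<eta>0, of n] by (auto simp: power2_eq_square mult.assoc n_def)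
    then have "0 \<le> \<eta> * n ^ m * B" using B(1) by (rule mult_nonneg_nonneg)
    moreover have "6 ^ m * real m \<le> 72" using m by auto
    ultimately show ?thesis by (intro mult_right_mono)
  qed
  finally show ?thesis by (simp add: n_def mult_ac)
qed

text \<open>By \<open>S\<^sup>2 - T\<^sup>2 \<le> 2 * S * (S - T)\<close>, the change of a square is at most the product of the inner sum
\<open>S\<close> on the blowup, which is of order \<open>\<eta>\<close>, and its change \<open>S - T\<close>, which only the
mismatched pairs cause. So a factor \<open>\<eta>\<close> appears in addition to the number of mismatches.\<close>

lemma square_term_diff:
  fixes E :: "'a \<Rightarrow> 'a \<Rightarrow> bool" and B \<eta> :: real
  assumes g: "(w, k, m, g) \<in> set squares" and V: "finite V" and c: "\<And>x. x \<in> V \<Longrightarrow> c x < 6"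
    and B: "0 \<le> B" "real_of_int w \<le> B" "\<And>p. real_of_int \<bar>g p\<bar> \<le> B"
    and \<eta>: "\<And>i. i < 6 \<Longrightarrow> \<bar>real (part_size V c i) - card V / 6\<bar> \<le> \<eta> * card V"
  shows "real_of_int (w * (\<Sum>xs\<in>tuples V k. (\<Sum>ys\<in>tuples V m. g (pattern (blow c) (xs @ ys)))\<^sup>2))
     - 7200 * B ^ 3 * \<eta> * mismatches E V c * card V ^ 4
     \<le> real_of_int (w * (\<Sum>xs\<in>tuples V k. (\<Sum>ys\<in>tuples V m. g (pattern E (xs @ ys)))\<^sup>2))"
proof -
  define n where "n = real (card V)"
  define SE where "SE xs = real_of_int (\<Sum>ys\<in>tuples V m. g (pattern E (xs @ ys)))" for xs
  define SH where "SH xs = real_of_int (\<Sum>ys\<in>tuples V m. g (pattern (blow c) (xs @ ys)))" for xs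
  define W where "W x y \<longleftrightarrow> E x y \<noteq> hex (c x) (c y)" for x y
  \<comment> \<open>since \<open>k + m \<le> 5\<close>, at most \<open>25 * n ^ (k + m - 2)\<close> tuples contain a given pair, and \<open>7200 = 2 * 72 * 2 * 25\<close>\<close>
  define bad where "bad zs \<longleftrightarrow> (\<exists>i j. i < j \<and> j < k + m \<and> W (zs ! i) (zs ! j))" for zs
  have km: "(k, m) = (4, 1) \<or> (k, m) = (2, 2)" by (rule squares_dims[OF g])
  have w: "0 \<le> real_of_int w" using squares_coeff_pos[OF g] by simp
  have \<eta>0: "0 \<le> \<eta> * n" using \<eta>[of 0] by (auto simp: n_def intro: order_trans[OF abs_ge_zero])
  have n0: "0 \<le> n" by (simp add: n_def)
  have SH: "\<bar>SH xs\<bar> \<le> 72 * \<eta> * B * n ^ m" if "xs \<in> tuples V k" for xs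
    using flag_sum_blow[OF g V c that B(1,3) \<eta>] by (simp add: SH_def n_def)
  define hits :: "'a list \<Rightarrow> real" where "hits xs = (\<Sum>ys\<in>tuples V m. of_bool (bad (xs @ ys)))" for xs
  have diff: "\<bar>SE xs - SH xs\<bar> \<le> 2 * B * hits xs" if xs: "xs \<in> tuples V k" for xs
  proof -
    have "\<bar>SE xs - SH xs\<bar> = \<bar>\<Sum>ys\<in>tuples V m. real_of_int (g (pattern E (xs @ ys)) - g (pattern (blow c) (xs @ ys)))\<bar>"
      by (simp add: SE_def SH_def sum_subtractf)
    also have "\<dots> \<le> (\<Sum>ys\<in>tuples V m. 2 * B * of_bool (bad (xs @ ys)))"
    proof (rule order_trans[OF sum_abs sum_mono])
      fix ys assume ys: "ys \<in> tuples V m"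
      show "\<bar>real_of_int (g (pattern E (xs @ ys)) - g (pattern (blow c) (xs @ ys)))\<bar> \<le> 2 * B * of_bool (bad (xs @ ys))"
      proof (cases "bad (xs @ ys)")
        case True
        have "\<bar>real_of_int (g (pattern E (xs @ ys)) - g (pattern (blow c) (xs @ ys)))\<bar> \<le>
          real_of_int \<bar>g (pattern E (xs @ ys))\<bar> + real_of_int \<bar>g (pattern (blow c) (xs @ ys))\<bar>" by simp
        then show ?thesis using True B(3)[of "pattern E (xs @ ys)"] B(3)[of "pattern (blow c) (xs @ ys)"] by simp
      next
        case False
        have "g (pattern E (xs @ ys)) = g (pattern (blow c) (xs @ ys))"
        proof (rule flag_cong[OF g])
          fix i j assume "i < j" "j < k + m"
          then show "pattern E (xs @ ys) i j = pattern (blow c) (xs @ ys) i j"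
            using False unfolding bad_def W_def by (auto simp: pattern_def blow_def)
        qed
        then show ?thesis using B(1) by simp
      qed
    qed
    finally show ?thesis by (simp only: sum_distrib_left hits_def)
  qed
  have "(\<Sum>xs\<in>tuples V k. (\<Sum>ys\<in>tuples V m. of_bool (bad (xs @ ys)) :: int)) = int (card {zs \<in> tuples V (k + m). bad zs})"
    using sum_tuples_append[OF V, of "\<lambda>zs. of_bool (bad zs) :: int" k m] card_tuples_filter[OF V, of "k + m" bad] by simp
  also have "\<dots> \<le> int ((k + m)\<^sup>2 * mismatches E V c * card V ^ (k + m - 2))"
    using card_tuples_altered[OF V, of "k + m" W] unfolding bad_def mismatches_def W_def by (intro of_nat_mono)
  also have "\<dots> \<le> int (25 * mismatches E V c * card V ^ (k + m - 2))"
    using km by (intro of_nat_mono mult_right_mono) auto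
  finally have "real_of_int (\<Sum>xs\<in>tuples V k. (\<Sum>ys\<in>tuples V m. of_bool (bad (xs @ ys)))) \<le> real_of_int (int (25 * mismatches E V c * card V ^ (k + m - 2)))"
    by (rule of_int_le_iff[THEN iffD2])
  then have bad: "(\<Sum>xs\<in>tuples V k. hits xs) \<le> 25 * real (mismatches E V c) * n ^ (k + m - 2)"
    by (simp add: n_def hits_def)
  have "(\<Sum>xs\<in>tuples V k. (SH xs)\<^sup>2) - (\<Sum>xs\<in>tuples V k. (SE xs)\<^sup>2) = (\<Sum>xs\<in>tuples V k. (SH xs)\<^sup>2 - (SE xs)\<^sup>2)"
    by (simp add: sum_subtractf)
  also have "\<dots> \<le> (\<Sum>xs\<in>tuples V k. 2 * (72 * \<eta> * B * n ^ m) * (2 * B * hits xs))"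
  proof (rule sum_mono)
    fix xs assume xs: "xs \<in> tuples V k"
    have "(SH xs)\<^sup>2 - (SE xs)\<^sup>2 = 2 * (SH xs * (SH xs - SE xs)) - (SH xs - SE xs)\<^sup>2" by (simp add: power2_eq_square algebra_simps)
    also have "\<dots> \<le> 2 * (SH xs * (SH xs - SE xs))" by simp
    also have "\<dots> \<le> 2 * (\<bar>SH xs\<bar> * \<bar>SE xs - SH xs\<bar>)"
      using abs_ge_self[of "SH xs * (SH xs - SE xs)"] by (simp add: abs_mult abs_minus_commute)
    also have "\<dots> \<le> 2 * ((72 * \<eta> * B * n ^ m) * (2 * B * hits xs))"
      using order_trans[OF abs_ge_zero SH[OF xs]] by (intro mult_left_mono mult_mono SH[OF xs] diff[OF xs]) auto
    finally show "(SH xs)\<^sup>2 - (SE xs)\<^sup>2 \<le> 2 * (72 * \<eta> * B * n ^ m) * (2 * B * hits xs)" by simp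
  qed
  also have "\<dots> = (\<Sum>xs\<in>tuples V k. (288 * \<eta> * B\<^sup>2 * n ^ m) * hits xs)"
    by (intro sum.cong refl) (simp add: power2_eq_square)
  also have "\<dots> = 288 * \<eta> * B\<^sup>2 * n ^ m * (\<Sum>xs\<in>tuples V k. hits xs)"
    by (simp only: sum_distrib_left)
  also have "\<dots> \<le> 288 * \<eta> * B\<^sup>2 * n ^ m * (25 * real (mismatches E V c) * n ^ (k + m - 2))"
  proof (rule mult_left_mono[OF bad])
    have "n ^ m = n * n ^ (m - 1)" using km by (auto simp: power2_eq_square)
    then have "288 * \<eta> * B\<^sup>2 * n ^ m = 288 * (\<eta> * n) * B\<^sup>2 * n ^ (m - 1)" by simp
    also have "0 \<le> \<dots>" using \<eta>0 n0 by (intro mult_nonneg_nonneg[OF mult_nonneg_nonneg[OF mult_nonneg_nonneg[OF _ \<eta>0]]]) auto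
    finally show "0 \<le> 288 * \<eta> * B\<^sup>2 * n ^ m" .
  qed
  also have "\<dots> = 7200 * \<eta> * B\<^sup>2 * real (mismatches E V c) * n ^ 4"
    using km by (auto simp: power2_eq_square power3_eq_cube power4_eq_xxxx)
  finally have le: "(\<Sum>xs\<in>tuples V k. (SH xs)\<^sup>2) - (\<Sum>xs\<in>tuples V k. (SE xs)\<^sup>2) \<le> 7200 * \<eta> * B\<^sup>2 * real (mismatches E V c) * n ^ 4" .
  have "real_of_int w * ((\<Sum>xs\<in>tuples V k. (SH xs)\<^sup>2) - (\<Sum>xs\<in>tuples V k. (SE xs)\<^sup>2)) \<le> real_of_int w * (7200 * \<eta> * B\<^sup>2 * real (mismatches E V c) * n ^ 4)"
    by (rule mult_left_mono[OF le w])
  also have "\<dots> \<le> B * (7200 * \<eta> * B\<^sup>2 * real (mismatches E V c) * n ^ 4)"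
  proof (rule mult_right_mono[OF B(2)])
    have "7200 * \<eta> * B\<^sup>2 * real (mismatches E V c) * n ^ 4 = 7200 * (\<eta> * n) * B\<^sup>2 * real (mismatches E V c) * n ^ 3"
      by (simp add: power4_eq_xxxx power3_eq_cube)
    also have "0 \<le> \<dots>" using \<eta>0 n0 by (intro mult_nonneg_nonneg[OF mult_nonneg_nonneg[OF mult_nonneg_nonneg[OF mult_nonneg_nonneg[OF _ \<eta>0]]]]) auto
    finally show "0 \<le> 7200 * \<eta> * B\<^sup>2 * real (mismatches E V c) * n ^ 4" .
  qed
  also have "\<dots> = 7200 * B ^ 3 * \<eta> * real (mismatches E V c) * n ^ 4" by (simp add: power2_eq_square power3_eq_cube)
  finally have "real_of_int w * (\<Sum>xs\<in>tuples V k. (SH xs)\<^sup>2) - real_of_int w * (\<Sum>xs\<in>tuples V k. (SE xs)\<^sup>2) \<le> 7200 * B ^ 3 * \<eta> * real (mismatches E V c) * n ^ 4"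
    by (simp add: right_diff_distrib)
  then show ?thesis by (simp add: SE_def SH_def n_def)
qed

lemma real_of_int_sum_list: "real_of_int (\<Sum>x\<leftarrow>xs. f x) = (\<Sum>x\<leftarrow>xs. real_of_int (f x))"
  by (induction xs) simp_all

lemma sos_diff:
  fixes E :: "'a \<Rightarrow> 'a \<Rightarrow> bool" and B \<eta> :: real
  assumes V: "finite V" and c: "\<And>x. x \<in> V \<Longrightarrow> c x < 6"
    and B: "0 \<le> B" "\<And>w k m g. (w, k, m, g) \<in> set squares \<Longrightarrow> real_of_int w \<le> B \<and> (\<forall>p. real_of_int \<bar>g p\<bar> \<le> B)"
    and \<eta>: "\<And>i. i < 6 \<Longrightarrow> \<bar>real (part_size V c i) - card V / 6\<bar> \<le> \<eta> * card V"
  shows "real_of_int (sos (blow c) V) - length squares * (7200 * B ^ 3 * \<eta> * mismatches E V c * card V ^ 4) \<le> real_of_int (sos E V)"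
proof -
  define f where "f E = (\<lambda>(w, k, m, g). real_of_int (w * (\<Sum>xs\<in>tuples V k. (\<Sum>ys\<in>tuples V m. g (pattern E (xs @ ys)))\<^sup>2)))" for E
  have sos: "real_of_int (sos E V) = (\<Sum>q\<leftarrow>squares. f E q)" for E
    unfolding sos_def f_def real_of_int_sum_list by (simp add: case_prod_unfold)
  have "(\<Sum>q\<leftarrow>squares. f (blow c) q - 7200 * B ^ 3 * \<eta> * mismatches E V c * card V ^ 4) \<le> (\<Sum>q\<leftarrow>squares. f E q)"
  proof (rule sum_list_mono)
    fix q assume q: "q \<in> set squares"
    obtain w k m g where qq: "q = (w, k, m, g)" by (cases q) auto
    show "f (blow c) q - 7200 * B ^ 3 * \<eta> * mismatches E V c * card V ^ 4 \<le> f E q"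
      using square_term_diff[OF q[unfolded qq] V c B(1) _ _ \<eta>, of E] B(2)[OF q[unfolded qq]] by (simp add: f_def qq)
  qed
  then show ?thesis by (simp add: sos sum_list_subtractf sum_list_triv)
qed

section \<open>The polynomial of the hexagon\<close>

text \<open>In \<open>a1\<close>, \<open>a2\<close>, \<open>a3\<close> this compares a quadratic form with the square of a linear form. The
difference is diagonalised by completing squares; multiplied by the leading coefficient it is a sum
of two squares.\<close>

lemma quadratic_form_bound:
  fixes a1 a2 a3 b1 b2 b3 :: real
  assumes "b1 > 0" "b2 > 0" "b3 > 0"
  shows "4 * (b1*b2 + b1*b3 + b2*b3) * (a1*a2*(b1+b2) + a1*a3*(b1+b3) + a2*a3*(b2+b3))
    \<le> (a1+a2+a3)\<^sup>2 * ((b1+b2)*(b1+b3)*(b2+b3))"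
proof -
  define x y z where "x = b2 + b3" and "y = b1 + b3" and "z = b1 + b2"
  define s where "s = b1*b2 + b1*b3 + b2*b3"
  define P where "P = z * y * x"
  have "P > 0" using assms by (simp add: P_def x_def y_def z_def)
  \<comment> \<open>complete the square in \<open>a1\<close>; the rest is a perfect square in \<open>a2\<close> and \<open>a3\<close> up to the factor \<open>4 * s\<close>\<close>
  have "P * ((a1+a2+a3)\<^sup>2 * P - 4 * s * (a1*a2*z + a1*a3*y + a2*a3*x)) =
     (P * a1 + z * (2*b3\<^sup>2 - x*y) * a2 + y * (2*b2\<^sup>2 - x*z) * a3)\<^sup>2 + 4 * s * (z * b3 * a2 - y * b2 * a3)\<^sup>2"
    unfolding P_def s_def x_def y_def z_def by algebra
  also have "\<dots> \<ge> 0" using assms by (intro add_nonneg_nonneg mult_nonneg_nonneg) (auto simp: s_def)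
  finally have "0 \<le> (a1+a2+a3)\<^sup>2 * P - 4 * s * (a1*a2*z + a1*a3*y + a2*a3*x)"
    using \<open>P > 0\<close> by (simp add: zero_le_mult_iff)
  then show ?thesis by (simp add: P_def s_def x_def y_def z_def)
qed

text \<open>With \<open>B\<close> and \<open>s\<close> fixed, the left-hand side increases with \<open>t\<close> in the relevant range, so
\<open>t\<close> can be replaced by its upper bound \<open>s\<^sup>2 / (3 * B)\<close>. The resulting inequality in \<open>B\<^sup>2\<close>
and \<open>s\<close> has the factor \<open>B\<^sup>2 - 3 * s\<close>, which vanishes only for equal \<open>b1\<close>, \<open>b2\<close>, \<open>b3\<close>.\<close>

lemma symmetric_bound:
  fixes b1 b2 b3 :: real
  assumes "b1 > 0" "b2 > 0" "b3 > 0"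
  defines "B \<equiv> b1 + b2 + b3" and "s \<equiv> b1*b2 + b1*b3 + b2*b3" and "t \<equiv> b1*b2*b3"
  shows "243 * t * (B * s - t) \<le> 8 * s * B ^ 4"
    and "243 * t * (B * s - t) = 8 * s * B ^ 4 \<Longrightarrow> b1 = b2 \<and> b2 = b3"
proof -
  have pos: "B > 0" "s > 0" "t > 0" using assms by (simp_all add: B_def s_def t_def add_pos_pos)
  have d: "B\<^sup>2 - 3 * s = ((b1-b2)\<^sup>2 + (b1-b3)\<^sup>2 + (b2-b3)\<^sup>2) / 2" unfolding B_def s_def by algebra
  have s: "3 * s \<le> B\<^sup>2" using d by (smt (verit) zero_le_power2 divide_nonneg_pos)
  have "s\<^sup>2 - 3 * B * t = ((b1*b2-b1*b3)\<^sup>2 + (b1*b2-b2*b3)\<^sup>2 + (b1*b3-b2*b3)\<^sup>2) / 2" unfolding B_def s_def t_def by algebra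
  then have t: "3 * B * t \<le> s\<^sup>2" by (smt (verit) zero_le_power2 divide_nonneg_pos)
  define u where "u = s\<^sup>2 / (3 * B)"
  have u: "t \<le> u" "3 * B * u = s\<^sup>2" using t pos by (simp_all add: u_def field_simps)
  have "u \<le> B * s / 9"
  proof -
    have "s * (3 * s) \<le> s * B\<^sup>2" using s pos by (intro mult_left_mono) auto
    then show ?thesis using pos by (simp add: u_def field_simps power2_eq_square)
  qed
  moreover have "0 < B * s" using pos by simp
  ultimately have tu: "t + u < B * s" using u(1) by linarith
  have id: "8 * s * B ^ 4 - 243 * t * (B * s - t) = 243 * (u - t) * (B * s - t - u) + (8 * s * B ^ 4 - 243 * u * (B * s - u))"
    by algebra
  have "B\<^sup>2 * (8 * s * B ^ 4 - 243 * u * (B * s - u)) = s * (8 * B ^ 6 - 81 * B\<^sup>2 * s\<^sup>2 + 27 * s ^ 3)"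
    using u(2) by algebra
  also have "8 * B ^ 6 - 81 * B\<^sup>2 * s\<^sup>2 + 27 * s ^ 3 = (B\<^sup>2 - 3 * s) * (8 * B ^ 4 + 24 * B\<^sup>2 * s - 9 * s\<^sup>2)" by algebra
  finally have f: "B\<^sup>2 * (8 * s * B ^ 4 - 243 * u * (B * s - u)) = s * ((B\<^sup>2 - 3 * s) * (8 * B ^ 4 + 24 * B\<^sup>2 * s - 9 * s\<^sup>2))" .
  have "9 * s\<^sup>2 \<le> 24 * B\<^sup>2 * s"
  proof -
    have "s * (3 * s) \<le> s * B\<^sup>2" using s pos by (intro mult_left_mono) auto
    moreover have "0 < s * B\<^sup>2" using pos by simp
    moreover have "9 * s\<^sup>2 = 3 * (s * (3 * s))" "24 * B\<^sup>2 * s = 24 * (s * B\<^sup>2)" by (simp_all add: power2_eq_square)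
    ultimately show ?thesis by linarith
  qed
  moreover have "0 < B ^ 4" using pos by simp
  ultimately have g: "8 * B ^ 4 + 24 * B\<^sup>2 * s - 9 * s\<^sup>2 > 0" by linarith
  have nn: "0 \<le> B\<^sup>2 * (8 * s * B ^ 4 - 243 * u * (B * s - u))"
    unfolding f using s g pos by (intro mult_nonneg_nonneg) auto
  then have h: "0 \<le> 8 * s * B ^ 4 - 243 * u * (B * s - u)" using pos by (simp add: zero_le_mult_iff)
  have k: "0 \<le> 243 * (u - t) * (B * s - t - u)" using u tu by (intro mult_nonneg_nonneg) auto
  show "243 * t * (B * s - t) \<le> 8 * s * B ^ 4" using id h k by linarith
  assume "243 * t * (B * s - t) = 8 * s * B ^ 4"
  then have "8 * s * B ^ 4 - 243 * u * (B * s - u) = 0" using id h k by linarith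
  then have "s * ((B\<^sup>2 - 3 * s) * (8 * B ^ 4 + 24 * B\<^sup>2 * s - 9 * s\<^sup>2)) = 0" using f by simp
  then have "B\<^sup>2 - 3 * s = 0" using g pos by simp
  then have "(b1-b2)\<^sup>2 + (b1-b3)\<^sup>2 + (b2-b3)\<^sup>2 = 0" using d by simp
  then show "b1 = b2 \<and> b2 = b3" by (smt (verit) zero_le_power2 power2_eq_iff zero_eq_power2)
qed

text \<open>The two previous bounds are chained through \<open>(b1 + b2) * (b1 + b3) * (b2 + b3) = B * s - t\<close>.\<close>

lemma half_bound:
  fixes a1 a2 a3 b1 b2 b3 :: real
  assumes "a1 \<ge> 0" "a2 \<ge> 0" "a3 \<ge> 0" "b1 \<ge> 0" "b2 \<ge> 0" "b3 \<ge> 0"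
  defines "L \<equiv> b1*b2*b3 * (a1*a2*(b1+b2) + a1*a3*(b1+b3) + a2*a3*(b2+b3))"
  shows "243 * L \<le> 2 * (a1+a2+a3)\<^sup>2 * (b1+b2+b3) ^ 4"
    and "243 * L = 2 * (a1+a2+a3)\<^sup>2 * (b1+b2+b3) ^ 4 \<Longrightarrow> a1+a2+a3 > 0 \<Longrightarrow> b1+b2+b3 > 0 \<Longrightarrow> b1 = b2 \<and> b2 = b3"
proof -
  define A B s t Q where "A = a1+a2+a3" and "B = b1+b2+b3" and "s = b1*b2 + b1*b3 + b2*b3" and "t = b1*b2*b3"
    and "Q = a1*a2*(b1+b2) + a1*a3*(b1+b3) + a2*a3*(b2+b3)"
  have "243 * (t * Q) \<le> 2 * A\<^sup>2 * B ^ 4 \<and> (243 * (t * Q) = 2 * A\<^sup>2 * B ^ 4 \<longrightarrow> A > 0 \<longrightarrow> B > 0 \<longrightarrow> b1 = b2 \<and> b2 = b3)"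
  proof (cases "t = 0")
    case True
    then show ?thesis by auto
  next
    case False
    then have b: "b1 > 0" "b2 > 0" "b3 > 0" using assms by (auto simp: t_def)
    then have pos: "t > 0" "s > 0" by (simp_all add: t_def s_def add_pos_pos)
    have P: "(b1+b2)*(b1+b3)*(b2+b3) = B * s - t" unfolding B_def s_def t_def by algebra
    have 1: "4 * s * Q \<le> A\<^sup>2 * (B * s - t)"
      using quadratic_form_bound[OF b, of a1 a2 a3] unfolding P by (simp add: s_def Q_def A_def)
    have 2: "243 * t * (B * s - t) \<le> 8 * s * B ^ 4" "243 * t * (B * s - t) = 8 * s * B ^ 4 \<Longrightarrow> b1 = b2 \<and> b2 = b3"
      using symmetric_bound[OF b] by (simp_all add: B_def s_def t_def)
    have 3: "243 * t * (4 * s * Q) \<le> 243 * t * (A\<^sup>2 * (B * s - t))" using 1 pos by (intro mult_left_mono) auto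
    have 4: "A\<^sup>2 * (243 * t * (B * s - t)) \<le> A\<^sup>2 * (8 * s * B ^ 4)" using 2(1) by (intro mult_left_mono) auto
    have e: "243 * t * (A\<^sup>2 * (B * s - t)) = A\<^sup>2 * (243 * t * (B * s - t))" "4 * s * (243 * (t * Q)) = 243 * t * (4 * s * Q)"
      "A\<^sup>2 * (8 * s * B ^ 4) = 4 * s * (2 * A\<^sup>2 * B ^ 4)" by simp_all
    have 5: "4 * s * (243 * (t * Q)) \<le> 4 * s * (2 * A\<^sup>2 * B ^ 4)" using 3 4 e by linarith
    then have "243 * (t * Q) \<le> 2 * A\<^sup>2 * B ^ 4" using pos by (simp add: mult_ac)
    moreover have "b1 = b2 \<and> b2 = b3" if "243 * (t * Q) = 2 * A\<^sup>2 * B ^ 4" "A > 0"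
    proof -
      have "4 * s * (243 * (t * Q)) = 4 * s * (2 * A\<^sup>2 * B ^ 4)" using that by simp
      then have "A\<^sup>2 * (243 * t * (B * s - t)) = A\<^sup>2 * (8 * s * B ^ 4)" using 3 4 e by linarith
      then show ?thesis using that 2(2) by simp
    qed
    ultimately show ?thesis by simp
  qed
  then show "243 * L \<le> 2 * (a1+a2+a3)\<^sup>2 * (b1+b2+b3) ^ 4"
    "243 * L = 2 * (a1+a2+a3)\<^sup>2 * (b1+b2+b3) ^ 4 \<Longrightarrow> a1+a2+a3 > 0 \<Longrightarrow> b1+b2+b3 > 0 \<Longrightarrow> b1 = b2 \<and> b2 = b3"
    unfolding L_def A_def B_def t_def Q_def by blast+
qed

text \<open>The number of copies in a blowup of the hexagon with parts of sizes \<open>x 0\<close> to \<open>x 5\<close>, see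
\<open>copies_blow\<close>. The twelve monomials are grouped by the class of the bipartite hexagon from which
all three parts occur.\<close>

definition hexpoly :: "(nat \<Rightarrow> real) \<Rightarrow> real" where
  "hexpoly x = x 1 * x 3 * x 5 * (x 0 * x 2 * (x 3 + x 5) + x 0 * x 4 * (x 3 + x 1) + x 2 * x 4 * (x 5 + x 1))
     + x 0 * x 2 * x 4 * (x 3 * x 5 * (x 0 + x 2) + x 3 * x 1 * (x 0 + x 4) + x 5 * x 1 * (x 2 + x 4))"

lemma sum_lessThan_6: "(\<Sum>i<6. f i) = f 0 + f 1 + f 2 + f 3 + f 4 + f (5::nat)" for f :: "nat \<Rightarrow> real"
  by (simp add: eval_nat_numeral)

text \<open>In each of the two halves, a part of one class is paired with the opposite part of the other class,
so \<open>half_bound\<close> applies with \<open>a\<close> from one class and \<open>b\<close> from the other. With the total sizes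
\<open>A\<close> and \<open>B\<close> of the classes and \<open>q = A * B \<le> 1/4\<close>, the bounds add up to
\<open>2 * q\<^sup>2 * (1 - 2 * q) / 243\<close>.\<close>

lemma hexpoly_max:
  assumes "\<And>i. i < 6 \<Longrightarrow> 0 \<le> x i" "(\<Sum>i<6. x i) = 1"
  shows "hexpoly x \<le> 1 / 3888" "hexpoly x = 1 / 3888 \<Longrightarrow> i < 6 \<Longrightarrow> x i = 1 / 6"
proof -
  have nn: "x 0 \<ge> 0" "x 1 \<ge> 0" "x 2 \<ge> 0" "x 3 \<ge> 0" "x 4 \<ge> 0" "x 5 \<ge> 0" using assms(1) by simp_all
  define A B q where "A = x 0 + x 2 + x 4" and "B = x 3 + x 5 + x 1" and "q = A * B"
  have AB: "A + B = 1" "A \<ge> 0" "B \<ge> 0" using assms nn by (simp_all add: A_def B_def sum_lessThan_6)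
  define L1 L2 where "L1 = x 3 * x 5 * x 1 * (x 0 * x 2 * (x 3 + x 5) + x 0 * x 4 * (x 3 + x 1) + x 2 * x 4 * (x 5 + x 1))"
    and "L2 = x 0 * x 2 * x 4 * (x 3 * x 5 * (x 0 + x 2) + x 3 * x 1 * (x 0 + x 4) + x 5 * x 1 * (x 2 + x 4))"
  have h: "hexpoly x = L1 + L2" by (simp add: hexpoly_def L1_def L2_def mult_ac)
  have 1: "243 * L1 \<le> 2 * A\<^sup>2 * B ^ 4" "243 * L1 = 2 * A\<^sup>2 * B ^ 4 \<Longrightarrow> A > 0 \<Longrightarrow> B > 0 \<Longrightarrow> x 3 = x 5 \<and> x 5 = x 1"
    using half_bound[of "x 0" "x 2" "x 4" "x 3" "x 5" "x 1"] nn unfolding A_def B_def L1_def by auto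
  have 2: "243 * L2 \<le> 2 * B\<^sup>2 * A ^ 4" "243 * L2 = 2 * B\<^sup>2 * A ^ 4 \<Longrightarrow> B > 0 \<Longrightarrow> A > 0 \<Longrightarrow> x 0 = x 2 \<and> x 2 = x 4"
    using half_bound[of "x 3" "x 5" "x 1" "x 0" "x 2" "x 4"] nn unfolding A_def B_def L2_def by auto
  have "2 * A\<^sup>2 * B ^ 4 + 2 * B\<^sup>2 * A ^ 4 = 2 * q\<^sup>2 * ((A + B)\<^sup>2 - 2 * q)" unfolding q_def by algebra
  also have "\<dots> = 2 * q\<^sup>2 * (1 - 2 * q)" by (simp add: AB)
  finally have s: "2 * A\<^sup>2 * B ^ 4 + 2 * B\<^sup>2 * A ^ 4 = 2 * q\<^sup>2 * (1 - 2 * q)" .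
  have "1 / 4 - q = (A - B)\<^sup>2 / 4 + (1 - (A + B)\<^sup>2) / 4" unfolding q_def by (simp add: power2_eq_square field_simps)
  then have q4: "1 / 4 - q = (A - B)\<^sup>2 / 4" by (simp add: AB)
  have q: "q \<le> 1 / 4" using q4 zero_le_power2[of "A - B"] by linarith
  have q0: "0 \<le> q" using AB by (simp add: q_def)
  have r: "1 / 16 - 2 * q\<^sup>2 * (1 - 2 * q) = (1 / 4 - q) * (1 / 4 + q * (1 - 4 * q))"
    by (simp add: power2_eq_square field_simps)
  have r0: "1 / 4 + q * (1 - 4 * q) > 0" using q q0 by (intro add_pos_nonneg mult_nonneg_nonneg) auto
  have le: "2 * q\<^sup>2 * (1 - 2 * q) \<le> 1 / 16"
    using r mult_nonneg_nonneg[of "1 / 4 - q" "1 / 4 + q * (1 - 4 * q)"] r0 q by linarith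
  show "hexpoly x \<le> 1 / 3888" using 1(1) 2(1) s le by (simp add: h)
  assume eq: "hexpoly x = 1 / 3888" and i: "i < 6"
  then have eqs: "243 * L1 = 2 * A\<^sup>2 * B ^ 4" "243 * L2 = 2 * B\<^sup>2 * A ^ 4" "2 * q\<^sup>2 * (1 - 2 * q) = 1 / 16"
    using 1(1) 2(1) s le by (simp_all add: h)
  have "(1 / 4 - q) * (1 / 4 + q * (1 - 4 * q)) = 0" using eqs(3) r by linarith
  then have "1 / 4 - q = 0" using r0 by simp
  then have "A = B" using q4 by simp
  then have "A = 1 / 2" "B = 1 / 2" using AB by simp_all
  then have "x 3 = x 5 \<and> x 5 = x 1" "x 0 = x 2 \<and> x 2 = x 4" using 1(2) 2(2) eqs by simp_all
  moreover have "i = 0 \<or> i = 1 \<or> i = 2 \<or> i = 3 \<or> i = 4 \<or> i = 5" using i by auto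
  ultimately show "x i = 1 / 6" using \<open>A = 1 / 2\<close> \<open>B = 1 / 2\<close> by (auto simp: A_def B_def)
qed

text \<open>Bolzano-Weierstrass, one coordinate after the other.\<close>

lemma convergent_subsequence:
  fixes x :: "nat \<Rightarrow> nat \<Rightarrow> real"
  assumes "\<And>k i. i < m \<Longrightarrow> \<bar>x k i\<bar> \<le> 1"
  shows "\<exists>r :: nat \<Rightarrow> nat. strict_mono r \<and> (\<forall>i<m. convergent (\<lambda>k. x (r k) i))"
  using assms
proof (induction m)
  case 0
  show ?case by (intro exI[of _ id]) (simp add: strict_mono_def)
next
  case (Suc m)
  then obtain r :: "nat \<Rightarrow> nat" where r: "strict_mono r" "\<And>i. i < m \<Longrightarrow> convergent (\<lambda>k. x (r k) i)" by fastforce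
  obtain s :: "nat \<Rightarrow> nat" where s: "strict_mono s" "monoseq (\<lambda>k. x (r (s k)) m)"
    using seq_monosub[of "\<lambda>k. x (r k) m"] by blast
  have "Bseq (\<lambda>k. x (r (s k)) m)" using Suc.prems by (intro BseqI'[of _ 1]) simp
  then have "convergent (\<lambda>k. x (r (s k)) m)" using s(2) by (rule Bseq_monoseq_convergent)
  moreover have "convergent (\<lambda>k. x (r (s k)) i)" if "i < m" for i
    using convergent_subseq_convergent[OF r(2)[OF that] s(1)] by (simp add: o_def)
  ultimately show ?case using strict_mono_o[OF r(1) s(1)] by (intro exI[of _ "r \<circ> s"]) (auto simp: less_Suc_eq o_def)
qed

text \<open>Otherwise some sequence of points approaches the maximum but stays away from the maximiser. The limit of
a convergent subsequence is a second maximiser, which \<open>hexpoly_max\<close> excludes.\<close>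

lemma hexpoly_close:
  assumes "\<eta> > 0"
  shows "\<exists>\<epsilon>>0. \<forall>x. (\<forall>i<6. 0 \<le> x i) \<longrightarrow> (\<Sum>i<6. x i) = 1 \<longrightarrow> hexpoly x \<ge> 1 / 3888 - \<epsilon> \<longrightarrow> (\<forall>i<6. \<bar>x i - 1 / 6\<bar> \<le> \<eta>)"
proof (rule ccontr)
  assume neg: "\<not> ?thesis"
  have "\<exists>x. (\<forall>i<6. 0 \<le> x i) \<and> (\<Sum>i<6. x i) = 1 \<and> hexpoly x \<ge> 1 / 3888 - inverse (real (Suc k)) \<and> \<not> (\<forall>i<6. \<bar>x i - 1 / 6\<bar> \<le> \<eta>)" for k
  proof -
    have "inverse (real (Suc k)) > 0" by simp
    then show ?thesis using neg by blast
  qed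
  then obtain x where x: "\<And>k i. i < 6 \<Longrightarrow> 0 \<le> x k i" "\<And>k. (\<Sum>i<6. x k i) = 1"
    "\<And>k. hexpoly (x k) \<ge> 1 / 3888 - inverse (real (Suc k))" "\<And>k. \<not> (\<forall>i<6. \<bar>x k i - 1 / 6\<bar> \<le> \<eta>)" by metis
  have "\<bar>x k i\<bar> \<le> 1" if "i < 6" for k i
    using member_le_sum[of i "{..<6}" "x k"] x(1,2) that by simp
  then obtain r :: "nat \<Rightarrow> nat" where r: "strict_mono r" "\<And>i. i < 6 \<Longrightarrow> convergent (\<lambda>k. x (r k) i)"
    using convergent_subsequence[of 6 x] by blast
  define y where "y i = lim (\<lambda>k. x (r k) i)" for i
  have y: "(\<lambda>k. x (r k) i) \<longlonglongrightarrow> y i" if "i < 6" for i using r(2)[OF that] by (simp add: y_def convergent_LIMSEQ_iff)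
  have "0 \<le> y i" if "i < 6" for i using y[OF that] x(1)[OF that] by (intro LIMSEQ_le_const) auto
  moreover have "(\<lambda>k. \<Sum>i<6. x (r k) i) \<longlonglongrightarrow> (\<Sum>i<6. y i)" using y by (intro tendsto_sum) auto
  then have "(\<Sum>i<6. y i) = 1" by (simp add: x(2) LIMSEQ_const_iff)
  moreover have "1 / 3888 \<le> hexpoly y"
  proof (rule LIMSEQ_le)
    show "(\<lambda>k. 1 / 3888 - inverse (real (Suc k))) \<longlonglongrightarrow> 1 / 3888"
      using tendsto_diff[OF tendsto_const LIMSEQ_inverse_real_of_nat, of "1 / 3888"] by simp
    show "(\<lambda>k. hexpoly (x (r k))) \<longlonglongrightarrow> hexpoly y" unfolding hexpoly_def by (intro tendsto_intros y) simp_all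
    have "1 / 3888 - inverse (real (Suc k)) \<le> hexpoly (x (r k))" for k
    proof -
      have "inverse (real (Suc (r k))) \<le> inverse (real (Suc k))" using seq_suble[OF r(1), of k] by simp
      then show ?thesis using x(3)[of "r k"] by linarith
    qed
    then show "\<exists>N. \<forall>k\<ge>N. 1 / 3888 - inverse (real (Suc k)) \<le> hexpoly (x (r k))" by blast
  qed
  ultimately have sixth: "y i = 1 / 6" if "i < 6" for i using hexpoly_max[of y] that by (meson order_antisym)
  have "\<forall>\<^sub>F k in sequentially. \<bar>x (r k) i - 1 / 6\<bar> \<le> \<eta>" if "i < 6" for i
    using tendstoD[OF y[OF that] assms] unfolding sixth[OF that] dist_real_def by (rule eventually_mono) simp
  then have "\<forall>\<^sub>F k in sequentially. \<forall>i\<in>{..<6}. \<bar>x (r k) i - 1 / 6\<bar> \<le> \<eta>" by (simp add: eventually_ball_finite)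
  then obtain k where "\<forall>i\<in>{..<6}. \<bar>x (r k) i - 1 / 6\<bar> \<le> \<eta>" by (auto simp: eventually_sequentially)
  then show False using x(4)[of "r k"] by simp
qed

section \<open>Copies in blowups and in altered graphs\<close>

lemma hex_copies_eq: "hex_copies = [[1,2,3,4,0,0],[2,3,4,5,1,1],[3,4,5,0,2,2],[4,5,0,1,3,3],[5,0,1,2,4,4],[0,1,2,3,5,5],
  [5,4,3,2,0,0],[0,5,4,3,1,1],[1,0,5,4,2,2],[2,1,0,5,3,3],[3,2,1,0,4,4],[4,3,2,1,5,5]]"
  unfolding hex_copies_def by code_simp

lemma copies_hex_set: "{xs \<in> tuples {..<6} 6. copy (pattern hex xs)} = set hex_copies"
proof -
  have "copies hex {..<6} \<le> 12" using copies_bound[OF finite_lessThan graphlike_hex, of 6] by simp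
  then show ?thesis
    using card_seteq[OF _ hex_copies(1)] hex_copies(3) finite_tuples[OF finite_lessThan, of 6 6] unfolding copies_def by simp
qed

lemma copy_cong: "(\<And>i j. i < j \<Longrightarrow> j < 6 \<Longrightarrow> p i j = q i j) \<Longrightarrow> copy p = copy q"
  unfolding copy_def bits4 by simp

text \<open>Tuples are grouped by their colours, which form a copy in the hexagon.\<close>

lemma copies_blow:
  assumes "finite V" "\<And>x. x \<in> V \<Longrightarrow> c x < 6"
  shows "real (copies (blow c) V) = hexpoly (\<lambda>i. real (part_size V c i))"
proof -
  define N where "N = part_size V c"
  have "int (copies (blow c) V) = (\<Sum>xs\<in>tuples V 6. of_bool (copy (pattern hex (map c xs))))"
    unfolding copies_def card_tuples_filter[OF assms(1)]
    by (intro sum.cong refl arg_cong[where f = of_bool] copy_cong pattern_blow) (auto simp: tuples_def)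
  also have "\<dots> = (\<Sum>zs\<in>tuples {..<6} 6. int (prod_list (map N zs)) * of_bool (copy (pattern hex zs)))"
    unfolding N_def by (rule sum_tuples_by_colour[OF assms])
  also have "\<dots> = (\<Sum>zs\<in>{xs \<in> tuples {..<6} 6. copy (pattern hex xs)}. int (prod_list (map N zs)))"
    by (intro sum.mono_neutral_cong_right) (auto simp: finite_tuples)
  also have "\<dots> = (\<Sum>zs\<leftarrow>hex_copies. int (prod_list (map N zs)))"
    unfolding copies_hex_set by (rule sum.distinct_set_conv_list[OF hex_copies(2)])
  finally have "real_of_int (int (copies (blow c) V)) = real_of_int (\<Sum>zs\<leftarrow>hex_copies. int (prod_list (map N zs)))" by simp
  also have "\<dots> = hexpoly (\<lambda>i. real (N i))"
    unfolding hex_copies_eq hexpoly_def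
    by (simp only: list.map sum_list.Cons sum_list.Nil prod_list.Cons prod_list.Nil of_int_add of_int_mult of_int_of_nat_eq of_nat_mult of_nat_1 mult_1_right of_int_0) algebra
  finally show ?thesis by (simp add: N_def)
qed

lemma hexpoly_scale: "hexpoly (\<lambda>i. k * x i) = k ^ 6 * hexpoly x"
  unfolding hexpoly_def by algebra

lemma sum_part_size:
  assumes "finite V" "\<And>x. x \<in> V \<Longrightarrow> c x < 6"
  shows "(\<Sum>i<6. part_size V c i) = card V"
  using sum_by_colour[where V = V and c = c and f = "\<lambda>_. 1", OF assms] by (simp flip: of_nat_sum)

text \<open>Only tuples that contain a mismatched pair can be counted on one side and not on the other.\<close>

lemma altered_bound:
  fixes E :: "'a \<Rightarrow> 'a \<Rightarrow> bool"
  assumes "finite V" and P: "\<And>p q. (\<And>i j. i < j \<Longrightarrow> j < k \<Longrightarrow> p i j = q i j) \<Longrightarrow> P p = P q"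
  shows "\<bar>real (card {xs \<in> tuples V k. P (pattern E xs)}) - real (card {xs \<in> tuples V k. P (pattern (blow c) xs)})\<bar> \<le>
    real (k\<^sup>2 * mismatches E V c * card V ^ (k - 2))"
proof -
  define S T where "S = {xs \<in> tuples V k. P (pattern E xs)}" and "T = {xs \<in> tuples V k. P (pattern (blow c) xs)}"
  define U where "U = {zs \<in> tuples V k. \<exists>i j. i < j \<and> j < k \<and> E (zs ! i) (zs ! j) \<noteq> hex (c (zs ! i)) (c (zs ! j))}"
  have fin: "finite S" "finite T" "finite U" using finite_tuples[OF assms(1)] by (auto simp: S_def T_def U_def)
  have U: "card U \<le> k\<^sup>2 * mismatches E V c * card V ^ (k - 2)"
    unfolding U_def mismatches_def by (rule card_tuples_altered[OF assms(1)])
  have same: "P (pattern E xs) = P (pattern (blow c) xs)" if "xs \<in> tuples V k" "xs \<notin> U" for xs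
    using that by (intro P) (auto simp: U_def pattern_def blow_def)
  have "S \<subseteq> T \<union> U" "T \<subseteq> S \<union> U" using same by (auto simp: S_def T_def)
  then have "card S \<le> card T + card U" "card T \<le> card S + card U"
    using fin by (meson card_Un_le card_mono finite_UnI order_trans)+
  then show ?thesis using U unfolding S_def T_def by (simp del: of_nat_mult of_nat_power)
qed

lemma copies_altered:
  assumes "finite V"
  shows "\<bar>real (copies E V) - real (copies (blow c) V)\<bar> \<le> 36 * real (mismatches E V c) * real (card V) ^ 4"
  using altered_bound[of V 6 copy, OF assms copy_cong, of E c] unfolding copies_def by simp

definition path5 :: "(nat \<Rightarrow> nat \<Rightarrow> bool) \<Rightarrow> bool" where
  "path5 p \<longleftrightarrow> bits 4 p = root_path \<and> map (\<lambda>i. p i 4) [0,1,2,3] = [True, False, False, False]"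

definition paths :: "('a \<Rightarrow> 'a \<Rightarrow> bool) \<Rightarrow> 'a set \<Rightarrow> nat" where
  "paths E V = card {xs \<in> tuples V 5. path5 (pattern E xs)}"

definition embeddings :: "('a \<Rightarrow> 'a \<Rightarrow> bool) \<Rightarrow> 'a set \<Rightarrow> 'a list set" where
  "embeddings E V = {xs \<in> tuples V 6. copy (pattern E xs) \<and> xs ! 4 \<noteq> xs ! 5}"

lemma paths_altered:
  assumes "finite V"
  shows "\<bar>real (paths E V) - real (paths (blow c) V)\<bar> \<le> 25 * real (mismatches E V c) * real (card V) ^ 3"
proof -
  have *: "path5 p = path5 q" if "\<And>i j. i < j \<Longrightarrow> j < 5 \<Longrightarrow> p i j = q i j" for p q
    unfolding path5_def bits4 using that by simp
  show ?thesis using altered_bound[of V 5 path5, OF assms *, of E c] unfolding paths_def by simp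
qed

lemma paths_le: "finite V \<Longrightarrow> paths E V \<le> card V ^ 5"
  unfolding paths_def card_tuples[symmetric] by (intro card_mono finite_tuples) auto

text \<open>Copies with distinct last vertices are embeddings; the others are induced paths on five vertices with
the end vertex listed twice.\<close>

lemma copies_split:
  assumes "finite V" "graphlike E"
  shows "copies E V = card (embeddings E V) + paths E V"
proof -
  define D where "D = {xs \<in> tuples V 6. copy (pattern E xs) \<and> xs ! 4 = xs ! 5}"
  have "{xs \<in> tuples V 6. copy (pattern E xs)} = embeddings E V \<union> D" by (auto simp: embeddings_def D_def)
  moreover have "embeddings E V \<inter> D = {}" by (auto simp: embeddings_def D_def)
  moreover have "finite (embeddings E V)" "finite D" using finite_tuples[OF assms(1)] by (auto simp: embeddings_def D_def)
  ultimately have "copies E V = card (embeddings E V) + card D" unfolding copies_def by (simp add: card_Un_disjoint)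
  moreover have "bij_betw (\<lambda>xs. xs @ [xs ! 4]) {xs \<in> tuples V 5. path5 (pattern E xs)} D"
  proof (rule bij_betwI[where g = "take 5"])
    have *: "copy (pattern E (xs @ [xs ! 4])) = path5 (pattern E xs)" if xs: "xs \<in> tuples V 5" for xs
    proof -
      obtain a b c d e where "xs = [a,b,c,d,e]" using xs by (auto simp: tuples_def length_Suc_conv eval_nat_numeral)
      then show ?thesis using assms(2) by (simp add: copy_def copy4_def path5_def bits4 pattern_def graphlike_def)
    qed
    show "(\<lambda>xs. xs @ [xs ! 4]) \<in> {xs \<in> tuples V 5. path5 (pattern E xs)} \<rightarrow> D"
    proof (intro funcsetI)
      fix xs assume "xs \<in> {xs \<in> tuples V 5. path5 (pattern E xs)}"
      moreover from this have "xs ! 4 \<in> V" using nth_mem[of 4 xs] by (auto simp: tuples_def)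
      ultimately show "xs @ [xs ! 4] \<in> D" using * by (auto simp: D_def tuples_def nth_append)
    qed
    have **: "take 5 xs @ [take 5 xs ! 4] = xs" if d: "xs \<in> D" for xs
    proof -
      obtain a b c d e f where "xs = [a,b,c,d,e,f]" using d by (auto simp: D_def tuples_def length_Suc_conv eval_nat_numeral)
      then show ?thesis using d by (simp add: D_def)
    qed
    show "take 5 \<in> D \<rightarrow> {xs \<in> tuples V 5. path5 (pattern E xs)}"
    proof (intro funcsetI)
      fix xs assume xs: "xs \<in> D"
      then have t: "take 5 xs \<in> tuples V 5" by (auto simp: D_def tuples_def dest: in_set_takeD)
      then have "path5 (pattern E (take 5 xs))" using *[OF t] **[OF xs] xs by (simp add: D_def)
      then show "take 5 xs \<in> {xs \<in> tuples V 5. path5 (pattern E xs)}" using t by simp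
    qed
    show "take 5 (xs @ [xs ! 4]) = xs" if "xs \<in> {xs \<in> tuples V 5. path5 (pattern E xs)}" for xs
      using that by (simp add: tuples_def)
    show "take 5 xs @ [take 5 xs ! 4] = xs" if "xs \<in> D" for xs by (rule **[OF that])
  qed
  ultimately show ?thesis unfolding paths_def by (simp add: bij_betw_same_card)
qed

section \<open>Embeddings and induced subgraphs\<close>

lemma less6: "i < (6::nat) \<longleftrightarrow> i = 0 \<or> i = 1 \<or> i = 2 \<or> i = 3 \<or> i = 4 \<or> i = 5" by auto

lemma all_less6: "(\<forall>i<(6::nat). P i) \<longleftrightarrow> P 0 \<and> P 1 \<and> P 2 \<and> P 3 \<and> P 4 \<and> P 5"
  by (simp only: less6 imp_disjL all_conj_distrib simp_thms)

lemma lessThan6: "{..<6::nat} = {0, 1, 2, 3, 4, 5}"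
  unfolding set_eq_iff lessThan_iff less6 insert_iff empty_iff by simp

definition adj :: "'a graph \<Rightarrow> 'a \<Rightarrow> 'a \<Rightarrow> bool" where
  "adj G x y \<longleftrightarrow> {x, y} \<in> edges G"

lemma graphlike_adj: "simple_graph G \<Longrightarrow> graphlike (adj G)"
  by (auto simp: graphlike_def adj_def simple_graph_def insert_commute)

text \<open>\<open>F24\<close> in the order in which \<open>copy\<close> lists its vertices.\<close>

definition spider :: "nat \<Rightarrow> nat \<Rightarrow> bool" where
  "spider i j \<longleftrightarrow> (i, j) \<in> {(0, 1), (1, 0), (1, 2), (2, 1), (2, 3), (3, 2), (0, 4), (4, 0), (0, 5), (5, 0)}"

text \<open>The vertex of \<open>F24\<close> at each position of that order.\<close>

definition F24_label :: "nat \<Rightarrow> nat" where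
  "F24_label i = [0, 2, 1, 5, 3, 4] ! i"

lemma copy_iff_spider:
  assumes "graphlike p"
  shows "copy p \<longleftrightarrow> (\<forall>i<6. \<forall>j<6. p i j = spider i j)"
proof -
  have s: "p i j = p j i" "\<not> p i i" for i j using assms unfolding graphlike_def by blast+
  have "copy p \<longleftrightarrow> p 0 1 \<and> \<not> p 0 2 \<and> p 1 2 \<and> \<not> p 0 3 \<and> \<not> p 1 3 \<and> p 2 3 \<and> p 0 4 \<and> \<not> p 1 4 \<and> \<not> p 2 4 \<and> \<not> p 3 4
    \<and> p 0 5 \<and> \<not> p 1 5 \<and> \<not> p 2 5 \<and> \<not> p 3 5 \<and> \<not> p 4 5"
    unfolding copy_def copy4_def bits4 root_path_def by simp
  also have "\<dots> \<longleftrightarrow> (\<forall>i<6. \<forall>j<6. p i j = spider i j)"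
    unfolding all_less6
    by (simp del: One_nat_def add: spider_def s(2) s(1)[of 1 0] s(1)[of 2 0] s(1)[of 3 0] s(1)[of 4 0] s(1)[of 5 0] s(1)[of 2 1] s(1)[of 3 1]
      s(1)[of 4 1] s(1)[of 5 1] s(1)[of 3 2] s(1)[of 4 2] s(1)[of 5 2] s(1)[of 4 3] s(1)[of 5 3] s(1)[of 5 4] conj_ac)
  finally show ?thesis .
qed

lemma F24_spider: "i < 6 \<Longrightarrow> j < 6 \<Longrightarrow> {F24_label i, F24_label j} \<in> edges F24 \<longleftrightarrow> spider i j"
  unfolding less6 by (elim disjE) (simp_all add: F24_label_def F24_def spider_def doubleton_eq_iff)

lemma F24_label_bij: "bij_betw F24_label {..<6} {..<6}"
proof -
  have "F24_label ` {..<6} = {..<6}"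
    unfolding lessThan6 image_insert image_empty by (simp add: F24_label_def insert_commute)
  then show ?thesis by (simp add: bij_betw_def eq_card_imp_inj_on)
qed

text \<open>The path is chosen first and the two pendant vertices last; the nested conditions prune the search for
tuples of positions that preserve adjacency.\<close>

lemma spider_check: "list_all (\<lambda>b. list_all (\<lambda>c. if spider b c then list_all (\<lambda>d. if spider c d \<and> \<not> spider b d then
    list_all (\<lambda>e. if spider d e \<and> \<not> spider b e \<and> \<not> spider c e then list_all (\<lambda>x. if spider b x \<and> \<not> spider c x \<and> \<not> spider d x \<and> \<not> spider e x then
    list_all (\<lambda>y. if spider b y \<and> \<not> spider c y \<and> \<not> spider d y \<and> \<not> spider e y \<and> x \<noteq> y then
       [b, c, d, e, x, y] = [0,1,2,3,4,5] \<or> [b, c, d, e, x, y] = [0,1,2,3,5,4] else True) [0..<6] else True) [0..<6]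
     else True) [0..<6] else True) [0..<6] else True) [0..<6]) [0..<6]"
  by code_simp

text \<open>The only nontrivial automorphism of \<open>F24\<close> exchanges the two pendant vertices.\<close>

lemma spider_automorphisms:
  "{s \<in> tuples {..<6} 6. (\<forall>i<6. \<forall>j<6. spider (s ! i) (s ! j) = spider i j) \<and> s ! 4 \<noteq> s ! 5} = {[0,1,2,3,4,5], [0,1,2,3,5,4]}"
proof (intro equalityI subsetI)
  fix s assume s: "s \<in> {s \<in> tuples {..<6} 6. (\<forall>i<6. \<forall>j<6. spider (s ! i) (s ! j) = spider i j) \<and> s ! 4 \<noteq> s ! 5}"
  then obtain b c d e x y where eq: "s = [b,c,d,e,x,y]" by (auto simp: tuples_def length_Suc_conv eval_nat_numeral)
  have mem: "b \<in> {0..<6}" "c \<in> {0..<6}" "d \<in> {0..<6}" "e \<in> {0..<6}" "x \<in> {0..<6}" "y \<in> {0..<6}"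
    using s by (auto simp: eq tuples_def)
  have h: "\<forall>i<6. \<forall>j<6. spider (s ! i) (s ! j) = spider i j" "x \<noteq> y" using s by (auto simp: eq)
  have p: "spider b c" "spider c d \<and> \<not> spider b d" "spider d e \<and> \<not> spider b e \<and> \<not> spider c e"
    "spider b x \<and> \<not> spider c x \<and> \<not> spider d x \<and> \<not> spider e x"
    "spider b y \<and> \<not> spider c y \<and> \<not> spider d y \<and> \<not> spider e y \<and> x \<noteq> y"
    using h(1)[unfolded all_less6] h(2) by (simp_all add: eq) (simp_all add: spider_def)
  note 1 = bspec[OF bspec[OF spider_check[unfolded list_all_iff set_upt] mem(1)] mem(2), unfolded if_P[OF p(1)]]
  note 2 = bspec[OF 1 mem(3), unfolded if_P[OF p(2)]]
  note 3 = bspec[OF 2 mem(4), unfolded if_P[OF p(3)]]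
  note 4 = bspec[OF 3 mem(5), unfolded if_P[OF p(4)]]
  note 5 = bspec[OF 4 mem(6), unfolded if_P[OF p(5)]]
  then show "s \<in> {[0,1,2,3,4,5], [0,1,2,3,5,4]}" unfolding eq by blast
next
  fix s :: "nat list" assume "s \<in> {[0,1,2,3,4,5], [0,1,2,3,5,4]}"
  then consider "s = [0,1,2,3,4,5]" | "s = [0,1,2,3,5,4]" by auto
  then show "s \<in> {s \<in> tuples {..<6} 6. (\<forall>i<6. \<forall>j<6. spider (s ! i) (s ! j) = spider i j) \<and> s ! 4 \<noteq> s ! 5}"
    by cases (simp_all add: tuples_def all_less6 spider_def)
qed

text \<open>Distinct vertices of the tree have different neighbourhoods except for the two pendant ones, so the
adjacencies force distinct entries.\<close>

lemma spider_distinct: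
  assumes "graphlike E" "xs \<in> tuples V 6" "\<forall>i<6. \<forall>j<6. pattern E xs i j = spider i j" "xs ! 4 \<noteq> xs ! 5"
  shows "distinct xs"
proof -
  obtain b c d e x y where eq: "xs = [b,c,d,e,x,y]" using assms(2) by (auto simp: tuples_def length_Suc_conv eval_nat_numeral)
  have "E b c" "E c d" "E d e" "E b x" "E b y" "\<not> E b d" "\<not> E b e" "\<not> E c e" "\<not> E c x" "\<not> E d x" "\<not> E e x" "\<not> E c y" "\<not> E d y" "\<not> E e y"
    using assms(3)[unfolded all_less6] by (simp_all add: eq pattern_def) (simp_all add: spider_def)
  moreover have "\<not> E u u" "E u v = E v u" for u v using assms(1) by (auto simp: graphlike_def)
  ultimately show ?thesis using assms(4) unfolding eq by auto
qed

lemma in_embeddings: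
  assumes "graphlike E"
  shows "xs \<in> embeddings E V \<longleftrightarrow> xs \<in> tuples V 6 \<and> (\<forall>i<6. \<forall>j<6. E (xs ! i) (xs ! j) = spider i j) \<and> xs ! 4 \<noteq> xs ! 5"
proof -
  have "graphlike (pattern E xs)" using assms by (simp add: graphlike_def pattern_def)
  then show ?thesis by (simp add: embeddings_def copy_iff_spider pattern_def)
qed

lemma embedding_distinct: "graphlike E \<Longrightarrow> xs \<in> embeddings E V \<Longrightarrow> distinct xs"
  using spider_distinct[of E xs V] by (simp add: in_embeddings pattern_def)

definition F24_sets :: "'a graph \<Rightarrow> 'a set set" where
  "F24_sets G = {S. S \<subseteq> verts G \<and> card S = card (verts F24) \<and> isomorphic (induced G S) F24}"

lemma embedding_bij:
  assumes "graphlike E" "xs \<in> embeddings E V"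
  shows "bij_betw ((!) xs) {..<6} (set xs)"
  using bij_betw_nth[OF embedding_distinct[OF assms], of "{..<6}" "set xs"] assms(2)
  by (simp add: embeddings_def tuples_def)

lemma embedding_set:
  assumes "graphlike (adj G)" "xs \<in> embeddings (adj G) (verts G)"
  shows "set xs \<in> F24_sets G"
proof -
  define h where "h = inv_into {..<6} ((!) xs)"
  have b: "bij_betw ((!) xs) {..<6} (set xs)" by (rule embedding_bij[OF assms])
  have h: "bij_betw h (set xs) {..<6}" unfolding h_def by (rule bij_betw_inv_into[OF b])
  have xs: "set xs \<subseteq> verts G" "length xs = 6" and sp: "\<And>i j. i < 6 \<Longrightarrow> j < 6 \<Longrightarrow> adj G (xs ! i) (xs ! j) = spider i j"
    using assms(2) unfolding in_embeddings[OF assms(1)] by (auto simp: tuples_def)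
  have nth: "xs ! h x = x" "h x < 6" if "x \<in> set xs" for x
    using that b h f_inv_into_f[of x "(!) xs" "{..<6}"] by (auto simp: h_def bij_betw_def)
  have "isomorphism (F24_label \<circ> h) (induced G (set xs)) F24"
    unfolding isomorphism_def
  proof (intro conjI ballI)
    show "bij_betw (F24_label \<circ> h) (verts (induced G (set xs))) (verts F24)"
      using bij_betw_trans[OF h F24_label_bij] by (simp add: induced_def F24_def)
    fix x y assume "x \<in> verts (induced G (set xs))" "y \<in> verts (induced G (set xs))"
    then have x: "x \<in> set xs" and y: "y \<in> set xs" by (auto simp: induced_def)
    have "{x, y} \<in> edges (induced G (set xs)) \<longleftrightarrow> adj G (xs ! h x) (xs ! h y)" using x y by (simp add: induced_def adj_def nth)
    also have "\<dots> \<longleftrightarrow> spider (h x) (h y)" using x y nth by (intro sp) auto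
    also have "\<dots> \<longleftrightarrow> {F24_label (h x), F24_label (h y)} \<in> edges F24" using x y nth by (intro F24_spider[symmetric]) auto
    finally show "{x, y} \<in> edges (induced G (set xs)) \<longleftrightarrow> {(F24_label \<circ> h) x, (F24_label \<circ> h) y} \<in> edges F24" by simp
  qed
  then show ?thesis using xs distinct_card[OF embedding_distinct[OF assms]]
    by (auto simp: F24_sets_def isomorphic_def F24_def)
qed

lemma embedding_exists:
  assumes "graphlike (adj G)" "S \<in> F24_sets G"
  shows "\<exists>xs\<in>embeddings (adj G) (verts G). set xs = S"
proof -
  obtain f where f: "isomorphism f (induced G S) F24" and S: "S \<subseteq> verts G"
    using assms(2) by (auto simp: F24_sets_def isomorphic_def)
  define g where "g = inv_into S f \<circ> F24_label"
  define xs where "xs = map g [0..<6]"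
  have b: "bij_betw f S {..<6}" and e: "\<And>x y. x \<in> S \<Longrightarrow> y \<in> S \<Longrightarrow> {x, y} \<in> edges G \<longleftrightarrow> {f x, f y} \<in> edges F24"
    using f by (auto simp: isomorphism_def induced_def F24_def)
  have g: "bij_betw g {..<6} S" unfolding g_def by (rule bij_betw_trans[OF F24_label_bij bij_betw_inv_into[OF b]])
  have fg: "f (g i) = F24_label i" "g i \<in> S" if "i < 6" for i
    using that b g bij_betw_imp_surj_on[OF F24_label_bij] f_inv_into_f[of "F24_label i" f S] by (auto simp: g_def bij_betw_def)
  have "set xs = S" using g by (auto simp: xs_def bij_betw_def lessThan_atLeast0)
  moreover have "xs ! 4 \<noteq> xs ! 5" using inj_onD[OF bij_betw_imp_inj_on[OF g], of 4 5] by (auto simp: xs_def)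
  moreover have "adj G (xs ! i) (xs ! j) = spider i j" if "i < 6" "j < 6" for i j
    using that e[of "g i" "g j"] F24_spider[OF that] by (simp add: xs_def adj_def fg)
  ultimately show ?thesis using S unfolding in_embeddings[OF assms(1)] Bex_def
    by (intro exI[of _ xs]) (auto simp: tuples_def xs_def)
qed

lemma embeddings_same_set:
  assumes "graphlike E" "xs \<in> embeddings E V"
  shows "card {ys \<in> embeddings E V. set ys = set xs} = 2"
proof -
  let ?A = "{[0,1,2,3,4,5], [0,1,2,3,5,4]} :: nat list set"
  define h where "h = inv_into {..<6} ((!) xs)"
  have b: "bij_betw ((!) xs) {..<6} (set xs)" by (rule embedding_bij[OF assms])
  have h: "bij_betw h (set xs) {..<6}" unfolding h_def by (rule bij_betw_inv_into[OF b])
  have xs: "set xs \<subseteq> V" "length xs = 6" and sp: "\<And>i j. i < 6 \<Longrightarrow> j < 6 \<Longrightarrow> E (xs ! i) (xs ! j) = spider i j"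
    using assms(2) unfolding in_embeddings[OF assms(1)] by (auto simp: tuples_def)
  have nth: "xs ! h x = x" "h x < 6" if "x \<in> set xs" for x
    using that b h f_inv_into_f[of x "(!) xs" "{..<6}"] by (auto simp: h_def bij_betw_def)
  have "{ys \<in> embeddings E V. set ys = set xs} = (\<lambda>s. map ((!) xs) s) ` ?A"
  proof (intro equalityI subsetI)
    fix ys assume ys: "ys \<in> {ys \<in> embeddings E V. set ys = set xs}"
    then have len: "length ys = 6" and sp': "\<And>i j. i < 6 \<Longrightarrow> j < 6 \<Longrightarrow> E (ys ! i) (ys ! j) = spider i j" and ne: "ys ! 4 \<noteq> ys ! 5"
      using in_embeddings[OF assms(1), of ys V] by (auto simp: tuples_def)
    have mem: "ys ! i \<in> set xs" if "i < 6" for i using that ys len nth_mem[of i ys] by auto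
    have eq: "map ((!) xs) (map h ys) = ys" using ys nth by (auto intro!: map_idI)
    have "map h ys \<in> {s \<in> tuples {..<6} 6. (\<forall>i<6. \<forall>j<6. spider (s ! i) (s ! j) = spider i j) \<and> s ! 4 \<noteq> s ! 5}"
    proof (intro CollectI conjI allI impI)
      show "map h ys \<in> tuples {..<6} 6" using ys nth len by (auto simp: tuples_def)
      show "spider (map h ys ! i) (map h ys ! j) = spider i j" if "i < 6" "j < 6" for i j
        using that mem nth sp[of "h (ys ! i)" "h (ys ! j)"] sp'[OF that] len by simp
      show "map h ys ! 4 \<noteq> map h ys ! 5" using ne len mem nth(1)[of "ys ! 4"] nth(1)[of "ys ! 5"] by auto
    qed
    then have "map h ys \<in> ?A" unfolding spider_automorphisms .
    then show "ys \<in> (\<lambda>s. map ((!) xs) s) ` ?A" using eq by (metis image_eqI)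
  next
    fix ys assume "ys \<in> (\<lambda>s. map ((!) xs) s) ` ?A"
    then obtain s where s: "s \<in> ?A" "ys = map ((!) xs) s" by blast
    then have s': "s \<in> {s \<in> tuples {..<6} 6. (\<forall>i<6. \<forall>j<6. spider (s ! i) (s ! j) = spider i j) \<and> s ! 4 \<noteq> s ! 5}"
      using spider_automorphisms by simp
    have len: "length s = 6" "set s \<subseteq> {..<6}" using s' by (auto simp: tuples_def)
    have lt: "s ! i < 6" if "i < 6" for i using subsetD[OF len(2) nth_mem, of i] len(1) that by simp
    have set_s: "set s = {..<6}" using s(1) unfolding lessThan6 by (elim insertE emptyE) (simp_all add: insert_commute)
    have "set ys = set xs" using b unfolding s(2) by (simp add: set_s bij_betw_def)
    moreover have "ys ! 4 \<noteq> ys ! 5"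
      using s' lt[of 4] lt[of 5] inj_onD[OF bij_betw_imp_inj_on[OF b], of "s ! 4" "s ! 5"] len unfolding s(2) by auto
    moreover have "E (ys ! i) (ys ! j) = spider i j" if "i < 6" "j < 6" for i j
      using s' that sp[OF lt lt, OF that] len unfolding s(2) by simp
    ultimately show "ys \<in> {ys \<in> embeddings E V. set ys = set xs}"
      using xs len unfolding in_embeddings[OF assms(1)] mem_Collect_eq by (auto simp: tuples_def s(2))
  qed
  moreover have "inj_on (\<lambda>s. map ((!) xs) s) ?A"
  proof -
    have "xs ! 4 \<noteq> xs ! 5" using assms(2) by (simp add: embeddings_def)
    then show ?thesis by (auto simp: inj_on_def)
  qed
  ultimately show ?thesis by (simp add: card_image)
qed

text \<open>The vertex sets of embeddings are the sets that induce \<open>F24\<close>, and each is the set of two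
embeddings, one for each automorphism.\<close>

lemma card_embeddings:
  assumes "simple_graph G"
  shows "card (embeddings (adj G) (verts G)) = 2 * card (F24_sets G)"
proof -
  have g: "graphlike (adj G)" by (rule graphlike_adj[OF assms])
  have fin: "finite (verts G)" using assms by (simp add: simple_graph_def)
  then have 1: "finite (embeddings (adj G) (verts G))" by (simp add: embeddings_def finite_tuples)
  have "F24_sets G \<subseteq> Pow (verts G)" by (auto simp: F24_sets_def)
  then have 2: "finite (F24_sets G)" using fin finite_subset by blast
  have "card (embeddings (adj G) (verts G)) = (\<Sum>S\<in>F24_sets G. card {xs \<in> embeddings (adj G) (verts G). set xs = S})"
    using sum.group[OF 1 2, of set "\<lambda>_. 1::nat"] embedding_set[OF g] by (simp add: image_subset_iff)
  also have "\<dots> = (\<Sum>S\<in>F24_sets G. 2)"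
    using embedding_exists[OF g] embeddings_same_set[OF g] by (intro sum.cong refl) blast
  finally show ?thesis by simp
qed

lemma density_F24: "density F24 G = real (card (F24_sets G)) / real (card (verts G) choose 6)"
  unfolding density_def F24_sets_def by (simp add: F24_def)

section \<open>Blowups as graphs and the edit distance\<close>

definition hex_blowup :: "'a set \<Rightarrow> ('a \<Rightarrow> nat) \<Rightarrow> 'a graph" where
  "hex_blowup V c = blowup C6 (\<lambda>i. {x \<in> V. c x = i})"

lemma C6_hex: "i < 6 \<Longrightarrow> j < 6 \<Longrightarrow> {i, j} \<in> edges C6 \<longleftrightarrow> hex i j"
  unfolding less6 by (elim disjE) (simp_all add: C6_def hex_def doubleton_eq_iff)

lemma hex_self: "\<not> hex i i" "hex i j = hex j i"
  by (auto simp: hex_def)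

lemma hex_blowup_props:
  assumes "finite V" "\<And>x. x \<in> V \<Longrightarrow> c x < 6"
  shows "verts (hex_blowup V c) = V" "adj (hex_blowup V c) x y \<longleftrightarrow> x \<in> V \<and> y \<in> V \<and> hex (c x) (c y)"
    "simple_graph (hex_blowup V c)" "hex_blowup V c \<in> blowups C6"
proof -
  have v: "verts C6 = {..<6}" by (simp add: C6_def)
  show 1: "verts (hex_blowup V c) = V" using assms(2) by (auto simp: hex_blowup_def blowup_def v)
  have e: "edges (hex_blowup V c) = {{x, y} | x y. x \<in> V \<and> y \<in> V \<and> hex (c x) (c y)}"
  proof (intro equalityI subsetI)
    fix e assume "e \<in> edges (hex_blowup V c)"
    then obtain x y where "e = {x, y}" "x \<in> V" "y \<in> V" "{c x, c y} \<in> edges C6"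
      by (auto simp: hex_blowup_def blowup_def)
    then show "e \<in> {{x, y} | x y. x \<in> V \<and> y \<in> V \<and> hex (c x) (c y)}" using C6_hex assms(2) by blast
  next
    fix e assume "e \<in> {{x, y} | x y. x \<in> V \<and> y \<in> V \<and> hex (c x) (c y)}"
    then obtain x y where xy: "e = {x, y}" "x \<in> V" "y \<in> V" "hex (c x) (c y)" by blast
    then have "x \<noteq> y" using hex_self(1) by metis
    moreover have "{c x, c y} \<in> edges C6" using xy C6_hex assms(2) by blast
    ultimately show "e \<in> edges (hex_blowup V c)" using xy assms(2)
      unfolding hex_blowup_def blowup_def v by simp blast
  qed
  show "adj (hex_blowup V c) x y \<longleftrightarrow> x \<in> V \<and> y \<in> V \<and> hex (c x) (c y)"
    unfolding adj_def e mem_Collect_eq doubleton_eq_iff using hex_self(2) by blast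
  have "card {x, y} = 2" if "hex (c x) (c y)" for x y
    using that hex_self(1) by (cases "x = y") auto
  then show "simple_graph (hex_blowup V c)" using assms(1) unfolding simple_graph_def e 1 by auto
  have "blowup_parts C6 (\<lambda>i. {x \<in> V. c x = i})"
    using assms(1) by (auto simp: blowup_parts_def disjoint_family_on_def)
  then show "hex_blowup V c \<in> blowups C6" unfolding blowups_def hex_blowup_def by blast
qed

lemma edit_distance_le:
  assumes "simple_graph G" "\<And>x. x \<in> verts G \<Longrightarrow> c x < 6"
  shows "edit_distance G C6 \<le> mismatches (adj G) (verts G) c"
proof -
  define V H where "V = verts G" and "H = hex_blowup V c"
  have fin: "finite V" using assms(1) by (simp add: simple_graph_def V_def)
  note H = hex_blowup_props[OF fin, of c, folded H_def, OF assms(2)[folded V_def]]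
  have sub: "sym_diff (edges G) (edges H) \<subseteq> (\<lambda>(x, y). {x, y}) ` {(x, y) \<in> V \<times> V. adj G x y \<noteq> hex (c x) (c y)}"
  proof
    fix e assume e: "e \<in> sym_diff (edges G) (edges H)"
    then have "e \<subseteq> V" "card e = 2" using assms(1) H(1) H(3) unfolding simple_graph_def V_def by blast+
    then obtain x y where xy: "e = {x, y}" "x \<in> V" "y \<in> V" by (auto simp: card_2_iff)
    then have "adj G x y \<noteq> hex (c x) (c y)" using e H(2)[of x y] unfolding adj_def by blast
    then show "e \<in> (\<lambda>(x, y). {x, y}) ` {(x, y) \<in> V \<times> V. adj G x y \<noteq> hex (c x) (c y)}" using xy by blast
  qed
  have fin2: "finite {(x, y) \<in> V \<times> V. adj G x y \<noteq> hex (c x) (c y)}" using fin by (auto intro: finite_subset[of _ "V \<times> V"])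
  have "card (sym_diff (edges G) (edges H)) \<le> mismatches (adj G) V c"
    unfolding mismatches_def using card_mono[OF finite_imageI[OF fin2] sub] card_image_le[OF fin2] by (rule order_trans)
  moreover have "isomorphic H H" unfolding isomorphic_def isomorphism_def by (intro exI[of _ id]) auto
  then have "edit_distance G C6 \<le> card (sym_diff (edges G) (edges H))"
    unfolding edit_distance_def using H(1,3,4) V_def by (intro Least_le exI[of _ H]) simp
  ultimately show ?thesis by (simp add: V_def)
qed

lemma mismatches_le: "finite V \<Longrightarrow> mismatches E V c \<le> (card V)\<^sup>2"
  unfolding mismatches_def power2_eq_square card_cartesian_product[symmetric] by (intro card_mono) auto

lemma tuples_nth: "xs \<in> tuples V k \<Longrightarrow> i < k \<Longrightarrow> xs ! i \<in> V"
  using nth_mem by (fastforce simp: tuples_def)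

lemma F24_sets_copies:
  assumes "simple_graph G"
  shows "2 * real (card (F24_sets G)) = real (copies (adj G) (verts G)) - real (paths (adj G) (verts G))"
  using copies_split[OF _ graphlike_adj[OF assms], of "verts G"] card_embeddings[OF assms] assms
  by (simp add: simple_graph_def)

lemma F24_sets_blowup:
  assumes "finite V" "\<And>x. x \<in> V \<Longrightarrow> c x < 6"
  shows "2 * real (card (F24_sets (hex_blowup V c))) = hexpoly (\<lambda>i. real (part_size V c i)) - real (paths (blow c) V)"
proof -
  note H = hex_blowup_props[where c = c, OF assms]
  have eq: "pattern (adj (hex_blowup V c)) xs i j = pattern (blow c) xs i j" if "xs \<in> tuples V k" "i < k" "j < k" for xs k i j
    using H(2)[of "xs ! i" "xs ! j"] that tuples_nth[of xs V k] by (simp add: pattern_def blow_def)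
  have "copies (adj (hex_blowup V c)) V = copies (blow c) V"
    unfolding copies_def using eq[where k = 6] by (intro arg_cong[where f = card] Collect_cong conj_cong refl copy_cong) auto
  moreover have "path5 (pattern (adj (hex_blowup V c)) xs) = path5 (pattern (blow c) xs)" if "xs \<in> tuples V 5" for xs
    unfolding path5_def bits4 using eq[OF that] by simp
  then have "paths (adj (hex_blowup V c)) V = paths (blow c) V"
    unfolding paths_def by (intro arg_cong[where f = card] Collect_cong conj_cong refl) auto
  ultimately show ?thesis using F24_sets_copies[OF H(3)] copies_blow[where c = c, OF assms] by (simp add: H(1))
qed

text \<open>Conversely to \<open>hex_blowup\<close>, the parts of any blowup are the colour classes of a colouring; the
value outside of the parts is arbitrary.\<close>

lemma blowup_C6_colouring:
  assumes "blowup_parts C6 V"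
  obtains c where "\<And>x. c x < 6" "\<And>i. i < 6 \<Longrightarrow> part_size (\<Union>i<6. V i) c i = card (V i)"
    "blowup C6 V = hex_blowup (\<Union>i<6. V i) c" "finite (\<Union>i<6. V i)"
proof -
  define c where "c x = (if \<exists>i<6. x \<in> V i then SOME i. i < 6 \<and> x \<in> V i else 0)" for x
  have v: "verts C6 = {..<6}" by (simp add: C6_def)
  have fin: "finite (\<Union>i<6. V i)" and dj: "\<And>i j x. i < 6 \<Longrightarrow> j < 6 \<Longrightarrow> x \<in> V i \<Longrightarrow> x \<in> V j \<Longrightarrow> i = j"
    using assms by (auto simp: blowup_parts_def v disjoint_family_on_def)
  have c: "c x = i" if "i < 6" "x \<in> V i" for x i
  proof -
    have "\<exists>i. i < 6 \<and> x \<in> V i" using that by blast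
    from someI_ex[OF this] show ?thesis using that dj by (auto simp: c_def)
  qed
  have "c x = 0" if "\<not> (\<exists>i<6. x \<in> V i)" for x unfolding c_def if_not_P[OF that] ..
  then have lt: "c x < 6" for x using c by (cases "\<exists>i<6. x \<in> V i") auto
  have part: "{x \<in> (\<Union>i<6. V i). c x = i} = V i" if "i < 6" for i using that c by auto
  have "blowup C6 V = blowup C6 (\<lambda>i. {x \<in> (\<Union>i<6. V i). c x = i})"
    unfolding blowup_def v using part by (intro arg_cong2[where f = Pair] Collect_cong ex_cong1 conj_cong refl SUP_cong) auto
  then have "blowup C6 V = hex_blowup (\<Union>i<6. V i) c" unfolding hex_blowup_def .
  moreover have "part_size (\<Union>i<6. V i) c i = card (V i)" if "i < 6" for i unfolding part_size_def part[OF that] ..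
  ultimately show ?thesis using lt fin by (intro that[of c])
qed

section \<open>Limits of densities\<close>

lemma choose_6: "real (v choose 6) = (\<Prod>i<6. real v - real i) / 720"
  by (simp add: binomial_gbinomial gbinomial_prod_rev fact_numeral lessThan_atLeast0)

lemma choose_6_limit:
  assumes "(\<lambda>n. real (v n) / real n) \<longlonglongrightarrow> 1"
  shows "(\<lambda>n. real (v n choose 6) / real n ^ 6) \<longlonglongrightarrow> 1 / 720"
proof -
  have "(\<lambda>n. (\<Prod>i<6. real (v n) / real n - real i * (1 / real n)) / 720) \<longlonglongrightarrow> (\<Prod>i<6. 1 - real i * 0) / (720 :: real)"
    by (intro tendsto_intros assms lim_const_over_n) simp
  moreover have "(\<Prod>i<6. real (v n) / real n - real i * (1 / real n)) / 720 = real (v n choose 6) / real n ^ 6" for n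
  proof -
    have "(\<Prod>i<6. real (v n) / real n - real i * (1 / real n)) = (\<Prod>i<6. (real (v n) - real i) / real n)"
      by (simp add: diff_divide_distrib)
    also have "\<dots> = (\<Prod>i<6. real (v n) - real i) / real n ^ 6" by (simp add: prod_dividef)
    finally show ?thesis by (simp add: choose_6)
  qed
  ultimately show ?thesis by simp
qed

text \<open>Twice the number of induced copies in the blowup is \<open>hexpoly\<close> of the part sizes up to the number
of paths on five vertices, which is of lower order. Division by \<open>n choose 6\<close> gives the factor 360.\<close>

lemma blowup_limit:
  fixes V :: "nat \<Rightarrow> nat \<Rightarrow> nat set"
  assumes parts: "\<And>n. blowup_parts C6 (V n)" and lim: "\<And>i. i < 6 \<Longrightarrow> (\<lambda>n. real (card (V n i)) / real n) \<longlonglongrightarrow> x i"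
    and sum: "(\<Sum>i<6. x i) = 1"
  shows "(\<lambda>n. density F24 (blowup C6 (V n))) \<longlonglongrightarrow> 360 * hexpoly x"
proof -
  define N where "N n = real (card (F24_sets (blowup C6 (V n))))" for n
  define v where "v n = (\<Sum>i<6. card (V n i))" for n
  have dens: "density F24 (blowup C6 (V n)) = N n / real (v n choose 6)"
    and N: "2 * N n \<le> hexpoly (\<lambda>i. real (card (V n i)))" "hexpoly (\<lambda>i. real (card (V n i))) - real (v n) ^ 5 \<le> 2 * N n" for n
  proof -
    obtain c where c: "\<And>x. c x < 6" "\<And>i. i < 6 \<Longrightarrow> part_size (\<Union>i<6. V n i) c i = card (V n i)"
      "blowup C6 (V n) = hex_blowup (\<Union>i<6. V n i) c" and fin: "finite (\<Union>i<6. V n i)"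
      using blowup_C6_colouring[OF parts[of n]] by metis
    have card: "card (\<Union>i<6. V n i) = v n"
      using sum_part_size[OF fin, of c] c(1,2) by (simp add: v_def)
    show "density F24 (blowup C6 (V n)) = N n / real (v n choose 6)"
      unfolding density_F24 N_def using hex_blowup_props(1)[OF fin, of c] c(1) card by (simp add: c(3))
    have "2 * N n = hexpoly (\<lambda>i. real (part_size (\<Union>i<6. V n i) c i)) - real (paths (blow c) (\<Union>i<6. V n i))"
      unfolding N_def c(3) by (rule F24_sets_blowup[OF fin c(1)])
    moreover have "hexpoly (\<lambda>i. real (part_size (\<Union>i<6. V n i) c i)) = hexpoly (\<lambda>i. real (card (V n i)))"
      by (simp add: hexpoly_def c(2))
    moreover have "real (paths (blow c) (\<Union>i<6. V n i)) \<le> real (v n) ^ 5"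
      using paths_le[OF fin, of "blow c"] unfolding card by (metis of_nat_le_iff of_nat_power)
    ultimately show "2 * N n \<le> hexpoly (\<lambda>i. real (card (V n i)))" "hexpoly (\<lambda>i. real (card (V n i))) - real (v n) ^ 5 \<le> 2 * N n" by auto
  qed
  have vlim: "(\<lambda>n. real (v n) / real n) \<longlonglongrightarrow> 1"
  proof -
    have "(\<lambda>n. \<Sum>i<6. real (card (V n i)) / real n) \<longlonglongrightarrow> (\<Sum>i<6. x i)" using lim by (intro tendsto_sum) auto
    then show ?thesis unfolding sum v_def by (simp add: sum_divide_distrib)
  qed
  define h where "h n = hexpoly (\<lambda>i. real (card (V n i)) / real n)" for n
  have hlim: "h \<longlonglongrightarrow> hexpoly x"
    unfolding h_def hexpoly_def by (intro tendsto_intros lim) simp_all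
  have h: "h n * real n ^ 6 = hexpoly (\<lambda>i. real (card (V n i)))" if "n > 0" for n
    using hexpoly_scale[of "real n" "\<lambda>i. real (card (V n i)) / real n"] that by (simp add: h_def)
  have "(\<lambda>n. 2 * N n / real n ^ 6) \<longlonglongrightarrow> hexpoly x"
  proof (rule tendsto_sandwich)
    show "\<forall>\<^sub>F n in sequentially. h n - (real (v n) / real n) ^ 5 * (1 / real n) \<le> 2 * N n / real n ^ 6"
    proof (rule eventually_mono[OF eventually_gt_at_top[of 0]])
      fix n :: nat assume n: "n > 0"
      have "h n - (real (v n) / real n) ^ 5 * (1 / real n) = (h n * real n ^ 6 - real (v n) ^ 5) / real n ^ 6"
        using n by (simp add: diff_divide_distrib power_divide flip: power_Suc2)
      also have "\<dots> \<le> 2 * N n / real n ^ 6" using N(2)[of n] h[OF n] by (intro divide_right_mono) auto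
      finally show "h n - (real (v n) / real n) ^ 5 * (1 / real n) \<le> 2 * N n / real n ^ 6" .
    qed
    show "\<forall>\<^sub>F n in sequentially. 2 * N n / real n ^ 6 \<le> h n"
    proof (rule eventually_mono[OF eventually_gt_at_top[of 0]])
      fix n :: nat assume n: "n > 0"
      then show "2 * N n / real n ^ 6 \<le> h n" using N(1)[of n] h[OF n] by (simp add: pos_divide_le_eq)
    qed
    have "(\<lambda>n. h n - (real (v n) / real n) ^ 5 * (1 / real n)) \<longlonglongrightarrow> hexpoly x - 1 ^ 5 * 0"
      by (intro tendsto_intros hlim vlim lim_const_over_n)
    then show "(\<lambda>n. h n - (real (v n) / real n) ^ 5 * (1 / real n)) \<longlonglongrightarrow> hexpoly x" by simp
  qed (rule hlim)
  then have "(\<lambda>n. (2 * N n / real n ^ 6) / 2 / (real (v n choose 6) / real n ^ 6)) \<longlonglongrightarrow> hexpoly x / 2 / (1 / 720)"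
    by (intro tendsto_intros choose_6_limit vlim) auto
  moreover have "\<forall>\<^sub>F n in sequentially. (2 * N n / real n ^ 6) / 2 / (real (v n choose 6) / real n ^ 6) = density F24 (blowup C6 (V n))"
    by (rule eventually_mono[OF eventually_gt_at_top[of 0]]) (simp add: dens)
  ultimately show ?thesis by (simp add: tendsto_cong field_simps)
qed

lemma near_multiple_limit:
  assumes "\<And>n. \<bar>real (k n) - x * real n\<bar> \<le> 1"
  shows "(\<lambda>n. real (k n) / real n) \<longlonglongrightarrow> x"
proof -
  have "(\<lambda>n. real (k n) / real n - x) \<longlonglongrightarrow> 0"
  proof (rule tendsto_0_le)
    show "\<forall>\<^sub>F n in sequentially. norm (real (k n) / real n - x) \<le> norm (1 / real n) * 1"
    proof (rule eventually_mono[OF eventually_gt_at_top[of 0]])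
      fix n :: nat assume n: "n > 0"
      then have "real (k n) / real n - x = (real (k n) - x * real n) / real n" by (simp add: field_simps)
      then show "norm (real (k n) / real n - x) \<le> norm (1 / real n) * 1" using assms[of n] by (simp add: divide_right_mono)
    qed
  qed (rule lim_const_over_n)
  then show ?thesis by (simp add: LIM_zero_iff)
qed

text \<open>The description of the limit determines it uniquely because for each point of the simplex there is
a sequence of blowups with these part sizes.\<close>

lemma limit_density_C6:
  assumes "x \<in> simplex 6"
  shows "limit_density F24 C6 x = 360 * hexpoly x"
  unfolding limit_density_def
proof (rule the_equality)
  have v: "verts C6 = {..<6}" by (simp add: C6_def)
  have sum: "(\<Sum>i<6. x i) = 1" using assms by (simp add: simplex_def)
  show "\<forall>V :: nat \<Rightarrow> nat \<Rightarrow> nat set. (\<forall>n. blowup_parts C6 (V n)) \<and> (\<forall>i\<in>verts C6. (\<lambda>n. real (card (V n i)) / real n) \<longlonglongrightarrow> x i) \<longrightarrow>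
    (\<lambda>n. density F24 (blowup C6 (V n))) \<longlonglongrightarrow> 360 * hexpoly x"
    using blowup_limit[OF _ _ sum] by (simp add: v)
  fix L assume L: "\<forall>V :: nat \<Rightarrow> nat \<Rightarrow> nat set. (\<forall>n. blowup_parts C6 (V n)) \<and> (\<forall>i\<in>verts C6. (\<lambda>n. real (card (V n i)) / real n) \<longlonglongrightarrow> x i) \<longrightarrow>
    (\<lambda>n. density F24 (blowup C6 (V n))) \<longlonglongrightarrow> L"
  define V where "V n i = (\<lambda>k. 6 * k + i) ` {..<nat \<lfloor>x i * real n\<rfloor>}" for n i :: nat
  have parts: "blowup_parts C6 (V n)" for n
  proof -
    have "i = j" if "i < 6" "j < 6" "6 * k + i = 6 * l + j" for i j k l :: nat using that by presburger
    then show ?thesis by (fastforce simp: blowup_parts_def v disjoint_family_on_def V_def)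
  qed
  have lim: "(\<lambda>n. real (card (V n i)) / real n) \<longlonglongrightarrow> x i" if "i < 6" for i
  proof (rule near_multiple_limit)
    fix n
    have "0 \<le> x i * real n" using that assms by (simp add: simplex_def)
    then have "real (nat \<lfloor>x i * real n\<rfloor>) = of_int \<lfloor>x i * real n\<rfloor>" by simp
    moreover have "card (V n i) = nat \<lfloor>x i * real n\<rfloor>" unfolding V_def by (subst card_image) (auto simp: inj_on_def)
    ultimately show "\<bar>real (card (V n i)) - x i * real n\<bar> \<le> 1" by linarith
  qed
  have "(\<lambda>n. density F24 (blowup C6 (V n))) \<longlonglongrightarrow> L" using L parts lim by (simp add: v)
  moreover have "(\<lambda>n. density F24 (blowup C6 (V n))) \<longlonglongrightarrow> 360 * hexpoly x" by (rule blowup_limit[OF parts lim sum])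
  ultimately show "L = 360 * hexpoly x" by (rule LIMSEQ_unique)
qed

definition densities :: "nat \<Rightarrow> real set" where
  "densities n = {density F24 G | G :: nat graph. simple_graph G \<and> card (verts G) = n}"

lemma finite_densities: "finite (densities n)"
proof -
  have "densities n \<subseteq> (\<lambda>k. real k / real (n choose 6)) ` {..2 ^ n}"
  proof
    fix d assume "d \<in> densities n"
    then obtain G :: "nat graph" where G: "simple_graph G" "card (verts G) = n" "d = density F24 G"
      unfolding densities_def by blast
    have "card (F24_sets G) \<le> card (Pow (verts G))" using G(1) by (intro card_mono) (auto simp: F24_sets_def simple_graph_def)
    then have "card (F24_sets G) \<in> {..2 ^ n}" using G by (simp add: card_Pow simple_graph_def)
    then show "d \<in> (\<lambda>k. real k / real (n choose 6)) ` {..2 ^ n}" using G by (auto simp: density_F24)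
  qed
  then show ?thesis by (rule finite_subset) simp
qed

lemma density_le_max:
  fixes G :: "nat graph"
  assumes "simple_graph G" "card (verts G) = n"
  shows "density F24 G \<le> max_density F24 n"
  using assms finite_densities unfolding max_density_def densities_def by (intro Max_ge) blast+

lemma density_upper:
  assumes "simple_graph G" "card (verts G) = n"
  shows "density F24 G \<le> real n ^ 6 / 7776 / real (n choose 6)"
proof -
  have fin: "finite (verts G)" using assms(1) by (simp add: simple_graph_def)
  have "3888 * int (copies (adj G) (verts G)) \<le> int n ^ 6" using copies_bound[OF fin graphlike_adj[OF assms(1)]] assms(2) by simp
  then have "real_of_int (3888 * int (copies (adj G) (verts G))) \<le> real_of_int (int n ^ 6)" by (simp only: of_int_le_iff)
  then have "real (card (F24_sets G)) \<le> real n ^ 6 / 7776" using F24_sets_copies[OF assms(1)] by simp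
  then show ?thesis unfolding density_F24 assms(2) by (intro divide_right_mono) auto
qed

lemma max_density_upper: "max_density F24 n \<le> real n ^ 6 / 7776 / real (n choose 6)"
proof -
  have "simple_graph ({..<n}, {})" by (simp add: simple_graph_def)
  then have "density F24 ({..<n}, {}) \<in> densities n" unfolding densities_def by (intro CollectI exI[of _ "({..<n}, {})"]) simp
  then have "Max (densities n) \<in> densities n" using finite_densities by (intro Max_in) blast+
  then obtain G :: "nat graph" where "simple_graph G" "card (verts G) = n" "max_density F24 n = density F24 G"
    unfolding max_density_def densities_def by blast
  then show ?thesis using density_upper by metis
qed

text \<open>Balanced blowups have the lower bound as their limit, and the upper bound is \<open>copies_bound\<close>.\<close>

lemma max_density_limit: "max_density F24 \<longlonglongrightarrow> 5 / 54"
proof (rule tendsto_sandwich)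
  define V where "V n i = {y \<in> {..<n}. y mod 6 = i}" for n i :: nat
  have v: "verts C6 = {..<6}" by (simp add: C6_def)
  have parts: "blowup_parts C6 (V n)" for n by (auto simp: blowup_parts_def disjoint_family_on_def V_def)
  have lim: "(\<lambda>n. real (card (V n i)) / real n) \<longlonglongrightarrow> 1 / 6" if i: "i < 6" for i
  proof (rule near_multiple_limit)
    fix n
    have "(\<lambda>k. 6 * k + i) ` {..<n div 6} \<subseteq> V n i" "V n i \<subseteq> (\<lambda>k. 6 * k + i) ` {..n div 6}"
    proof -
      show "(\<lambda>k. 6 * k + i) ` {..<n div 6} \<subseteq> V n i" using i by (auto simp: V_def)
      show "V n i \<subseteq> (\<lambda>k. 6 * k + i) ` {..n div 6}"
      proof
        fix y assume "y \<in> V n i"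
        then have "y = 6 * (y div 6) + i" "y div 6 \<in> {..n div 6}" by (auto simp: V_def div_le_mono)
        then show "y \<in> (\<lambda>k. 6 * k + i) ` {..n div 6}" by (rule image_eqI)
      qed
    qed
    then have "card ((\<lambda>k. 6 * k + i) ` {..<n div 6}) \<le> card (V n i)" "card (V n i) \<le> card ((\<lambda>k. 6 * k + i) ` {..n div 6})"
      by (auto intro!: card_mono simp: V_def)
    then have "n div 6 \<le> card (V n i)" "card (V n i) \<le> n div 6 + 1"
      by (simp_all add: card_image inj_on_def)
    then show "\<bar>real (card (V n i)) - 1 / 6 * real n\<bar> \<le> 1" by linarith
  qed
  have "(\<lambda>n. density F24 (blowup C6 (V n))) \<longlonglongrightarrow> 360 * hexpoly (\<lambda>_. 1 / 6)"
    by (rule blowup_limit[OF parts lim]) simp_all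
  then show "(\<lambda>n. density F24 (blowup C6 (V n))) \<longlonglongrightarrow> 5 / 54" by (simp add: hexpoly_def power_divide)
  have "blowup C6 (V n) = hex_blowup {..<n} (\<lambda>y. y mod 6)" for n unfolding hex_blowup_def V_def ..
  then show "\<forall>\<^sub>F n in sequentially. density F24 (blowup C6 (V n)) \<le> max_density F24 n"
    using hex_blowup_props(1,3)[of "{..<n}" "\<lambda>y. y mod 6" for n] by (intro always_eventually allI density_le_max) auto
  show "\<forall>\<^sub>F n in sequentially. max_density F24 n \<le> real n ^ 6 / 7776 / real (n choose 6)"
    using max_density_upper by (intro always_eventually allI)
  have "(\<lambda>n. real n / real n) \<longlonglongrightarrow> 1" using near_multiple_limit[of "\<lambda>n. n" 1] by simp
  from tendsto_divide[OF tendsto_const[of "1/7776"] choose_6_limit[OF this]]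
  have "(\<lambda>n. 1 / 7776 / (real (n choose 6) / real n ^ 6)) \<longlonglongrightarrow> 5 / 54" by simp
  then show "(\<lambda>n. real n ^ 6 / 7776 / real (n choose 6)) \<longlonglongrightarrow> 5 / 54" by simp
qed

section \<open>Stability\<close>

lemma unique_maximiser_C6: "unique_maximiser F24 6 C6 (\<lambda>i. if i < 6 then 1 / 6 else 0)"
proof -
  let ?u = "\<lambda>i::nat. if i < 6 then 1 / 6 else (0::real)"
  have u: "?u \<in> simplex 6" "hexpoly ?u = 1 / 3888" by (simp_all add: simplex_def hexpoly_def power_divide)
  have le: "limit_density F24 C6 y \<le> 5 / 54" "limit_density F24 C6 y = 5 / 54 \<Longrightarrow> i < 6 \<Longrightarrow> y i = 1 / 6"
    if "y \<in> simplex 6" for y i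
    using hexpoly_max(1)[of y] hexpoly_max(2)[of y i] that unfolding limit_density_C6[OF that] by (auto simp: simplex_def)
  have lim: "limit_density F24 C6 ?u = 5 / 54" unfolding limit_density_C6[OF u(1)] u(2) by simp
  have max: "is_maximiser F24 6 C6 ?u" unfolding is_maximiser_def lim using u(1) le(1) by blast
  have id: "automorphism id C6" by (simp add: isomorphism_def)
  have "\<exists>f. automorphism f C6 \<and> (\<forall>i<6. y i = ?u (f i))" if y: "is_maximiser F24 6 C6 y" for y
  proof -
    have "y \<in> simplex 6" "limit_density F24 C6 ?u \<le> limit_density F24 C6 y"
      using y u(1) by (simp_all add: is_maximiser_def)
    then have "y i = 1 / 6" if "i < 6" for i using le(1)[of y] le(2)[of y i] that lim by simp
    then show ?thesis using id by (intro exI[of _ id]) simp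
  qed
  then show ?thesis using max by (simp add: unique_maximiser_def)
qed

lemma excess_sum_blow:
  assumes "\<And>x. x \<in> V \<Longrightarrow> c x < 6"
  shows "(\<Sum>xs\<in>tuples V 6. excess (pattern (blow c) xs)) = 0"
  using excess_blow[where c = c, OF _ assms] by (intro sum.neutral) blast

definition optimal_colouring :: "('a \<Rightarrow> 'a \<Rightarrow> bool) \<Rightarrow> 'a set \<Rightarrow> ('a \<Rightarrow> nat) \<Rightarrow> bool" where
  "optimal_colouring E V c \<longleftrightarrow> (\<forall>x. c x < 6) \<and> (\<forall>c'. (\<forall>x. c' x < 6) \<longrightarrow> mismatches E V c \<le> mismatches E V c')"

lemma optimal_colouring_exists: "\<exists>c. optimal_colouring E V c"
  using ex_has_least_nat[of "\<lambda>c. \<forall>x. c x < (6::nat)" "\<lambda>_. 0" "mismatches E V"] by (auto simp: optimal_colouring_def)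

lemma many_roots:
  assumes "finite V" "real (copies E V) \<ge> real (card V) ^ 6 / 4000"
  shows "real (card (roots E V)) \<ge> real (card V) ^ 4 / 4000"
proof (cases "card V = 0")
  case False
  have "real (card V) ^ 6 / 4000 \<le> real (card (roots E V)) * (real (card V))\<^sup>2"
    using copies_le_roots[OF assms(1), of E] assms(2) by (metis of_nat_le_iff of_nat_mult of_nat_power order_trans)
  also have "real (card V) ^ 6 / 4000 = real (card V) ^ 4 / 4000 * (real (card V))\<^sup>2" by (simp flip: power_add)
  finally show ?thesis using False by (simp only: mult_le_cancel_right) simp
qed simp

lemma flag_identity_real:
  assumes "finite V" "graphlike E"
  shows "270000 * real (card V) ^ 6 = real_of_int (\<Sum>xs\<in>tuples V 6. excess (pattern E xs)) + 1049760000 * real (copies E V) + real_of_int (sos E V)"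
proof -
  have "real_of_int (270000 * int (card V) ^ 6) = real_of_int ((\<Sum>xs\<in>tuples V 6. excess (pattern E xs)) + 1049760000 * int (copies E V) + sos E V)"
    by (simp only: flag_identity[OF assms])
  then show ?thesis by (simp only: of_int_add of_int_mult of_int_power of_int_numeral of_int_of_nat_eq)
qed

lemma optimal_excess:
  assumes "finite V" "graphlike E" "optimal_colouring E V c" "real (copies E V) \<ge> real (card V) ^ 6 / 4000"
  shows "67 / 500 * real (mismatches E V c) * real (card V) ^ 4 \<le> real_of_int (\<Sum>xs\<in>tuples V 6. excess (pattern E xs))"
proof -
  have "536 * int (card (roots E V)) * int (mismatches E V c) \<le> (\<Sum>xs\<in>tuples V 6. excess (pattern E xs))"
    using assms(3) by (intro excess_ge_mismatches[OF assms(1,2)]) (simp add: optimal_colouring_def)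
  then have "536 * real (card (roots E V)) * real (mismatches E V c) \<le> real_of_int (\<Sum>xs\<in>tuples V 6. excess (pattern E xs))"
    by (metis (mono_tags, lifting) of_int_le_iff of_int_mult of_int_numeral of_int_of_nat_eq)
  moreover have "536 * (real (card V) ^ 4 / 4000) * real (mismatches E V c) \<le> 536 * real (card (roots E V)) * real (mismatches E V c)"
    using many_roots[OF assms(1,4)] by (intro mult_right_mono mult_left_mono) auto
  ultimately show ?thesis by (simp add: mult_ac)
qed

text \<open>A graph with almost \<open>n ^ 6 / 3888\<close> copies has little excess in total, hence few mismatches under
an optimal colouring. Passing to the blowup changes the number of copies by little, so \<open>hexpoly\<close> is
almost maximal at its part sizes. The condition on \<open>\<epsilon>\<close> keeps the number of copies above
\<open>n ^ 6 / 4000\<close>.\<close>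

lemma nearly_balanced:
  fixes \<eta> :: real
  assumes "\<eta> > 0"
  shows "\<exists>\<epsilon>>0. \<epsilon> \<le> 1 / 3888 - 1 / 4000 \<and> (\<forall>(V :: 'a set) E c. finite V \<longrightarrow> V \<noteq> {} \<longrightarrow> graphlike E \<longrightarrow> optimal_colouring E V c \<longrightarrow>
    real (copies E V) \<ge> (1 / 3888 - \<epsilon>) * real (card V) ^ 6 \<longrightarrow> (\<forall>i<6. \<bar>real (part_size V c i) - card V / 6\<bar> \<le> \<eta> * card V))"
proof -
  obtain d where d: "d > 0" and close: "\<And>x i. (\<forall>i<6. 0 \<le> x i) \<Longrightarrow> (\<Sum>i<6. x i) = 1 \<Longrightarrow> hexpoly x \<ge> 1 / 3888 - d \<Longrightarrow> i < 6 \<Longrightarrow> \<bar>x i - 1 / 6\<bar> \<le> \<eta>"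
    using hexpoly_close[OF assms] by metis
  \<comment> \<open>the number of mismatches is at most \<open>M * \<epsilon> * n\<^sup>2\<close>, and each destroys at most \<open>36 * n ^ 4\<close> copies\<close>
  define M :: real where "M = 1049760000 * 500 / 67"
  define \<epsilon> where "\<epsilon> = min (1 / 3888 - 1 / 4000) (d / (1 + 36 * M))"
  have \<epsilon>: "\<epsilon> > 0" "\<epsilon> \<le> 1 / 3888 - 1 / 4000" "(1 + 36 * M) * \<epsilon> \<le> d"
    using d by (auto simp: \<epsilon>_def M_def min_def field_simps)
  have "\<bar>real (part_size V c i) - card V / 6\<bar> \<le> \<eta> * card V"
    if V: "finite V" "V \<noteq> {}" and E: "graphlike E" and c: "optimal_colouring E V c"
      and cop: "real (copies E V) \<ge> (1 / 3888 - \<epsilon>) * real (card V) ^ 6" and i: "i < 6" for V :: "'a set" and E c i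
  proof -
    define n where "n = real (card V)"
    have n: "n > 0" using V by (simp add: n_def card_gt_0_iff)
    define e where "e = real (mismatches E V c)"
    have lt: "c x < 6" for x using c by (simp add: optimal_colouring_def)
    have "n ^ 6 / 4000 \<le> (1 / 3888 - \<epsilon>) * n ^ 6" using n \<epsilon>(2) mult_right_mono[of "1/4000" "1 / 3888 - \<epsilon>" "n ^ 6"] by simp
    then have "67 / 500 * e * n ^ 4 \<le> real_of_int (\<Sum>xs\<in>tuples V 6. excess (pattern E xs))"
      using optimal_excess[OF V(1) E c] cop by (simp add: n_def e_def)
    moreover have "0 \<le> real_of_int (sos E V)" by (simp add: sos_nonneg)
    ultimately have "67 / 500 * e * n ^ 4 \<le> 1049760000 * \<epsilon> * n ^ 6"
      using flag_identity_real[OF V(1) E] cop unfolding n_def[symmetric] by (simp add: algebra_simps)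
    then have e: "e * n ^ 4 \<le> M * \<epsilon> * n ^ 6" by (simp add: M_def)
    have "(1 / 3888 - d) * n ^ 6 \<le> (1 / 3888 - (1 + 36 * M) * \<epsilon>) * n ^ 6"
      using \<epsilon>(3) n by (intro mult_right_mono) auto
    also have "\<dots> = (1 / 3888 - \<epsilon>) * n ^ 6 - 36 * (M * \<epsilon> * n ^ 6)" by (simp add: algebra_simps)
    also have "\<dots> \<le> real (copies E V) - 36 * (e * n ^ 4)" using e cop unfolding n_def[symmetric] by linarith
    also have "\<dots> \<le> real (copies (blow c) V)"
      using copies_altered[OF V(1), of E c] unfolding n_def[symmetric] e_def[symmetric] by (simp add: mult_ac)
    also have "\<dots> = hexpoly (\<lambda>i. n * (real (part_size V c i) / n))"
      using copies_blow[OF V(1) lt] n by simp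
    also have "\<dots> = hexpoly (\<lambda>i. real (part_size V c i) / n) * n ^ 6" by (simp only: hexpoly_scale mult.commute)
    finally have "hexpoly (\<lambda>i. real (part_size V c i) / n) \<ge> 1 / 3888 - d" using n by simp
    moreover have "(\<Sum>i<6. real (part_size V c i) / n) = 1"
      using sum_part_size[OF V(1) lt] n unfolding n_def by (simp flip: sum_divide_distrib of_nat_sum)
    ultimately have "\<bar>real (part_size V c i) / n - 1 / 6\<bar> \<le> \<eta>" using close[of "\<lambda>i. real (part_size V c i) / n" i] i n by simp
    then have "\<bar>real (part_size V c i) / n - 1 / 6\<bar> * n \<le> \<eta> * n" using n by (intro mult_right_mono) auto
    moreover have "\<bar>real (part_size V c i) / n - 1 / 6\<bar> * n = \<bar>real (part_size V c i) - n / 6\<bar>"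
      using n abs_mult_pos[of n "real (part_size V c i) / n - 1 / 6"] by (simp add: left_diff_distrib)
    ultimately show ?thesis by (simp add: n_def)
  qed
  then show ?thesis using \<epsilon>(1,2) by blast
qed

text \<open>In the flag identity for the graph and for its blowup, the excess of the graph contributes at least
\<open>67/500 * e * n ^ 4\<close>, where \<open>e\<close> is the number of mismatches. The choice of \<open>\<eta>\<close> lets the
squares consume at most half of it, and the rest must be compensated by copies.\<close>

lemma improvement:
  "\<exists>\<epsilon>>0. \<exists>\<kappa>>0. \<forall>(V :: 'a set) E c. finite V \<longrightarrow> V \<noteq> {} \<longrightarrow> graphlike E \<longrightarrow> optimal_colouring E V c \<longrightarrow>
    real (copies E V) \<ge> (1 / 3888 - \<epsilon>) * real (card V) ^ 6 \<longrightarrow>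
    real (copies (blow c) V) - real (copies E V) \<ge> \<kappa> * real (mismatches E V c) * real (card V) ^ 4"
proof -
  obtain B' where B': "B' \<ge> 0" "\<And>w k m g. (w, k, m, g) \<in> set squares \<Longrightarrow> w \<le> B' \<and> (\<forall>p. \<bar>g p\<bar> \<le> (B'::int))"
    using flags_bounded by fast
  define B where "B = real_of_int B'"
  have B: "0 \<le> B" "\<And>w k m g. (w, k, m, g) \<in> set squares \<Longrightarrow> real_of_int w \<le> B \<and> (\<forall>p. real_of_int \<bar>g p\<bar> \<le> B)"
    using B' unfolding B_def of_int_le_iff by auto
  define Q where "Q = real (length squares) * 7200 * B ^ 3"
  have Q: "Q \<ge> 0" using B(1) by (simp add: Q_def)
  define \<eta> where "\<eta> = 67 / 1000 / (Q + 1)"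
  have \<eta>: "\<eta> > 0" "Q * \<eta> \<le> 67 / 1000" using Q by (auto simp: \<eta>_def field_simps)
  define \<kappa> :: real where "\<kappa> = 67 / 1000 / 1049760000"
  obtain \<epsilon> where \<epsilon>: "\<epsilon> > 0" "\<epsilon> \<le> 1 / 3888 - 1 / 4000" and bal: "\<And>(V :: 'a set) E c i. finite V \<Longrightarrow> V \<noteq> {} \<Longrightarrow> graphlike E \<Longrightarrow> optimal_colouring E V c \<Longrightarrow>
    real (copies E V) \<ge> (1 / 3888 - \<epsilon>) * real (card V) ^ 6 \<Longrightarrow> i < 6 \<Longrightarrow> \<bar>real (part_size V c i) - card V / 6\<bar> \<le> \<eta> * card V"
    using nearly_balanced[OF \<eta>(1), where 'a = 'a] by metis
  have "real (copies (blow c) V) - real (copies E V) \<ge> \<kappa> * real (mismatches E V c) * real (card V) ^ 4"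
    if V: "finite V" "V \<noteq> {}" and E: "graphlike E" and c: "optimal_colouring E V c"
      and cop: "real (copies E V) \<ge> (1 / 3888 - \<epsilon>) * real (card V) ^ 6" for V :: "'a set" and E c
  proof -
    define n where "n = real (card V)"
    define e where "e = real (mismatches E V c)"
    have n: "n \<ge> 0" "e * n ^ 4 \<ge> 0" by (simp_all add: n_def e_def)
    have lt: "c x < 6" for x using c by (simp add: optimal_colouring_def)
    have "n ^ 6 / 4000 \<le> (1 / 3888 - \<epsilon>) * n ^ 6" using n \<epsilon>(2) mult_right_mono[of "1/4000" "1 / 3888 - \<epsilon>" "n ^ 6"] by simp
    then have "67 / 500 * (e * n ^ 4) \<le> real_of_int (\<Sum>xs\<in>tuples V 6. excess (pattern E xs))"
      using optimal_excess[OF V(1) E c] cop by (simp add: n_def e_def)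
    moreover have "real_of_int (sos (blow c) V) - length squares * (7200 * B ^ 3 * \<eta> * mismatches E V c * card V ^ 4) \<le> real_of_int (sos E V)"
      using bal[OF V E c cop] by (intro sos_diff[where \<eta> = \<eta> and B = B, OF V(1) lt B]) auto
    then have "real_of_int (sos (blow c) V) - Q * \<eta> * (e * n ^ 4) \<le> real_of_int (sos E V)"
      by (simp add: Q_def e_def n_def mult_ac)
    moreover have "Q * \<eta> * (e * n ^ 4) \<le> 67 / 1000 * (e * n ^ 4)" using \<eta>(2) n by (intro mult_right_mono) auto
    ultimately have "67 / 1000 * (e * n ^ 4) \<le> 1049760000 * (real (copies (blow c) V) - real (copies E V))"
      using flag_identity_real[OF V(1) E] flag_identity_real[OF V(1) graphlike_blow[of c]] excess_sum_blow[of V c, OF lt]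
      by simp
    then show ?thesis unfolding n_def[symmetric] e_def[symmetric] by (simp add: \<kappa>_def)
  qed
  moreover have "\<kappa> > 0" by (simp add: \<kappa>_def)
  ultimately show ?thesis using \<epsilon>(1) by blast
qed

lemma choose_6_le: "real (n choose 6) \<le> real n ^ 6"
proof (cases "n \<ge> 6")
  case True
  then show ?thesis using binomial_le_pow[OF True] by (metis of_nat_le_iff of_nat_power)
qed (simp add: binomial_eq_0)

text \<open>With fewer than \<open>(1 / 3888 - \<epsilon>) * n ^ 6\<close> copies, the density falls short of the maximum by a
constant. Its limit is \<open>360 * \<epsilon>\<close>, and 100 is an arbitrary smaller factor.\<close>

lemma max_density_gap:
  assumes "\<epsilon> > 0"
  shows "\<exists>n0. \<forall>n\<ge>n0. 100 * \<epsilon> \<le> max_density F24 n - (1 / 3888 - \<epsilon>) * real n ^ 6 / 2 / real (n choose 6)"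
proof -
  have one: "(\<lambda>n. real n / real n) \<longlonglongrightarrow> 1" using near_multiple_limit[of "\<lambda>n. n" 1] by simp
  have "(\<lambda>n. max_density F24 n - (1 / 3888 - \<epsilon>) / 2 / (real (n choose 6) / real n ^ 6)) \<longlonglongrightarrow> 5 / 54 - (1 / 3888 - \<epsilon>) / 2 / (1 / 720)"
    by (intro tendsto_intros max_density_limit choose_6_limit[OF one]) simp
  moreover have "100 * \<epsilon> < 5 / 54 - (1 / 3888 - \<epsilon>) / 2 / (1 / 720)" using assms by (simp add: field_simps)
  ultimately have "\<forall>\<^sub>F n in sequentially. 100 * \<epsilon> < max_density F24 n - (1 / 3888 - \<epsilon>) / 2 / (real (n choose 6) / real n ^ 6)"
    by (rule order_tendstoD(1))
  then obtain n0 where "\<And>n. n \<ge> n0 \<Longrightarrow> 100 * \<epsilon> < max_density F24 n - (1 / 3888 - \<epsilon>) / 2 / (real (n choose 6) / real n ^ 6)"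
    by (auto simp: eventually_sequentially)
  then show ?thesis by (intro exI[of _ n0]) (auto simp: less_imp_le)
qed

text \<open>If the graph has few copies, then the deficit is bounded below by a constant and the trivial bound
\<open>n\<^sup>2\<close> on the mismatches suffices. Otherwise the blowup of the optimal colouring is denser by a
multiple of \<open>e / n\<^sup>2\<close>, and the maximum density is at least its density.\<close>

lemma F24_perfectly_stable: "perfectly_stable F24 C6"
proof -
  obtain \<epsilon> \<kappa> where \<epsilon>: "\<epsilon> > 0" and \<kappa>: "\<kappa> > 0" and improve: "\<And>(V :: nat set) E c. finite V \<Longrightarrow> V \<noteq> {} \<Longrightarrow> graphlike E \<Longrightarrow> optimal_colouring E V c \<Longrightarrow>
    real (copies E V) \<ge> (1 / 3888 - \<epsilon>) * real (card V) ^ 6 \<Longrightarrow>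
    real (copies (blow c) V) - real (copies E V) \<ge> \<kappa> * real (mismatches E V c) * real (card V) ^ 4"
    using improvement[where 'a = nat] by metis
  obtain n0 where gap: "\<And>n. n \<ge> n0 \<Longrightarrow> 100 * \<epsilon> \<le> max_density F24 n - (1 / 3888 - \<epsilon>) * real n ^ 6 / 2 / real (n choose 6)"
    using max_density_gap[OF \<epsilon>] by metis
  \<comment> \<open>\<open>50 / \<kappa>\<close> makes the paths on five vertices negligible; the last two are the constants of the two cases\<close>
  define C where "C = Max {6, real n0, 50 / \<kappa>, 4 / \<kappa>, 1 / (100 * \<epsilon>)}"
  have C: "C \<ge> 6" "C \<ge> real n0" "C \<ge> 50 / \<kappa>" "C \<ge> 4 / \<kappa>" "C \<ge> 1 / (100 * \<epsilon>)" by (simp_all add: C_def)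
  have "real (edit_distance G C6) \<le> C * (max_density F24 n - density F24 G) * (real n)\<^sup>2"
    if G: "simple_graph G" "card (verts G) = n" and n: "real n \<ge> C" for G :: "nat graph" and n
  proof -
    define V E where "V = verts G" and "E = adj G"
    have fin: "finite V" using G(1) by (simp add: V_def simple_graph_def)
    have E: "graphlike E" unfolding E_def by (rule graphlike_adj[OF G(1)])
    have card: "card V = n" using G(2) by (simp add: V_def)
    have n6: "n \<ge> 6" using n C(1) by linarith
    have ne: "V \<noteq> {}" using card n6 by auto
    have choose: "real (n choose 6) > 0" using n6 by simp
    have N: "2 * real (card (F24_sets G)) = real (copies E V) - real (paths E V)"
      unfolding E_def V_def by (rule F24_sets_copies[OF G(1)])
    obtain c where c: "optimal_colouring E V c" using optimal_colouring_exists by blast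
    define e where "e = real (mismatches E V c)"
    have lt: "c x < 6" for x using c by (simp add: optimal_colouring_def)
    have "edit_distance G C6 \<le> mismatches E V c" using edit_distance_le[OF G(1) lt] by (simp add: E_def V_def)
    then have edit: "real (edit_distance G C6) \<le> e" by (simp add: e_def)
    have gap0: "0 \<le> (max_density F24 n - density F24 G) * (real n)\<^sup>2" using density_le_max[OF G] by simp
    have "e \<le> C * ((max_density F24 n - density F24 G) * (real n)\<^sup>2)"
    proof (cases "real (copies E V) \<ge> (1 / 3888 - \<epsilon>) * real n ^ 6")
      case True
      define H where "H = hex_blowup V c"
      note H = hex_blowup_props[where c = c, OF fin lt, folded H_def]
      have "\<kappa> * e * real n ^ 4 \<le> real (copies (blow c) V) - real (copies E V)"
        using improve[OF fin ne E c] True by (simp add: card e_def)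
      moreover have "real (paths (blow c) V) - real (paths E V) \<le> 25 * e * real n ^ 3"
        using paths_altered[OF fin, of E c] by (simp add: card e_def)
      moreover have "25 * e * real n ^ 3 \<le> \<kappa> / 2 * e * real n ^ 4"
      proof -
        have "50 \<le> \<kappa> * real n" using order_trans[OF C(3) n] \<kappa> by (simp add: field_simps)
        then have "(50 * (e * real n ^ 3)) \<le> (\<kappa> * real n) * (e * real n ^ 3)" by (intro mult_right_mono) (simp_all add: e_def)
        then show ?thesis by (simp add: power_Suc[symmetric] mult_ac eval_nat_numeral)
      qed
      moreover have "2 * real (card (F24_sets H)) = real (copies (blow c) V) - real (paths (blow c) V)"
        unfolding H_def F24_sets_blowup[OF fin lt] copies_blow[OF fin lt] ..
      ultimately have "\<kappa> / 4 * e * real n ^ 4 \<le> real (card (F24_sets H)) - real (card (F24_sets G))" using N by linarith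
      then have "\<kappa> / 4 * e * real n ^ 4 / real (n choose 6) \<le> density F24 H - density F24 G"
        using choose unfolding density_F24 H(1) card G(2) diff_divide_distrib[symmetric] by (intro divide_right_mono) auto
      also have "\<dots> \<le> max_density F24 n - density F24 G" using density_le_max[OF H(3), of n] H(1) card by simp
      finally have "\<kappa> / 4 * e * real n ^ 4 / real (n choose 6) \<le> max_density F24 n - density F24 G" .
      moreover have "\<kappa> / 4 * e * real n ^ 4 / real n ^ 6 \<le> \<kappa> / 4 * e * real n ^ 4 / real (n choose 6)"
        using choose choose_6_le[of n] \<kappa> n6 by (intro divide_left_mono) (simp_all add: e_def)
      ultimately have "\<kappa> / 4 * e * real n ^ 4 / real n ^ 6 * (real n)\<^sup>2 \<le> (max_density F24 n - density F24 G) * (real n)\<^sup>2"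
        by (intro mult_right_mono) auto
      moreover have "\<kappa> / 4 * e * real n ^ 4 / real n ^ 6 * (real n)\<^sup>2 = \<kappa> / 4 * e"
        using n6 by (simp add: power_add[symmetric] field_simps)
      ultimately have "e \<le> 4 / \<kappa> * ((max_density F24 n - density F24 G) * (real n)\<^sup>2)" using \<kappa> by (simp add: field_simps)
      also have "\<dots> \<le> C * ((max_density F24 n - density F24 G) * (real n)\<^sup>2)" using C(4) gap0 by (intro mult_right_mono)
      finally show ?thesis .
    next
      case False
      then have "real (card (F24_sets G)) \<le> (1 / 3888 - \<epsilon>) * real n ^ 6 / 2" using N by simp
      then have "density F24 G \<le> (1 / 3888 - \<epsilon>) * real n ^ 6 / 2 / real (n choose 6)"
        unfolding density_F24 G(2) by (intro divide_right_mono) auto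
      moreover have "n \<ge> n0" using n C(2) by linarith
      ultimately have "100 * \<epsilon> \<le> max_density F24 n - density F24 G" using gap[of n] by linarith
      then have "100 * \<epsilon> * (real n)\<^sup>2 \<le> (max_density F24 n - density F24 G) * (real n)\<^sup>2" by (intro mult_right_mono) auto
      then have "(real n)\<^sup>2 \<le> 1 / (100 * \<epsilon>) * ((max_density F24 n - density F24 G) * (real n)\<^sup>2)" using \<epsilon> by (simp add: field_simps)
      also have "\<dots> \<le> C * ((max_density F24 n - density F24 G) * (real n)\<^sup>2)" using C(5) gap0 by (intro mult_right_mono)
      finally have "(real n)\<^sup>2 \<le> C * ((max_density F24 n - density F24 G) * (real n)\<^sup>2)" .
      moreover have "e \<le> (real n)\<^sup>2" using mismatches_le[OF fin, of E c] unfolding card e_def by (metis of_nat_le_iff of_nat_power)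
      ultimately show ?thesis by linarith
    qed
    then show ?thesis using edit by (simp add: mult.assoc)
  qed
  moreover have "C > 0" using C(1) by linarith
  ultimately show ?thesis unfolding perfectly_stable_def by blast
qed

theorem theorem3p11:
  shows "convergent (max_density F24) \<and> inducibility F24 = 5/54
    \<and> perfectly_stable F24 C6
    \<and> unique_maximiser F24 6 C6 (\<lambda>i. if i < 6 then 1/6 else 0)"
  using max_density_limit F24_perfectly_stable unique_maximiser_C6
  by (auto simp: inducibility_def convergent_def limI)

end
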